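(* Let $d\ge1$, $r>d/2$, $s>d/2+r$, $0\le q<s$ and $\kappa>d+1$, and assume that the sampling measures satisfy $\|\nu_m\|_{H^{-r}}\le C_1\delta_m^{r}$ for all $m$, with $C_1$ independent of $m$. Let $h\in C^\kappa([0,\infty))$ satisfy $h(t)=1$ for $0\le t\le1$ and $h(t)=0$ for $t\ge2$, and let $\mathcal F_n$ be the associated filtered hyperinterpolation operator. Then: (i) There is a constant $C>0$, independent of $m$, $n$ and $f$, such that for all $m$, $n\ge1$ and $f\in H^s(\mathbb S^d)$, $$\|f-\mathcal F_nf\|_{H^q}\le C\left(n^{-(s-q)}+\delta_m^{r}n^{r+q}\right)\|f\|_{H^s}.$$ (ii) If $n=n(m)\ge1$ is chosen so that $c_1\delta_m^{-r/(s+r)}\le n\le c_2\delta_m^{-r/(s+r)}$ with constants $c_1,c_2>0$ independent of $m$, then, with $C'$ independent of $m$ and $f$, $$\|f-\mathcal F_nf\|_{H^q}\le C'\,\delta_m^{\frac{r(s-q)}{s+r}}\|f\|_{H^s}.$$ (iii) If, in addition, the sampling sets are quasi-uniform ($\delta_m\le C_0\gamma_m$ for all $m$, with $C_0$ independent of $m$) and $0<w_j\le C_2\delta_m^{d}$ for all $j$ and $m$ with $C_2$ independent of $j,m$, then for every $C_3>0$ there is a constant $C''>0$ independent of $m,n,f$ such that $\|\mathcal F_nf\|_{L^\infty}\le C''\|f\|_{L^\infty}$ for all $f\in C(\mathbb S^d)$ and all $m$ and $n\ge1$ with $n\le C_3\delta_m^{-1}$.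
   Context: $\mathbb S^d=\{x\in\mathbb R^{d+1}:|x|=1\}$ carries the normalized surface measure $\sigma$ ($\sigma(\mathbb S^d)=1$) and the geodesic distance $\rho(x,y)=\arccos(x\cdot y)$. For each $\ell\ge0$, $\{Y_{\ell,k}:1\le k\le Z(d,\ell)\}$ is an $L^2(\mathbb S^d,\sigma)$-orthonormal basis of the (real) spherical harmonics of degree $\ell$; $\lambda_\ell=\ell(\ell+d-1)$ is the corresponding eigenvalue of $-\Delta_{\mathbb S^d}$. For a distribution $u$ put $\widehat u_{\ell,k}=\langle u,Y_{\ell,k}\rangle$. For $s\in\mathbb R$, $H^s(\mathbb S^d)$ is the space of distributions with $\|u\|_{H^s}^2=\sum_{\ell\ge0}(1+\lambda_\ell)^s\sum_k|\widehat u_{\ell,k}|^2<\infty$; for $s>d/2$ its elements are identified with their continuous representatives. Sampling: for each $m$ (in an infinite set of positive integers, with $m\ge2$ whenever $\gamma_m$ is used) there are a point set $\mathcal X_m=\{x_j\}_{j=1}^m\subset\mathbb S^d$ and weights $w_j>0$ with $\sum_{j=1}^mw_j=1$ (points and weights may depend on $m$). The mesh norm is $\delta_m=\sup_{x\in\mathbb S^d}\min_{j}\rho(x,x_j)$ and the separation radius is $\gamma_m=\tfrac12\min_{i\ne j}\rho(x_i,x_j)$. Set $\nu_m=\sum_{j=1}^mw_j\delta_{x_j}-\sigma$, where $\delta_{x_j}$ is the Dirac mass at $x_j$. For $n\ge1$, $\mathcal F_nf(x)=\sum_{j=1}^mw_jf(x_j)\Phi_n(x,x_j)$ with kernel $\Phi_n(x,y)=\sum_{\ell\ge0}h(\ell/n)\sum_kY_{\ell,k}(x)Y_{\ell,k}(y)$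 (a finite sum); $\mathcal F_n$ depends on $m$ as well as $n$. *)

theory Defs
  imports "HOL-Probability.Probability"
begin

text \<open>
  The sphere is \<open>sphere (0 :: 'a) 1\<close> in a Euclidean space \<open>'a\<close> of dimension \<open>d + 1\<close>. Functions
  on the sphere are represented by functions on all of \<open>'a\<close>; every notion below depends only on
  their values on the sphere.
\<close>

subsection \<open>Geodesic distance and surface measure\<close>

definition geodist :: "'a::euclidean_space \<Rightarrow> 'a \<Rightarrow> real" where
  "geodist x y = arccos (x \<bullet> y)"

text \<open>
  The normalized surface measure: the measure of a Borel set \<open>A\<close> of the sphere is the proportion of
  the unit ball filled by the cone \<open>{t x | x \<in> A, 0 < t < 1}\<close>. Restricting the space to the sphere
  makes functions that are continuous on the sphere measurable, whatever their values elsewhere.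
\<close>
definition sphere_measure :: "'a::euclidean_space measure" where
  "sphere_measure =
     restrict_space (distr (uniform_measure lborel (ball 0 1)) borel sgn) (sphere 0 1)"

subsection \<open>Spherical harmonics\<close>

text \<open>Iterated partial derivatives along the vectors of a list, the last one of the list first.\<close>
primrec iter_partial ::
    "'a::euclidean_space list \<Rightarrow> ('a \<Rightarrow> real) \<Rightarrow> 'a \<Rightarrow> real" where
  "iter_partial [] f = f"
| "iter_partial (b # bs) f = (\<lambda>x. frechet_derivative (iter_partial bs f) (at x) b)"

definition laplacian :: "('a::euclidean_space \<Rightarrow> real) \<Rightarrow> 'a \<Rightarrow> real" where
  "laplacian f x = (\<Sum>b\<in>Basis. iter_partial [b, b] f x)"

definition spherical_harmonics :: "nat \<Rightarrow> ('a::euclidean_space \<Rightarrow> real) set" where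
  "spherical_harmonics l =
     {g. \<exists>p. real_polynomial_function p \<and> (\<forall>c x. p (c *\<^sub>R x) = c ^ l * p x) \<and>
             (\<forall>x. laplacian p x = 0) \<and> (\<forall>x\<in>sphere 0 1. g x = p x)}"

text \<open>
  For every degree \<open>l\<close>, the functions \<open>Y l k\<close> with \<open>1 \<le> k \<le> Z l\<close> form an orthonormal basis of the
  spherical harmonics of degree \<open>l\<close>. This forces \<open>Z l\<close> to be the dimension of that space.
\<close>
definition harmonic_onb ::
    "(nat \<Rightarrow> nat) \<Rightarrow> (nat \<Rightarrow> nat \<Rightarrow> 'a::euclidean_space \<Rightarrow> real) \<Rightarrow> bool" where
  "harmonic_onb Z Y \<longleftrightarrow>
     (\<forall>l. (\<forall>k\<in>{1..Z l}. Y l k \<in> spherical_harmonics l) \<and>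
          (\<forall>j\<in>{1..Z l}. \<forall>k\<in>{1..Z l}.
             (\<integral>x. Y l j x * Y l k x \<partial>sphere_measure) = (if j = k then 1 else 0)) \<and>
          (\<forall>g\<in>spherical_harmonics l. \<exists>c. \<forall>x\<in>sphere 0 1. g x = (\<Sum>k=1..Z l. c k * Y l k x)))"

definition lb_eigenvalue :: "nat \<Rightarrow> nat \<Rightarrow> real" where
  "lb_eigenvalue d l = real l * (real l + real d - 1)"

subsection \<open>Distributions and Sobolev spaces\<close>

text \<open>
  Smoothness of a function on the sphere and the seminorms of the test function space are expressed
  through the extension that is constant along rays.
\<close>
definition radial_ext :: "('a::euclidean_space \<Rightarrow> real) \<Rightarrow> 'a \<Rightarrow> real" where
  "radial_ext \<phi> = (\<lambda>x. \<phi> (sgn x))"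

definition test_functions :: "('a::euclidean_space \<Rightarrow> real) set" where
  "test_functions =
     {\<phi>. \<forall>bs\<in>lists Basis. iter_partial bs (radial_ext \<phi>) differentiable_on - {0}}"

definition test_seminorm :: "nat \<Rightarrow> ('a::euclidean_space \<Rightarrow> real) \<Rightarrow> real" where
  "test_seminorm N \<phi> =
     (\<Sum>bs\<in>{bs \<in> lists Basis. length bs \<le> N}.
        SUP x\<in>sphere 0 1. \<bar>iter_partial bs (radial_ext \<phi>) x\<bar>)"

definition sphere_distribution :: "(('a::euclidean_space \<Rightarrow> real) \<Rightarrow> real) \<Rightarrow> bool" where
  "sphere_distribution u \<longleftrightarrow>
     (\<forall>\<phi>\<in>test_functions. \<forall>\<psi>\<in>test_functions. \<forall>a b.
        u (\<lambda>x. a * \<phi> x + b * \<psi> x) = a * u \<phi> + b * u \<psi>) \<and>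
     (\<exists>N C. \<forall>\<phi>\<in>test_functions. \<bar>u \<phi>\<bar> \<le> C * test_seminorm N \<phi>)"

definition distribution_of :: "('a::euclidean_space \<Rightarrow> real) \<Rightarrow> ('a \<Rightarrow> real) \<Rightarrow> real" where
  "distribution_of f \<phi> = (\<integral>x. f x * \<phi> x \<partial>sphere_measure)"

definition sobolev_term ::
    "nat \<Rightarrow> (nat \<Rightarrow> nat) \<Rightarrow> (nat \<Rightarrow> nat \<Rightarrow> 'a::euclidean_space \<Rightarrow> real) \<Rightarrow> real \<Rightarrow>
     (('a \<Rightarrow> real) \<Rightarrow> real) \<Rightarrow> nat \<Rightarrow> real" where
  "sobolev_term d Z Y s u l = (1 + lb_eigenvalue d l) powr s * (\<Sum>k=1..Z l. \<bar>u (Y l k)\<bar>\<^sup>2)"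

definition sobolev_space ::
    "nat \<Rightarrow> (nat \<Rightarrow> nat) \<Rightarrow> (nat \<Rightarrow> nat \<Rightarrow> 'a::euclidean_space \<Rightarrow> real) \<Rightarrow> real \<Rightarrow>
     (('a \<Rightarrow> real) \<Rightarrow> real) set" where
  "sobolev_space d Z Y s = {u. sphere_distribution u \<and> summable (sobolev_term d Z Y s u)}"

text \<open>Only meaningful on \<^const>\<open>sobolev_space\<close>, since divergent series have a junk value.\<close>
definition sobolev_norm ::
    "nat \<Rightarrow> (nat \<Rightarrow> nat) \<Rightarrow> (nat \<Rightarrow> nat \<Rightarrow> 'a::euclidean_space \<Rightarrow> real) \<Rightarrow> real \<Rightarrow>
     (('a \<Rightarrow> real) \<Rightarrow> real) \<Rightarrow> real" where
  "sobolev_norm d Z Y s u = sqrt (\<Sum>l. sobolev_term d Z Y s u l)"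

text \<open>
  For \<open>s > d / 2\<close> every member of the Sobolev space has a unique continuous representative; these
  representatives are the elements of the following set.
\<close>
definition sobolev_functions ::
    "nat \<Rightarrow> (nat \<Rightarrow> nat) \<Rightarrow> (nat \<Rightarrow> nat \<Rightarrow> 'a::euclidean_space \<Rightarrow> real) \<Rightarrow> real \<Rightarrow>
     ('a \<Rightarrow> real) set" where
  "sobolev_functions d Z Y s =
     {f. continuous_on (sphere 0 1) f \<and> distribution_of f \<in> sobolev_space d Z Y s}"

definition Linf_norm :: "('a::euclidean_space \<Rightarrow> real) \<Rightarrow> ereal" where
  "Linf_norm f = esssup sphere_measure (\<lambda>x. ereal \<bar>f x\<bar>)"

subsection \<open>Sampling points and filtered hyperinterpolation\<close>

definition mesh_norm :: "nat \<Rightarrow> (nat \<Rightarrow> 'a::euclidean_space) \<Rightarrow> real" where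
  "mesh_norm m x = (SUP y\<in>sphere 0 1. Min ((\<lambda>j. geodist y (x j)) ` {1..m}))"

definition separation_radius :: "nat \<Rightarrow> (nat \<Rightarrow> 'a::euclidean_space) \<Rightarrow> real" where
  "separation_radius m x =
     1 / 2 * Min {geodist (x i) (x j) | i j. i \<in> {1..m} \<and> j \<in> {1..m} \<and> i \<noteq> j}"

text \<open>The signed measure \<open>\<Sum>j. w j \<delta>\<^bsub>x j\<^esub> - \<sigma>\<close> as a distribution.\<close>
definition sampling_discrepancy ::
    "nat \<Rightarrow> (nat \<Rightarrow> 'a::euclidean_space) \<Rightarrow> (nat \<Rightarrow> real) \<Rightarrow> ('a \<Rightarrow> real) \<Rightarrow> real" where
  "sampling_discrepancy m x w \<phi> =
     (\<Sum>j=1..m. w j * \<phi> (x j)) - (\<integral>y. \<phi> y \<partial>sphere_measure)"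

text \<open>
  The class \<open>C\<^sup>\<kappa>\<close> on \<open>[0, \<infinity>)\<close> for real \<open>\<kappa> \<ge> 0\<close>, with one-sided derivatives at \<open>0\<close>. For integer
  \<open>\<kappa>\<close> this is \<open>\<kappa>\<close>-fold continuous differentiability; otherwise the derivative of order \<open>\<lfloor>\<kappa>\<rfloor>\<close> is
  in addition locally Hoelder continuous with exponent \<open>\<kappa> - \<lfloor>\<kappa>\<rfloor>\<close>.
\<close>
definition C_class :: "real \<Rightarrow> (real \<Rightarrow> real) \<Rightarrow> bool" where
  "C_class \<kappa> h \<longleftrightarrow>
     (\<exists>D :: nat \<Rightarrow> real \<Rightarrow> real.
        (\<forall>t\<ge>0. D 0 t = h t) \<and>
        (\<forall>i < nat \<lfloor>\<kappa>\<rfloor>. \<forall>t\<ge>0. (D i has_real_derivative D (Suc i) t) (at t within {0..})) \<and>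
        continuous_on {0..} (D (nat \<lfloor>\<kappa>\<rfloor>)) \<and>
        (\<kappa> \<notin> \<int> \<longrightarrow> (\<forall>R. \<exists>L. \<forall>t\<in>{0..R}. \<forall>t'\<in>{0..R}.
           \<bar>D (nat \<lfloor>\<kappa>\<rfloor>) t - D (nat \<lfloor>\<kappa>\<rfloor>) t'\<bar> \<le> L * \<bar>t - t'\<bar> powr (\<kappa> - \<lfloor>\<kappa>\<rfloor>))))"

definition filter_kernel ::
    "(nat \<Rightarrow> nat) \<Rightarrow> (nat \<Rightarrow> nat \<Rightarrow> 'a::euclidean_space \<Rightarrow> real) \<Rightarrow> (real \<Rightarrow> real) \<Rightarrow> nat \<Rightarrow>
     'a \<Rightarrow> 'a \<Rightarrow> real" where
  "filter_kernel Z Y h n x y = (\<Sum>l. h (real l / real n) * (\<Sum>k=1..Z l. Y l k x * Y l k y))"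

definition filtered_hyperinterpolation ::
    "(nat \<Rightarrow> nat) \<Rightarrow> (nat \<Rightarrow> nat \<Rightarrow> 'a::euclidean_space \<Rightarrow> real) \<Rightarrow> (real \<Rightarrow> real) \<Rightarrow>
     nat \<Rightarrow> (nat \<Rightarrow> 'a) \<Rightarrow> (nat \<Rightarrow> real) \<Rightarrow> nat \<Rightarrow> ('a \<Rightarrow> real) \<Rightarrow> 'a \<Rightarrow> real" where
  "filtered_hyperinterpolation Z Y h m x w n f y =
     (\<Sum>j=1..m. w j * f (x j) * filter_kernel Z Y h n y (x j))"

end

theory Submission
  imports Defs
begin

text \<open>
  (i) The Fourier coefficients of \<open>F f\<close> are those of \<open>f\<close> multiplied by \<open>h (l / n)\<close>, up to the
  aliasing errors \<open>h (l / n) \<nu> (f Y\<^bsub>l,k\<^esub>)\<close>. By duality the weighted square sum of the aliasing errors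
  is \<open>\<nu> (f P)\<close> for a polynomial \<open>P\<close> of degree \<open>2 n\<close>, and it is bounded by the norm of \<open>\<nu>\<close> in \<open>H\<^sup>-\<^sup>r\<close>
  times that of \<open>f P\<close> in \<open>H\<^sup>r\<close>. Multiplication by the component \<open>f\<^sub>l\<close> of degree \<open>l\<close> has norm at most a
  multiple of \<open>(1 + l)\<^sup>r sup |f\<^sub>l|\<close> on \<open>H\<^sup>r\<close>, and these numbers are summable because \<open>s > d / 2 + r\<close>.

  (iii) Multiplying the kernel by \<open>1 - x \<bullet> y\<close> turns its coefficients into a second-order difference of
  them, which smoothness of \<open>h\<close> makes small; this gives a weighted \<open>L\<^sup>2\<close> bound for the kernel.
  The Marcinkiewicz-Zygmund inequality transfers it from the sphere to the sampling points: the
  square of a harmonic polynomial is at most its average over a ball, and the balls around separated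
  points are disjoint. The Cauchy-Schwarz inequality then bounds the sum of the kernel over the
  sampling points.
\<close>

section \<open>The surface measure in polar coordinates\<close>

text \<open>The measure is given by cones in the ball, so a sphere integral is an expectation over
  the ball of a function of the direction, and all identities are derived in Euclidean space.
  Orthogonality of degrees, mean values and the even moments of \<open>x \<bullet> y\<close> all
  come from one of them, \<open>sphere_integral_laplacian\<close>. The size of zonal kernels comes
  from a three-term recurrence, which also shows how \<open>1 - x \<bullet> y\<close> acts on
  coefficients.

  In (i) the obstacle is that \<open>f P\<close> is not a polynomial; expanding \<open>f\<close> in
  uniformly convergent components is what costs the \<open>d / 2\<close> in
  \<open>s > d / 2 + r\<close>. Duality bounds the aliasing square sum by a multiple of its own
  root.

  In (iii) the kernel is multiplied by the power \<open>k\<close> of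
  \<open>1 + n\<^sup>2 * (1 - x \<bullet> y)\<close>. Every factor costs two differences of the
  coefficients, hence \<open>2 * k\<close> derivatives of \<open>h\<close>, while summability of the
  inverse square of the weight asks for \<open>2 * k \<ge> (d + 1) / 2\<close>. The choice
  \<open>k = (d + 1) div 2\<close> satisfies both.\<close>

abbreviation unit_ball_measure :: "'a::euclidean_space measure" where
  "unit_ball_measure \<equiv> uniform_measure lborel (ball 0 1)"

lemma emeasure_unit_ball:
  "emeasure lborel (ball (0::'a::euclidean_space) 1) \<noteq> 0"
  "emeasure lborel (ball (0::'a::euclidean_space) 1) \<noteq> \<infinity>"
proof -
  have "measure lborel (ball (0::'a) 1) > 0" by (rule content_ball_pos) simp
  then show "emeasure lborel (ball (0::'a) 1) \<noteq> 0" by (auto simp: measure_def)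
  show "emeasure lborel (ball (0::'a::euclidean_space) 1) \<noteq> \<infinity>"
    using emeasure_lborel_ball_finite[of "0::'a" 1] by simp
qed

interpretation unit_ball: prob_space "unit_ball_measure :: 'a::euclidean_space measure"
  by (intro prob_space_uniform_measure) (use emeasure_unit_ball in auto)

lemma borel_measurable_sgn [measurable]:
  "(sgn :: 'a::euclidean_space \<Rightarrow> 'a) \<in> borel_measurable borel"
  unfolding sgn_div_norm by measurable

lemma AE_unit_ball: "AE x in unit_ball_measure. x \<noteq> (0::'a::euclidean_space) \<and> norm x < 1"
proof (rule AE_uniform_measureI)
  show "AE x in lborel. x \<in> ball 0 1 \<longrightarrow> x \<noteq> (0::'a) \<and> norm x < 1"
    using AE_lborel_singleton[of "0::'a"] by eventually_elim auto
qed simp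

lemma emeasure_lborel_scale_vimage:
  fixes A :: "'a::euclidean_space set"
  assumes [measurable]: "A \<in> sets borel" and "c > 0"
  shows "emeasure lborel A = ennreal (c ^ DIM('a)) * emeasure lborel ((\<lambda>x. t + c *\<^sub>R x) -` A)"
proof -
  have "emeasure lborel A
      = emeasure (density (distr lborel borel (\<lambda>x. t + c *\<^sub>R x)) (\<lambda>_. \<bar>c\<bar>^DIM('a))) A"
    using lborel_affine[of c t] assms by simp
  also have "\<dots> = ennreal (c ^ DIM('a)) * emeasure lborel ((\<lambda>x. t + c *\<^sub>R x) -` A)"
    using assms by (simp add: emeasure_density nn_integral_cmult_indicator emeasure_distr)
  finally show ?thesis .
qed

text \<open>Dilation by \<open>a\<close> maps the cone over \<open>A\<close> cut at radius 1 onto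
  the cone cut at radius \<open>a\<close>, hence the factor. This product form is what makes radius
  and direction independent.\<close>

lemma measure_unit_ball_norm_less:
  fixes A :: "'a::euclidean_space set"
  assumes [measurable]: "A \<in> sets borel" and a: "0 \<le> a" "a \<le> 1"
  shows "measure unit_ball_measure {x. norm x < a \<and> sgn x \<in> A}
       = a ^ DIM('a) * measure unit_ball_measure {x. sgn x \<in> A}"
proof (cases "a = 0")
  case True
  then show ?thesis by (simp add: power_0_left)
next
  case False
  with a have "a > 0" by simp
  let ?T = "\<lambda>a. {x::'a. norm x < a \<and> sgn x \<in> A}"
  have meas [measurable]: "?T a \<in> sets borel" for a by measurable
  have vim: "(\<lambda>x. 0 + a *\<^sub>R x) -` ?T a = ?T 1"
    using \<open>a > 0\<close> by (auto simp: sgn_scaleR)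
  have "emeasure lborel (?T a) = ennreal (a ^ DIM('a)) * emeasure lborel (?T 1)"
    using emeasure_lborel_scale_vimage[OF meas \<open>a > 0\<close>, of a 0] unfolding vim .
  then have "measure lborel (?T a) = a ^ DIM('a) * measure lborel (?T 1)"
    using a by (simp add: measure_def enn2real_mult)
  moreover have "ball 0 1 \<inter> ?T a = ?T a" "ball 0 1 \<inter> {x. sgn x \<in> A} = ?T 1"
    using a by auto
  moreover have "measure unit_ball_measure X = measure lborel (ball 0 1 \<inter> X) / measure lborel (ball (0::'a) 1)"
    if "X \<in> sets borel" for X :: "'a set"
    using that emeasure_unit_ball by (intro measure_uniform_measure) auto
  moreover have "{x::'a. sgn x \<in> A} \<in> sets borel" by measurable
  ultimately show ?thesis by simp
qed

text \<open>The direction enters through a real function \<open>g\<close> because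
  \<open>indep_var\<close> wants both variables to have values in one type.\<close>

lemma indep_norm_sgn:
  fixes g :: "'a::euclidean_space \<Rightarrow> real"
  assumes [measurable]: "g \<in> borel_measurable borel"
  shows "unit_ball.indep_var borel (norm :: 'a \<Rightarrow> real) borel (\<lambda>x. g (sgn x))"
proof -
  let ?E = "{(norm :: 'a \<Rightarrow> real) -` A \<inter> UNIV | A. A \<in> range lessThan}"
  let ?F = "{(\<lambda>x. g (sgn x)) -` A \<inter> UNIV | A. A \<in> sets borel}"
  \<comment> \<open>The half-lines form an intersection-stable generator of the Borel sets, so the
    factorization has to be computed only for events \<open>norm x < a\<close>.\<close>
  have ind: "unit_ball.indep_set ?E ?F"
  proof (rule unit_ball.indep_setI)
    fix U V assume "U \<in> ?E" "V \<in> ?F"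
    then obtain a B where U: "U = {x. norm x < a}" and V: "V = {x. g (sgn x) \<in> B}"
      and [measurable]: "B \<in> sets borel" by auto
    define A where "A = g -` B"
    have [measurable]: "A \<in> sets borel"
      using measurable_sets[OF assms \<open>B \<in> sets borel\<close>] by (simp add: A_def)
    have V: "V = {x. sgn x \<in> A}" unfolding V A_def by simp
    have UV: "U \<inter> V = {x. norm x < a \<and> sgn x \<in> A}" unfolding U V by auto
    consider "a < 0" | "0 \<le> a" "a \<le> 1" | "a > 1" by linarith
    then show "unit_ball.prob (U \<inter> V) = unit_ball.prob U * unit_ball.prob V"
    proof cases
      case 1
      have "\<not> norm x < a" for x :: 'a using 1 norm_ge_zero[of x] by linarith
      then show ?thesis unfolding U by simp
    next
      case 2
      have "unit_ball.prob {x::'a. norm x < a} = a ^ DIM('a)"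
        using measure_unit_ball_norm_less[of "UNIV :: 'a set" a] 2 unit_ball.prob_space[where 'a = 'a] by simp
      then show ?thesis
        using measure_unit_ball_norm_less[of A a] 2 unfolding UV unfolding U V by simp
    next
      case 3
      have "unit_ball.prob {x::'a. norm x < a} = unit_ball.prob (UNIV :: 'a set)"
        by (rule unit_ball.finite_measure_eq_AE; (measurable)?)
           (rule AE_mp[OF AE_unit_ball], use 3 in auto)
      then have "unit_ball.prob {x::'a. norm x < a} = 1"
        using unit_ball.prob_space[where 'a = 'a] by simp
      moreover have "unit_ball.prob (U \<inter> V) = unit_ball.prob V"
        unfolding UV unfolding V
        by (rule unit_ball.finite_measure_eq_AE; (measurable)?)
           (rule AE_mp[OF AE_unit_ball], use 3 in auto)
      ultimately show ?thesis unfolding U by simp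
    qed
  next
    have "norm -` {..<a} \<in> sets (borel :: 'a measure)" for a
    proof -
      have "{x::'a. norm x < a} \<in> sets borel" by measurable
      then show ?thesis by (simp add: vimage_def)
    qed
    then show "?E \<subseteq> unit_ball.events" by auto
  next
    show "?F \<subseteq> unit_ball.events"
      by (auto intro!: measurable_sets[where M = borel and f = "\<lambda>x. g (sgn x)", simplified])
  qed
  have E: "Int_stable ?E"
  proof -
    have "?E = range (\<lambda>a. {x::'a. norm x < a})" by (auto simp: vimage_def)
    also have "Int_stable \<dots>"
    proof (rule Int_stableI_image)
      fix a b :: real
      show "\<exists>c\<in>UNIV. {x::'a. norm x < a} \<inter> {x. norm x < b} = {x. norm x < c}"
        by (rule bexI[of _ "min a b"]) auto
    qed
    finally show ?thesis .
  qed
  have F: "Int_stable ?F"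
  proof (rule Int_stableI)
    fix U V assume "U \<in> ?F" "V \<in> ?F"
    then obtain A B where "U = (\<lambda>x. g (sgn x)) -` A" "V = (\<lambda>x. g (sgn x)) -` B"
      "A \<in> sets borel" "B \<in> sets borel" by auto
    then show "U \<inter> V \<in> ?F" by (auto intro!: exI[of _ "A \<inter> B"])
  qed
  have "unit_ball.indep_set (sigma_sets UNIV ?E) (sigma_sets UNIV ?F)"
    using unit_ball.indep_set_sigma_sets[OF ind E F] by simp
  moreover have "sigma_sets UNIV ?E
      = sigma_sets UNIV {norm -` A \<inter> UNIV | A. A \<in> sets (borel :: real measure)}"
  proof -
    have "sigma_sets UNIV ?E = {norm -` A \<inter> UNIV | A. A \<in> sigma_sets UNIV (range lessThan)}"
      by (rule sigma_sets_vimage_commute[symmetric]) auto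
    also have "sigma_sets UNIV (range lessThan) = sets (borel :: real measure)"
      by (simp add: borel_Iio)
    also have "{(norm :: 'a \<Rightarrow> real) -` A \<inter> UNIV | A. A \<in> sets borel}
        = {norm -` A \<inter> UNIV | A. A \<in> sigma_sets UNIV (sets borel)}"
      by (simp add: sets.sigma_sets_eq[of borel, simplified])
    also have "\<dots> = sigma_sets UNIV {norm -` A \<inter> UNIV | A. A \<in> sets borel}"
      by (rule sigma_sets_vimage_commute) auto
    finally show ?thesis .
  qed
  ultimately show ?thesis
    unfolding unit_ball.indep_var_eq by simp
qed

subsection \<open>Integration over the sphere\<close>

lemma space_sphere_measure [simp]: "space sphere_measure = sphere 0 1"
  by (simp add: sphere_measure_def space_restrict_space)

lemma sets_sphere_measure: "sets sphere_measure = sets (restrict_space borel (sphere 0 1))"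
  unfolding sphere_measure_def by (rule sets_restrict_space_cong) simp

lemma borel_measurable_sphere_measure:
  fixes f :: "'a::euclidean_space \<Rightarrow> real"
  assumes "continuous_on (sphere 0 1) f"
  shows "f \<in> borel_measurable sphere_measure"
  using borel_measurable_continuous_on_restrict[OF assms]
  by (simp add: measurable_cong_sets[OF sets_sphere_measure refl])

lemma AE_sgn_sphere: "AE x in unit_ball_measure. sgn x \<in> sphere (0::'a::euclidean_space) 1"
  by (rule AE_mp[OF AE_unit_ball]) (auto simp: norm_sgn)

lemma borel_measurable_sphere_indicator:
  fixes f :: "'a::euclidean_space \<Rightarrow> real"
  assumes "continuous_on (sphere 0 1) f"
  shows "(\<lambda>x. indicator (sphere 0 1) x *\<^sub>R f x) \<in> borel_measurable borel"
  using borel_measurable_continuous_on_indicator[OF _ assms]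
  by simp

text \<open>The indicator discards the values of \<open>f\<close> off the sphere, in particular at
  \<open>sgn 0 = 0\<close>, about which continuity on the sphere says nothing.\<close>

lemma sphere_integral_eq:
  fixes f :: "'a::euclidean_space \<Rightarrow> real"
  assumes "continuous_on (sphere 0 1) f"
  shows "(\<integral>x. f x \<partial>sphere_measure)
       = (\<integral>x. indicator (sphere 0 1) (sgn x) *\<^sub>R f (sgn x) \<partial>unit_ball_measure)"
proof -
  have "(\<integral>x. f x \<partial>sphere_measure)
      = (\<integral>x. indicator (sphere 0 1) x *\<^sub>R f x \<partial>distr unit_ball_measure borel sgn)"
    unfolding sphere_measure_def by (subst integral_restrict_space) auto
  also have "\<dots> = (\<integral>x. indicator (sphere 0 1) (sgn x) *\<^sub>R f (sgn x) \<partial>unit_ball_measure)"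
    using borel_measurable_sphere_indicator[OF assms] by (subst integral_distr) auto
  finally show ?thesis .
qed

interpretation sphere: prob_space "sphere_measure :: 'a::euclidean_space measure"
proof
  have "emeasure (sphere_measure :: 'a measure) (sphere 0 1)
      = emeasure unit_ball_measure {x::'a. sgn x \<in> sphere 0 1}"
    unfolding sphere_measure_def
    by (subst emeasure_restrict_space) (auto simp: emeasure_distr vimage_def)
  also have "\<dots> = emeasure unit_ball_measure (space (unit_ball_measure :: 'a measure))"
    by (rule emeasure_eq_AE) (use AE_sgn_sphere in auto)
  finally show "emeasure (sphere_measure :: 'a measure) (space sphere_measure) = 1"
    using unit_ball.emeasure_space_1 by simp
qed

lemma sphere_bounded:
  fixes f :: "'a::euclidean_space \<Rightarrow> real"
  assumes "continuous_on (sphere 0 1) f"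
  obtains B where "B \<ge> 0" "\<And>x. x \<in> sphere 0 1 \<Longrightarrow> \<bar>f x\<bar> \<le> B"
proof -
  have "bounded (f ` sphere 0 1)"
    using assms compact_continuous_image compact_imp_bounded compact_sphere by blast
  then obtain B where "\<forall>x\<in>sphere 0 1. \<bar>f x\<bar> \<le> B" by (auto simp: bounded_iff)
  then show ?thesis by (intro that[of "max B 0"]) fastforce+
qed

lemma integrable_sphere [intro]:
  fixes f :: "'a::euclidean_space \<Rightarrow> real"
  assumes "continuous_on (sphere 0 1) f"
  shows "integrable sphere_measure f"
proof -
  obtain B where B: "\<And>x. x \<in> sphere 0 1 \<Longrightarrow> \<bar>f x\<bar> \<le> B" using sphere_bounded[OF assms] by blast
  show ?thesis
    by (rule sphere.integrable_const_bound[of _ B])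
       (use B assms borel_measurable_sphere_measure in \<open>auto intro!: AE_I2\<close>)
qed

text \<open>Independence factors the expectation of a radial times an angular function. The product
  formula for \<open>f\<close> is asked only away from the origin, because \<open>sgn 0\<close> is
  not on the sphere; the origin is a null set.\<close>

theorem polar_integral:
  fixes g :: "'a::euclidean_space \<Rightarrow> real" and \<phi> :: "real \<Rightarrow> real"
  assumes g: "continuous_on (sphere 0 1) g" and [measurable]: "\<phi> \<in> borel_measurable borel"
    and B: "\<And>t. 0 \<le> t \<Longrightarrow> t < 1 \<Longrightarrow> \<bar>\<phi> t\<bar> \<le> B"
    and f: "\<And>x. x \<noteq> 0 \<Longrightarrow> norm x < 1 \<Longrightarrow> f x = \<phi> (norm x) * g (sgn x)"
    and [measurable]: "f \<in> borel_measurable borel"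
  shows "integrable unit_ball_measure f"
    and "(\<integral>x. f x \<partial>unit_ball_measure)
       = (\<integral>x. \<phi> (norm x) \<partial>(unit_ball_measure :: 'a measure)) * (\<integral>x. g x \<partial>sphere_measure)"
proof -
  define G where "G x = indicator (sphere 0 1) x *\<^sub>R g x" for x
  obtain K where K: "\<And>x. x \<in> sphere 0 1 \<Longrightarrow> \<bar>g x\<bar> \<le> K" and "K \<ge> 0"
    using sphere_bounded[OF g] by blast
  have [measurable]: "G \<in> borel_measurable borel"
    using borel_measurable_sphere_indicator[OF g] by (simp add: G_def[abs_def])
  have iG: "integrable unit_ball_measure (\<lambda>x. G (sgn x))"
    by (rule unit_ball.integrable_const_bound[of _ K]; (measurable)?)
       (use K \<open>K \<ge> 0\<close> in \<open>auto simp: G_def indicator_def\<close>)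
  have i\<phi>: "integrable unit_ball_measure (\<lambda>x::'a. \<phi> (norm x))"
    by (rule unit_ball.integrable_const_bound[of _ B]; (measurable)?)
       (rule AE_mp[OF AE_unit_ball], use B in auto)
  have ind: "unit_ball.indep_var borel (\<lambda>x::'a. \<phi> (norm x)) borel (\<lambda>x. G (sgn x))"
    using unit_ball.indep_var_compose[OF indep_norm_sgn[of G] \<open>\<phi> \<in> borel_measurable borel\<close>
        measurable_ident_sets[OF refl]]
    by (simp add: o_def)
  have ae: "AE x in unit_ball_measure. f x = \<phi> (norm x) * G (sgn x)"
    by (rule AE_mp[OF AE_unit_ball]) (auto simp: f G_def norm_sgn)
  have "integrable unit_ball_measure (\<lambda>x. \<phi> (norm x) * G (sgn x))"
    using unit_ball.indep_var_integrable[OF ind i\<phi> iG] .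
  then show "integrable unit_ball_measure f"
    by (subst integrable_cong_AE[OF _ _ ae]; (measurable)?)
  have "(\<integral>x. f x \<partial>unit_ball_measure) = (\<integral>x. \<phi> (norm x) * G (sgn x) \<partial>unit_ball_measure)"
    by (rule integral_cong_AE[OF _ _ ae]; measurable)
  also have "\<dots> = (\<integral>x. \<phi> (norm x) \<partial>(unit_ball_measure :: 'a measure)) * (\<integral>x. G (sgn x) \<partial>unit_ball_measure)"
    using unit_ball.indep_var_lebesgue_integral[OF ind i\<phi> iG] .
  also have "(\<integral>x. G (sgn x) \<partial>unit_ball_measure) = (\<integral>x. g x \<partial>sphere_measure)"
    unfolding sphere_integral_eq[OF g] G_def ..
  finally show "(\<integral>x. f x \<partial>unit_ball_measure)
       = (\<integral>x. \<phi> (norm x) \<partial>(unit_ball_measure :: 'a measure)) * (\<integral>x. g x \<partial>sphere_measure)" .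
qed

text \<open>If \<open>f z > c\<close>, then \<open>f\<close> exceeds \<open>c\<close> in all
  directions near \<open>z\<close>, and these fill a nonempty open subset of the ball, which has
  positive Lebesgue measure.\<close>

lemma sphere_AE_imp_all:
  fixes f :: "'a::euclidean_space \<Rightarrow> real"
  assumes f: "continuous_on (sphere 0 1) f" and ae: "AE x in sphere_measure. f x \<le> c"
    and z: "z \<in> sphere 0 1"
  shows "f z \<le> c"
proof (rule ccontr)
  assume "\<not> f z \<le> c"
  define U where "U = {x \<in> ball 0 1 - {0}. f (sgn x) \<in> {c<..}}"
  have cont: "continuous_on (ball 0 1 - {0}) (\<lambda>x. f (sgn x))"
    by (rule continuous_on_compose2[OF f])
       (auto simp: norm_sgn split: if_splits intro!: continuous_intros)
  have op: "open U"
    using continuous_open_preimage[OF cont, of "{c<..}"] unfolding U_def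
    by (simp add: vimage_def Int_def open_Diff)
  have "sgn ((1/2) *\<^sub>R z) = z" using z by (simp add: sgn_div_norm)
  then have "(1/2) *\<^sub>R z \<in> U"
    using z \<open>\<not> f z \<le> c\<close> by (auto simp: U_def)
  have "AE x in distr unit_ball_measure borel sgn. x \<in> sphere 0 1 \<longrightarrow> f x \<le> c"
    using ae unfolding sphere_measure_def by (subst (asm) AE_restrict_space_iff) auto
  then have "AE x in unit_ball_measure. sgn x \<in> sphere 0 1 \<longrightarrow> f (sgn x) \<le> c"
    by (rule AE_distrD[rotated]) simp
  then have "AE x in unit_ball_measure. f (sgn x) \<le> c"
    using AE_sgn_sphere by eventually_elim auto
  then have "AE x in lborel. x \<in> ball 0 1 \<longrightarrow> f (sgn x) \<le> c"
    using emeasure_unit_ball by (subst (asm) AE_uniform_measure) (auto simp: less_top)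
  then have "AE x in lborel. x \<notin> U"
    by eventually_elim (auto simp: U_def)
  then have "emeasure lborel U = 0"
    using op by (subst (asm) AE_iff_measurable[of U]) auto
  moreover obtain e where e: "e > 0" "ball ((1/2) *\<^sub>R z) e \<subseteq> U"
    using op \<open>(1/2) *\<^sub>R z \<in> U\<close> by (meson openE)
  then have "emeasure lborel (ball ((1/2) *\<^sub>R z) e) \<le> emeasure lborel U"
    using op by (intro emeasure_mono) auto
  moreover have "measure lborel (ball ((1/2) *\<^sub>R z) e) > 0" using e by (intro content_ball_pos)
  then have "emeasure lborel (ball ((1/2) *\<^sub>R z) e) \<noteq> 0" by (auto simp: measure_def)
  ultimately show False by auto
qed

lemma sphere_integral_zero_imp:
  fixes f :: "'a::euclidean_space \<Rightarrow> real"
  assumes f: "continuous_on (sphere 0 1) f" and nn: "\<And>x. x \<in> sphere 0 1 \<Longrightarrow> f x \<ge> 0"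
    and 0: "(\<integral>x. f x \<partial>sphere_measure) = 0" and z: "z \<in> sphere 0 1"
  shows "f z = 0"
proof -
  have nn': "AE x in sphere_measure. 0 \<le> f x" by (rule AE_I2) (simp add: nn)
  have "AE x in sphere_measure. f x = 0"
    using integral_nonneg_eq_0_iff_AE[OF integrable_sphere[OF f]] 0 nn'
    by blast
  then have "AE x in sphere_measure. f x \<le> 0" by eventually_elim auto
  from sphere_AE_imp_all[OF f this z] nn[OF z] show ?thesis by simp
qed

section \<open>Homogeneous and harmonic polynomials\<close>

definition pd :: "'a::euclidean_space \<Rightarrow> ('a \<Rightarrow> real) \<Rightarrow> 'a \<Rightarrow> real" where
  "pd b p = (\<lambda>x. frechet_derivative p (at x) b)"

lemmas rpf_linear = real_polynomial_function.intros(1)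
  and rpf_const = real_polynomial_function.intros(2)
  and rpf_add = real_polynomial_function.intros(3)
  and rpf_mult = real_polynomial_function.intros(4)

lemma laplacian_pd: "laplacian p x = (\<Sum>b\<in>Basis. pd b (pd b p) x)"
  by (simp add: laplacian_def pd_def)

lemma rpf_differentiable:
  "real_polynomial_function p \<Longrightarrow> p differentiable (at (x::'a::euclidean_space))"
  by (induction rule: real_polynomial_function.induct)
     (auto intro: bounded_linear_imp_differentiable)

lemma rpf_has_derivative:
  "real_polynomial_function p \<Longrightarrow> (p has_derivative frechet_derivative p (at x)) (at (x::'a::euclidean_space))"
  using rpf_differentiable frechet_derivative_works by blast

lemma rpf_continuous_on:
  "real_polynomial_function p \<Longrightarrow> continuous_on S (p :: 'a::euclidean_space \<Rightarrow> real)"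
  by (simp add: continuous_on_polymonial_function real_polynomial_function_eq)

lemma rpf_measurable [measurable_dest]:
  "real_polynomial_function (p :: 'a::euclidean_space \<Rightarrow> real) \<Longrightarrow> p \<in> borel_measurable borel"
  by (intro borel_measurable_continuous_onI rpf_continuous_on)

lemma pd_eqI: "(p has_derivative D) (at x) \<Longrightarrow> pd b p x = D b"
  unfolding pd_def using frechet_derivative_at by metis

lemma pd_const [simp]: "pd b (\<lambda>x. c) = (\<lambda>x. 0)"
  by (rule ext) (simp add: pd_eqI[OF has_derivative_const])

lemma pd_linear: "bounded_linear f \<Longrightarrow> pd b f = (\<lambda>x. f b)"
  by (rule ext) (simp add: pd_eqI[OF bounded_linear_imp_has_derivative])

lemma pd_inner [simp]: "pd b (\<lambda>x. x \<bullet> y) = (\<lambda>x. b \<bullet> y)"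
  by (rule pd_linear) (rule bounded_linear_inner_left)

lemma pd_add:
  assumes "real_polynomial_function p" "real_polynomial_function q"
  shows "pd b (\<lambda>x. p x + q x) = (\<lambda>x. pd b p x + pd b q x)"
proof
  fix x
  from pd_eqI[OF has_derivative_add[OF assms[THEN rpf_has_derivative]]]
  show "pd b (\<lambda>x. p x + q x) x = pd b p x + pd b q x" by (simp only: pd_def)
qed

lemma pd_mult:
  assumes "real_polynomial_function p" "real_polynomial_function q"
  shows "pd b (\<lambda>x. p x * q x) = (\<lambda>x. p x * pd b q x + pd b p x * q x)"
proof
  fix x
  from pd_eqI[OF has_derivative_mult[OF assms[THEN rpf_has_derivative]]]
  show "pd b (\<lambda>x. p x * q x) x = p x * pd b q x + pd b p x * q x" by (simp only: pd_def)
qed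

lemma pd_cmult:
  assumes "real_polynomial_function p"
  shows "pd b (\<lambda>x. c * p x) = (\<lambda>x. c * pd b p x)"
  using pd_mult[OF rpf_const assms] by simp

lemma pd_sum:
  assumes "\<And>i. i \<in> I \<Longrightarrow> real_polynomial_function (p i)"
  shows "pd b (\<lambda>x. \<Sum>i\<in>I. p i x) = (\<lambda>x. \<Sum>i\<in>I. pd b (p i) x)"
  using assms
proof (induction I rule: infinite_finite_induct)
  case (insert i I)
  then show ?case by (simp add: pd_add real_polynomial_function_sum)
qed auto

lemma rpf_pd [intro]: "real_polynomial_function p \<Longrightarrow> real_polynomial_function (pd b p)"
proof (induction rule: real_polynomial_function.induct)
  case (linear f) then show ?case by (simp add: pd_linear rpf_const)
next
  case (const c) then show ?case by (simp add: rpf_const)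
next
  case (add f g) then show ?case by (simp add: pd_add rpf_add)
next
  case (mult f g) then show ?case
    by (simp add: pd_mult rpf_add rpf_mult)
qed

lemma pd_commute:
  "real_polynomial_function p \<Longrightarrow> pd a (pd b p) = pd b (pd a p)"
proof (induction rule: real_polynomial_function.induct)
  case (linear f) then show ?case by (simp add: pd_linear)
next
  case (add f g) then show ?case by (simp add: pd_add rpf_pd)
next
  case (mult f g)
  then show ?case
    by (simp add: pd_mult pd_add rpf_pd rpf_mult fun_eq_iff)
qed simp

lemma rpf_laplacian [intro]:
  "real_polynomial_function p \<Longrightarrow> real_polynomial_function (laplacian p)"
  unfolding laplacian_pd[abs_def] by (intro real_polynomial_function_sum rpf_pd) auto

lemma pd_laplacian:
  assumes "real_polynomial_function p"
  shows "laplacian (pd b p) = pd b (laplacian p)"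
proof -
  have "pd a (pd a (pd b p)) = pd b (pd a (pd a p))" for a
    using pd_commute[OF assms, of a b] pd_commute[OF rpf_pd[OF assms], of a b] by simp
  then show ?thesis
    unfolding laplacian_pd[abs_def] by (simp add: pd_sum rpf_pd assms)
qed

lemma laplacian_add:
  assumes "real_polynomial_function p" "real_polynomial_function q"
  shows "laplacian (\<lambda>x. p x + q x) x = laplacian p x + laplacian q x"
  by (simp add: laplacian_pd pd_add assms rpf_pd sum.distrib)

lemma laplacian_cmult:
  assumes "real_polynomial_function p"
  shows "laplacian (\<lambda>x. c * p x) x = c * laplacian p x"
  by (simp add: laplacian_pd pd_cmult assms rpf_pd sum_distrib_left)

lemma laplacian_sum:
  assumes "\<And>i. i \<in> I \<Longrightarrow> real_polynomial_function (p i)"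
  shows "laplacian (\<lambda>x. \<Sum>i\<in>I. p i x) x = (\<Sum>i\<in>I. laplacian (p i) x)"
  by (simp add: laplacian_pd pd_sum assms rpf_pd sum.swap[of _ I])

lemma laplacian_mult:
  assumes "real_polynomial_function p" "real_polynomial_function q"
  shows "laplacian (\<lambda>x. p x * q x) x
       = p x * laplacian q x + 2 * (\<Sum>b\<in>Basis. pd b p x * pd b q x) + laplacian p x * q x"
proof -
  have "pd b (pd b (\<lambda>x. p x * q x)) x
      = p x * pd b (pd b q) x + 2 * (pd b p x * pd b q x) + pd b (pd b p) x * q x" for b
  proof -
    have "pd b (pd b (\<lambda>x. p x * q x)) = pd b (\<lambda>x. p x * pd b q x + pd b p x * q x)"
      by (simp only: pd_mult assms)
    also have "\<dots> = (\<lambda>x. (p x * pd b (pd b q) x + pd b p x * pd b q x)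
        + (pd b p x * pd b q x + pd b (pd b p) x * q x))"
      by (simp only: pd_add pd_mult assms rpf_pd rpf_mult)
    finally show ?thesis by simp
  qed
  then show ?thesis
    unfolding laplacian_pd sum_distrib_left sum_distrib_right by (simp only: sum.distrib)
qed

lemma rpf_inner [intro]: "real_polynomial_function (\<lambda>x::'a::euclidean_space. x \<bullet> y)"
  by (intro rpf_linear bounded_linear_inner_left)

lemma rpf_inner_self [intro]: "real_polynomial_function (\<lambda>x::'a::euclidean_space. x \<bullet> x)"
proof -
  have "real_polynomial_function (\<lambda>x::'a. \<Sum>b\<in>Basis. (x \<bullet> b) * (x \<bullet> b))"
    by (intro real_polynomial_function_sum rpf_mult rpf_inner) auto
  then show ?thesis by (subst euclidean_inner)
qed

lemma pd_inner_self [simp]: "pd b (\<lambda>x::'a::euclidean_space. x \<bullet> x) = (\<lambda>x. 2 * (x \<bullet> b))"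
proof
  fix x :: 'a
  have "((\<lambda>x. x \<bullet> x) has_derivative (\<lambda>h. x \<bullet> h + h \<bullet> x)) (at x)"
    by (rule has_derivative_inner[OF has_derivative_ident has_derivative_ident])
  from pd_eqI[OF this] show "pd b (\<lambda>x::'a. x \<bullet> x) x = 2 * (x \<bullet> b)"
    by (simp add: inner_commute)
qed

section \<open>Homogeneous polynomials and degree\<close>

text \<open>The scaling law is required for all real \<open>c\<close>. With \<open>c = 0\<close> and
  \<open>0 ^ 0 = 1\<close> it makes \<open>hpoly 0\<close> the constants; the zero function has
  every degree.\<close>

definition hpoly :: "nat \<Rightarrow> ('a::euclidean_space \<Rightarrow> real) set" where
  "hpoly l = {p. real_polynomial_function p \<and> (\<forall>c x. p (c *\<^sub>R x) = c ^ l * p x)}"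

lemma hpoly_rpf [dest]: "p \<in> hpoly l \<Longrightarrow> real_polynomial_function p"
  by (simp add: hpoly_def)

lemma hpoly_scale: "p \<in> hpoly l \<Longrightarrow> p (c *\<^sub>R x) = c ^ l * p x"
  by (simp add: hpoly_def)

lemma hpoly_add: "p \<in> hpoly l \<Longrightarrow> q \<in> hpoly l \<Longrightarrow> (\<lambda>x. p x + q x) \<in> hpoly l"
  by (auto simp: hpoly_def algebra_simps)

lemma hpoly_cmult: "p \<in> hpoly l \<Longrightarrow> (\<lambda>x. c * p x) \<in> hpoly l"
  by (auto simp: hpoly_def algebra_simps)

lemma hpoly_mult: "p \<in> hpoly l \<Longrightarrow> q \<in> hpoly m \<Longrightarrow> (\<lambda>x. p x * q x) \<in> hpoly (l + m)"
  by (auto simp: hpoly_def algebra_simps power_add)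

lemma hpoly_zero: "(\<lambda>x. 0) \<in> hpoly l"
  by (auto simp: hpoly_def rpf_const)

lemma hpoly_const: "(\<lambda>x. c) \<in> hpoly 0"
  by (auto simp: hpoly_def rpf_const)

lemma hpoly_inner: "(\<lambda>x. x \<bullet> y) \<in> hpoly (Suc 0)"
  by (auto simp: hpoly_def)

lemma hpoly_inner_self: "(\<lambda>x. x \<bullet> x) \<in> hpoly 2"
  by (auto simp: hpoly_def power2_eq_square)

lemma hpoly_sum: "(\<And>i. i \<in> I \<Longrightarrow> p i \<in> hpoly l) \<Longrightarrow> (\<lambda>x. \<Sum>i\<in>I. p i x) \<in> hpoly l"
proof (induction I rule: infinite_finite_induct)
  case (insert i I)
  then show ?case by (simp add: hpoly_add)
qed (auto intro: hpoly_zero)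

lemma hpoly_power: "p \<in> hpoly l \<Longrightarrow> (\<lambda>x. p x ^ n) \<in> hpoly (n * l)"
proof (induction n)
  case 0 then show ?case using hpoly_const[of 1] by simp
next
  case (Suc n) then show ?case using hpoly_mult[OF Suc.prems Suc.IH] by simp
qed

lemma hpoly_0_const: "p \<in> hpoly 0 \<Longrightarrow> p = (\<lambda>x. p 0)"
proof
  fix x assume "p \<in> hpoly 0"
  from hpoly_scale[OF this, of 0 x] show "p x = p 0" by simp
qed

text \<open>The derivative of \<open>p (t *\<^sub>R x)\<close> at \<open>t = 1\<close> is computed
  by the chain rule and by homogeneity.\<close>

lemma euler_homogeneous:
  assumes "p \<in> hpoly l"
  shows "(\<Sum>b\<in>Basis. (x \<bullet> b) * pd b p x) = real l * p x"
proof -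
  let ?D = "frechet_derivative p (at x)"
  have D: "(p has_derivative ?D) (at x)" using assms by (intro rpf_has_derivative) auto
  then have lin: "linear ?D" using has_derivative_linear by blast
  have "(\<Sum>b\<in>Basis. (x \<bullet> b) * pd b p x) = ?D (\<Sum>b\<in>Basis. (x \<bullet> b) *\<^sub>R b)"
    by (simp add: linear_sum[OF lin] linear_scale[OF lin] pd_def)
  also have "\<dots> = ?D x" by (simp add: euclidean_representation)
  finally have 1: "(\<Sum>b\<in>Basis. (x \<bullet> b) * pd b p x) = ?D x" .
  have "((\<lambda>t. p (t *\<^sub>R x)) has_derivative (\<lambda>t. ?D (t *\<^sub>R x))) (at 1)"
    by (rule has_derivative_compose[of "\<lambda>t. t *\<^sub>R x" "\<lambda>t. t *\<^sub>R x" 1 UNIV p ?D])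
       (use D in \<open>auto intro!: derivative_eq_intros\<close>)
  moreover have "((\<lambda>t. p (t *\<^sub>R x)) has_derivative (\<lambda>t. t * (real l * p x))) (at 1)"
    unfolding hpoly_scale[OF assms] by (auto intro!: derivative_eq_intros)
  ultimately have "(\<lambda>t. ?D (t *\<^sub>R x)) = (\<lambda>t. t * (real l * p x))"
    by (rule has_derivative_unique)
  then have "?D (1 *\<^sub>R x) = 1 * (real l * p x)" by (rule fun_cong)
  with 1 show ?thesis by simp
qed

text \<open>Differentiating \<open>p (c *\<^sub>R y) = c ^ l * p y\<close> in \<open>y\<close> gives
  the law for the derivative up to a factor \<open>c\<close>, which cancels unless
  \<open>c = 0\<close>; that case follows by continuity. For \<open>l = 0\<close> the truncated
  \<open>l - 1\<close> is 0 and the derivative vanishes.\<close>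

lemma hpoly_pd:
  assumes p: "p \<in> hpoly l"
  shows "pd b p \<in> hpoly (l - 1)"
proof (cases l)
  case 0
  with hpoly_0_const p have "p = (\<lambda>x. p 0)" by blast
  then have "pd b p = (\<lambda>x. 0)" using pd_const[of b "p 0"] by simp
  then show ?thesis by (simp add: hpoly_zero)
next
  case (Suc k)
  have rp: "real_polynomial_function (pd b p)" using p by auto
  have 1: "pd b p (c *\<^sub>R x) * c = c ^ l * pd b p x" for c x
  proof -
    let ?D = "\<lambda>y. frechet_derivative p (at y)"
    have D: "(p has_derivative ?D y) (at y)" for y using p by (intro rpf_has_derivative) auto
    have lin: "linear (?D y)" for y using D has_derivative_linear by blast
    have "((\<lambda>y. p (c *\<^sub>R y)) has_derivative (\<lambda>h. ?D (c *\<^sub>R x) (c *\<^sub>R h))) (at x)"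
      by (rule has_derivative_compose[of "\<lambda>y. c *\<^sub>R y" "\<lambda>h. c *\<^sub>R h" x UNIV p "?D (c *\<^sub>R x)"])
         (use D in \<open>auto intro!: derivative_eq_intros\<close>)
    moreover have "((\<lambda>y. p (c *\<^sub>R y)) has_derivative (\<lambda>h. c ^ l * ?D x h)) (at x)"
      unfolding hpoly_scale[OF p] by (intro has_derivative_mult_right D)
    ultimately have "(\<lambda>h. ?D (c *\<^sub>R x) (c *\<^sub>R h)) = (\<lambda>h. c ^ l * ?D x h)"
      by (rule has_derivative_unique)
    then have "?D (c *\<^sub>R x) (c *\<^sub>R b) = c ^ l * ?D x b" by (rule fun_cong)
    then show ?thesis by (simp add: linear_scale[OF lin] pd_def mult.commute)
  qed
  have 2: "pd b p (c *\<^sub>R x) = c ^ k * pd b p x" if "c \<noteq> 0" for c x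
    using 1[of c x] that Suc by (simp add: field_simps)
  have 3: "pd b p (0 *\<^sub>R x) = 0 ^ k * pd b p x" for x
  proof (rule tendsto_unique[of "at (0::real)"])
    have "continuous (at 0) (\<lambda>c. pd b p (c *\<^sub>R x))"
      using continuous_on_compose2[OF rpf_continuous_on[OF rp, of UNIV], of UNIV "\<lambda>c. c *\<^sub>R x"]
      by (auto simp: continuous_on_eq_continuous_at intro!: continuous_intros)
    then show "((\<lambda>c. pd b p (c *\<^sub>R x)) \<longlongrightarrow> pd b p (0 *\<^sub>R x)) (at 0)"
      by (simp add: continuous_at)
    have "((\<lambda>c. c ^ k * pd b p x) \<longlongrightarrow> 0 ^ k * pd b p x) (at 0)"
      by (intro tendsto_intros)
    then show "((\<lambda>c. pd b p (c *\<^sub>R x)) \<longlongrightarrow> 0 ^ k * pd b p x) (at 0)"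
      by (rule Lim_transform_eventually)
         (auto simp: eventually_at 2 intro!: exI[of _ 1])
  qed auto
  have "pd b p (c *\<^sub>R x) = c ^ k * pd b p x" for c x
    using 2[of c x] 3[of x] by (cases "c = 0") auto
  then show ?thesis unfolding hpoly_def using rp Suc by simp
qed

lemma hpoly_laplacian:
  assumes "p \<in> hpoly l" shows "laplacian p \<in> hpoly (l - 2)"
  unfolding laplacian_pd[abs_def]
proof (rule hpoly_sum)
  show "pd b (pd b p) \<in> hpoly (l - 2)" for b
    using hpoly_pd[OF hpoly_pd[OF assms], of b b] by (simp add: numeral_2_eq_2)
qed

lemma laplacian_inner_self_mult:
  assumes "q \<in> hpoly l"
  shows "laplacian (\<lambda>x. (x \<bullet> x) * q x) x
       = (2 * real DIM('a) + 4 * real l) * q x + (x \<bullet> x) * laplacian q (x::'a::euclidean_space)"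
proof -
  have rq: "real_polynomial_function q" using assms by auto
  have "laplacian (\<lambda>x::'a. x \<bullet> x) x = 2 * real DIM('a)"
    by (simp add: laplacian_pd pd_cmult rpf_inner)
  moreover have "(\<Sum>b\<in>Basis. 2 * (x \<bullet> b) * pd b q x) = 2 * (real l * q x)"
    unfolding euler_homogeneous[OF assms, of x, symmetric] by (simp add: sum_distrib_left mult.assoc)
  ultimately show ?thesis
    using laplacian_mult[OF rpf_inner_self rq, of x] by (simp add: algebra_simps)
qed

text \<open>The degree bound is carried by homogeneous components, since scaling and Fischer's
  decomposition act on each of them separately.\<close>

definition poly_upto :: "nat \<Rightarrow> ('a::euclidean_space \<Rightarrow> real) \<Rightarrow> bool" where
  "poly_upto n p \<longleftrightarrow> (\<exists>q. (\<forall>i. q i \<in> hpoly i) \<and> (\<forall>x. p x = (\<Sum>i\<le>n. q i x)))"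

lemma poly_upto_hpoly: "p \<in> hpoly i \<Longrightarrow> i \<le> n \<Longrightarrow> poly_upto n p"
  unfolding poly_upto_def
  by (rule exI[of _ "\<lambda>j. if j = i then p else (\<lambda>x. 0)"])
     (auto simp: hpoly_zero if_distrib[of "\<lambda>f. f _"] cong: if_cong)

lemma poly_upto_add:
  assumes "poly_upto n p" "poly_upto n q" shows "poly_upto n (\<lambda>x. p x + q x)"
proof -
  obtain f g where "\<forall>i. f i \<in> hpoly i" "\<forall>x. p x = (\<Sum>i\<le>n. f i x)"
    "\<forall>i. g i \<in> hpoly i" "\<forall>x. q x = (\<Sum>i\<le>n. g i x)"
    using assms unfolding poly_upto_def by blast
  then show ?thesis unfolding poly_upto_def
    by (intro exI[of _ "\<lambda>i x. f i x + g i x"]) (auto simp: hpoly_add sum.distrib)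
qed

lemma poly_upto_sum:
  "(\<And>i. i \<in> I \<Longrightarrow> poly_upto n (p i)) \<Longrightarrow> poly_upto n (\<lambda>x. \<Sum>i\<in>I. p i x)"
proof (induction I rule: infinite_finite_induct)
  case (insert i I)
  then show ?case by (simp add: poly_upto_add)
qed (auto intro: poly_upto_hpoly[OF hpoly_zero, of 0])

lemma poly_upto_mult:
  assumes "poly_upto n p" "poly_upto m q" shows "poly_upto (n + m) (\<lambda>x. p x * q x)"
proof -
  obtain f g where f: "\<And>i. f i \<in> hpoly i" "\<And>x. p x = (\<Sum>i\<le>n. f i x)"
    and g: "\<And>i. g i \<in> hpoly i" "\<And>x. q x = (\<Sum>i\<le>m. g i x)"
    using assms unfolding poly_upto_def by blast
  have "poly_upto (n + m) (\<lambda>x. \<Sum>i\<le>n. \<Sum>j\<le>m. f i x * g j x)"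
    using f(1) g(1) by (intro poly_upto_sum poly_upto_hpoly[OF hpoly_mult]) auto
  then show ?thesis unfolding f(2) g(2) sum_product .
qed

lemma poly_upto_mono: "poly_upto n p \<Longrightarrow> n \<le> m \<Longrightarrow> poly_upto m p"
proof -
  assume "poly_upto n p" "n \<le> m"
  then obtain q where q: "\<And>i. q i \<in> hpoly i" "p = (\<lambda>x. \<Sum>i\<le>n. q i x)"
    unfolding poly_upto_def by blast
  show ?thesis unfolding q(2)
    by (intro poly_upto_sum poly_upto_hpoly[OF q(1)]) (use \<open>n \<le> m\<close> in auto)
qed

lemma poly_upto_cmult: "poly_upto n p \<Longrightarrow> poly_upto n (\<lambda>x. c * p x)"
  using poly_upto_mult[OF poly_upto_hpoly[OF hpoly_const, of 0 c], of n p] by simp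

lemma poly_upto_rpf: "poly_upto n p \<Longrightarrow> real_polynomial_function p"
proof -
  assume "poly_upto n p"
  then obtain q where q: "\<And>i. q i \<in> hpoly i" "p = (\<lambda>x. \<Sum>i\<le>n. q i x)"
    unfolding poly_upto_def by blast
  show ?thesis unfolding q(2) using q(1) by (intro real_polynomial_function_sum) auto
qed

lemma rpf_poly_upto: "real_polynomial_function (p :: 'a::euclidean_space \<Rightarrow> real) \<Longrightarrow> \<exists>n. poly_upto n p"
proof (induction rule: real_polynomial_function.induct)
  case (linear f)
  then have "f \<in> hpoly 1"
    by (auto simp: hpoly_def rpf_linear linear_simps)
  then show ?case using poly_upto_hpoly by blast
next
  case (const c) then show ?case using poly_upto_hpoly[OF hpoly_const] by blast
next
  case (add f g)
  then obtain n m where "poly_upto n f" "poly_upto m g" by blast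
  then have "poly_upto (max n m) (\<lambda>x. f x + g x)"
    by (intro poly_upto_add) (auto elim: poly_upto_mono)
  then show ?case by blast
next
  case (mult f g) then show ?case using poly_upto_mult by blast
qed

section \<open>Harmonic polynomials and Fischer's decomposition\<close>

definition harm :: "nat \<Rightarrow> ('a::euclidean_space \<Rightarrow> real) set" where
  "harm l = {p \<in> hpoly l. \<forall>x. laplacian p x = 0}"

lemma harm_hpoly [dest]: "p \<in> harm l \<Longrightarrow> p \<in> hpoly l"
  by (simp add: harm_def)

lemma harm_zero: "(\<lambda>x. 0) \<in> harm l"
  by (simp add: harm_def hpoly_zero laplacian_pd)

lemma harm_add: "p \<in> harm l \<Longrightarrow> q \<in> harm l \<Longrightarrow> (\<lambda>x. p x + q x) \<in> harm l"
  by (auto simp: harm_def hpoly_add laplacian_add hpoly_rpf)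

lemma harm_cmult: "p \<in> harm l \<Longrightarrow> (\<lambda>x. c * p x) \<in> harm l"
  by (auto simp: harm_def hpoly_cmult laplacian_cmult hpoly_rpf)

lemma harm_sum: "(\<And>i. i \<in> I \<Longrightarrow> p i \<in> harm l) \<Longrightarrow> (\<lambda>x. \<Sum>i\<in>I. p i x) \<in> harm l"
proof (induction I rule: infinite_finite_induct)
  case (insert i I)
  then show ?case by (simp add: harm_add)
qed (auto intro: harm_zero)

lemma harm_pd: "p \<in> harm l \<Longrightarrow> pd b p \<in> harm (l - 1)"
proof -
  assume p: "p \<in> harm l"
  then have "laplacian (pd b p) = pd b (laplacian p)" by (intro pd_laplacian) auto
  also have "laplacian p = (\<lambda>x. 0)" using p by (auto simp: harm_def)
  finally show ?thesis using p hpoly_pd[of p l b] by (auto simp: harm_def)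
qed

lemma harm_0: "hpoly 0 = harm 0"
proof -
  have "laplacian p x = 0" if "p \<in> hpoly 0" for p :: "'a \<Rightarrow> real" and x
  proof -
    have "pd b p = (\<lambda>x. 0)" for b by (subst hpoly_0_const[OF that]) simp
    then show ?thesis by (simp add: laplacian_pd)
  qed
  then show ?thesis by (auto simp: harm_def)
qed

lemma laplacian_hpoly_less_2:
  assumes "p \<in> hpoly l" "l < 2" shows "laplacian p x = 0"
proof -
  have "pd b p \<in> harm 0" for b
    using hpoly_pd[OF assms(1), of b] assms(2) harm_0 by (cases l) auto
  then have "pd b p = (\<lambda>x. pd b p 0)" for b by (intro hpoly_0_const harm_hpoly)
  then have "pd b (pd b p) = pd b (\<lambda>x. pd b p 0)" for b by (rule arg_cong)
  then have "pd b (pd b p) = (\<lambda>x. 0)" for b unfolding pd_const .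
  then show ?thesis by (simp add: laplacian_pd)
qed

text \<open>Up to a positive factor the Laplacian lowers the power of \<open>x \<bullet> x\<close>
  by one. Read backwards, every product of this kind is itself a Laplacian.\<close>

lemma laplacian_power_harm:
  assumes "h \<in> harm j"
  shows "laplacian (\<lambda>x. (x \<bullet> x) ^ Suc i * h x) x
       = 2 * real (Suc i) * (real DIM('a) + 2 * real j + 2 * real i) * ((x \<bullet> x) ^ i * h (x::'a::euclidean_space))"
proof (induction i arbitrary: x)
  case 0
  show ?case using laplacian_inner_self_mult[of h j x] assms by (auto simp: harm_def)
next
  case (Suc i)
  have q: "(\<lambda>x. (x \<bullet> x) ^ Suc i * h x) \<in> hpoly (Suc i * 2 + j)"
    using assms by (intro hpoly_mult hpoly_power hpoly_inner_self) auto
  show ?case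
    using laplacian_inner_self_mult[OF q, of x] unfolding Suc.IH
    by (simp add: algebra_simps)
qed

text \<open>Decompose the Laplacian of \<open>p\<close> by induction, write each term as the
  Laplacian of a product via \<open>laplacian_power_harm\<close>, and subtract these products from
  \<open>p\<close>: the rest is harmonic of degree \<open>l\<close>.\<close>

lemma fischer_decomposition:
  "p \<in> hpoly l \<Longrightarrow>
   \<exists>h. (\<forall>j. h j \<in> harm j) \<and> (\<forall>x. p x = (\<Sum>i\<le>l div 2. (x \<bullet> x) ^ i * h (l - 2 * i) (x::'a::euclidean_space)))"
proof (induction l arbitrary: p rule: less_induct)
  case (less l)
  show ?case
  proof (cases "l < 2")
    case True
    then have "p \<in> harm l" using less.prems laplacian_hpoly_less_2 by (auto simp: harm_def)
    with True show ?thesis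
      by (intro exI[of _ "\<lambda>j. if j = l then p else (\<lambda>x. 0)"]) (auto simp: harm_zero)
  next
    case False
    define k where "k = l - 2"
    have l: "l = k + 2" using False by (simp add: k_def)
    have rp: "real_polynomial_function p" using less.prems by auto
    obtain h where h: "\<And>j. h j \<in> harm j"
      and Dp: "\<And>x. laplacian p x = (\<Sum>i\<le>k div 2. (x \<bullet> x) ^ i * h (k - 2 * i) x)"
      using less.IH[of k "laplacian p"] hpoly_laplacian[OF less.prems] l by auto
    \<comment> \<open>The factor of \<open>laplacian_power_harm\<close> for a harmonic of degree
      \<open>k - 2 * i\<close>.\<close>
    define c where "c i = 2 * real (Suc i) * (real DIM('a) + 2 * real (k - 2 * i) + 2 * real i)" for i
    have c: "c i > 0" for i by (auto simp: c_def intro!: mult_pos_pos add_pos_nonneg)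
    define q where "q i x = (x \<bullet> x) ^ Suc i * h (k - 2 * i) x / c i" for i and x :: 'a
    have q_eq: "q i = (\<lambda>x. inverse (c i) * ((x \<bullet> x) ^ Suc i * h (k - 2 * i) x))" for i
      by (auto simp: q_def field_simps)
    have hp: "(\<lambda>x. (x \<bullet> x) ^ Suc i * h (k - 2 * i) x) \<in> hpoly l" if "i \<le> k div 2" for i
      using hpoly_mult[OF hpoly_power[OF hpoly_inner_self, of "Suc i"] harm_hpoly[OF h], of "k - 2 * i"] that l
      by (simp add: mult.commute)
    then have qh: "q i \<in> hpoly l" if "i \<le> k div 2" for i
      unfolding q_eq using that by (intro hpoly_cmult) auto
    have Dq: "laplacian (q i) x = (x \<bullet> x) ^ i * h (k - 2 * i) x" if "i \<le> k div 2" for i x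
    proof -
      have "laplacian (q i) x = inverse (c i) * laplacian (\<lambda>x. (x \<bullet> x) ^ Suc i * h (k - 2 * i) x) x"
        unfolding q_eq using hp[OF that] by (intro laplacian_cmult hpoly_rpf)
      also have "\<dots> = inverse (c i) * (c i * ((x \<bullet> x) ^ i * h (k - 2 * i) x))"
        by (subst laplacian_power_harm[OF h]) (simp only: c_def)
      finally show ?thesis using c[of i] by (simp add: field_simps)
    qed
    define h0 where "h0 x = p x + (- 1) * (\<Sum>i\<le>k div 2. q i x)" for x
    have s: "(\<lambda>x. \<Sum>i\<le>k div 2. q i x) \<in> hpoly l" by (intro hpoly_sum qh) auto
    have "h0 \<in> hpoly l"
      unfolding h0_def[abs_def] by (intro hpoly_add hpoly_cmult less.prems s)
    moreover have "laplacian h0 x = 0" for x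
    proof -
      have "laplacian h0 x = laplacian p x + laplacian (\<lambda>x. (- 1) * (\<Sum>i\<le>k div 2. q i x)) x"
        unfolding h0_def[abs_def] by (rule laplacian_add[OF rp hpoly_rpf[OF hpoly_cmult[OF s]]])
      also have "laplacian (\<lambda>x. (- 1) * (\<Sum>i\<le>k div 2. q i x)) x
          = (- 1) * laplacian (\<lambda>x. \<Sum>i\<le>k div 2. q i x) x"
        by (rule laplacian_cmult[OF hpoly_rpf[OF s]])
      also have "laplacian (\<lambda>x. \<Sum>i\<le>k div 2. q i x) x = (\<Sum>i\<le>k div 2. laplacian (q i) x)"
        by (rule laplacian_sum) (use qh in auto)
      finally show ?thesis by (simp add: Dp Dq)
    qed
    ultimately have h0: "h0 \<in> harm l" by (simp add: harm_def)
    \<comment> \<open>The term with power \<open>Suc i\<close> carries a harmonic of degree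
      \<open>j = l - 2 * Suc i\<close>, so that \<open>i = (l - j) div 2 - 1\<close>.\<close>
    define g where "g j = (if j = l then h0 else if even (l - j) \<and> j < l
        then (\<lambda>x. inverse (c ((l - j) div 2 - 1)) * h j x) else (\<lambda>x. 0))" for j
    have "g j \<in> harm j" for j
      using h0 by (auto simp: g_def harm_zero intro!: harm_cmult h)
    moreover have "p x = (\<Sum>i\<le>l div 2. (x \<bullet> x) ^ i * g (l - 2 * i) x)" for x
    proof -
      have "(\<Sum>i\<le>l div 2. (x \<bullet> x) ^ i * g (l - 2 * i) x)
          = h0 x + (\<Sum>i\<le>k div 2. (x \<bullet> x) ^ Suc i * g (l - 2 * Suc i) x)"
      proof -
        have "l div 2 = Suc (k div 2)" using l by simp
        moreover have "g l = h0" by (simp add: g_def)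
        ultimately show ?thesis
          by (simp only: sum.atMost_Suc_shift) simp
      qed
      also have "(\<Sum>i\<le>k div 2. (x \<bullet> x) ^ Suc i * g (l - 2 * Suc i) x) = (\<Sum>i\<le>k div 2. q i x)"
      proof (rule sum.cong[OF refl])
        fix i assume "i \<in> {..k div 2}"
        then have i: "2 * i \<le> k" by auto
        have "l - (k - 2 * i) = 2 * Suc i" using i l by auto
        then have "g (k - 2 * i) x = inverse (c i) * h (k - 2 * i) x"
          using i l by (simp add: g_def)
        moreover have "l - 2 * Suc i = k - 2 * i" using l by simp
        ultimately show "(x \<bullet> x) ^ Suc i * g (l - 2 * Suc i) x = q i x"
          by (simp add: q_def field_simps)
      qed
      finally show ?thesis by (simp add: h0_def)
    qed
    ultimately show ?thesis by blast
  qed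
qed

text \<open>On the sphere the factors \<open>(x \<bullet> x) ^ i\<close> of Fischer's decomposition disappear.\<close>
lemma poly_upto_harm:
  assumes "poly_upto n p"
  shows "\<exists>h. (\<forall>j. h j \<in> harm j) \<and> (\<forall>x\<in>sphere 0 1. p x = (\<Sum>j\<le>n. h j (x::'a::euclidean_space)))"
proof -
  obtain q where q: "\<And>i. q i \<in> hpoly i" "\<And>x. p x = (\<Sum>i\<le>n. q i x)"
    using assms unfolding poly_upto_def by blast
  have "\<exists>h. (\<forall>j. h j \<in> harm j) \<and> (\<forall>x. q l x = (\<Sum>i\<le>l div 2. (x \<bullet> x) ^ i * h (l - 2 * i) x))" for l
    using fischer_decomposition[OF q(1)] .
  then obtain h where h: "\<And>l j. h l j \<in> harm j"
    and qh: "\<And>l x. q l x = (\<Sum>i\<le>l div 2. (x \<bullet> x) ^ i * h l (l - 2 * i) x)"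
    by metis
  \<comment> \<open>Degree \<open>j\<close> collects contributions from all homogeneous parts of
    degree \<open>l \<ge> j\<close> with the parity of \<open>j\<close>.\<close>
  define g where "g j x = (\<Sum>l\<le>n. if j \<le> l \<and> even (l - j) then h l j x else 0)" for j x
  have "g j \<in> harm j" for j
    unfolding g_def[abs_def]
  proof (rule harm_sum)
    show "(\<lambda>x. if j \<le> l \<and> even (l - j) then h l j x else 0) \<in> harm j" for l
      by (cases "j \<le> l \<and> even (l - j)") (simp_all only: if_True if_False h harm_zero simp_thms)
  qed
  moreover have "p x = (\<Sum>j\<le>n. g j x)" if "x \<in> sphere 0 1" for x
  proof -
    have xx: "x \<bullet> x = 1" using that by (simp add: norm_eq_1)
    have "q l x = (\<Sum>j\<le>n. if j \<le> l \<and> even (l - j) then h l j x else 0)" if "l \<le> n" for l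
    proof -
      have "q l x = (\<Sum>i\<le>l div 2. h l (l - 2 * i) x)" using qh[of l x] xx by simp
      also have "\<dots> = (\<Sum>j\<in>{j. j \<le> l \<and> even (l - j)}. h l j x)"
      proof (rule sum.reindex_bij_witness[of _ "\<lambda>j. (l - j) div 2" "\<lambda>i. l - 2 * i"])
        fix a assume a: "a \<in> {..l div 2}"
        then have eq: "l - (l - 2 * a) = 2 * a" by auto
        show "(l - (l - 2 * a)) div 2 = a" unfolding eq by simp
        have "even (l - (l - 2 * a))" unfolding eq by simp
        then show "l - 2 * a \<in> {j. j \<le> l \<and> even (l - j)}" by simp
      next
        fix b assume "b \<in> {j. j \<le> l \<and> even (l - j)}"
        then have b: "b \<le> l" "2 * ((l - b) div 2) = l - b" by auto
        then show "l - 2 * ((l - b) div 2) = b" "(l - b) div 2 \<in> {..l div 2}"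
          by (simp_all add: div_le_mono)
      qed simp
      also have "\<dots> = (\<Sum>j\<le>n. if j \<le> l \<and> even (l - j) then h l j x else 0)"
        using that by (intro sum.mono_neutral_cong_left) auto
      finally show ?thesis .
    qed
    then show ?thesis unfolding q(2) g_def by (subst sum.swap) auto
  qed
  ultimately show ?thesis by blast
qed

section \<open>Integrals of homogeneous polynomials over the sphere\<close>

lemma lborel_integral_translate:
  fixes F :: "'a::euclidean_space \<Rightarrow> real"
  assumes "F \<in> borel_measurable borel"
  shows "(\<integral>x. F (c + x) \<partial>lborel) = (\<integral>x. F x \<partial>lborel)"
proof -
  have "(\<integral>x. F x \<partial>lborel) = (\<integral>x. F x \<partial>distr lborel borel ((+) c))"
    by (simp add: lborel_distr_plus)
  also have "\<dots> = (\<integral>x. F (c + x) \<partial>lborel)"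
    using assms by (subst integral_distr) auto
  finally show ?thesis by simp
qed

lemma integrable_bounded_support:
  fixes F :: "'a::euclidean_space \<Rightarrow> real"
  assumes [measurable]: "F \<in> borel_measurable borel"
    and "\<And>x. norm x \<ge> R \<Longrightarrow> F x = 0" and "\<And>x. \<bar>F x\<bar> \<le> K"
  shows "integrable lborel F"
proof (rule Bochner_Integration.integrable_bound)
  have "emeasure lborel (ball (0::'a) R) < \<infinity>"
    using emeasure_lborel_ball_finite[of 0 R] by (simp add: top.not_eq_extremum)
  then show "integrable lborel (\<lambda>x. K * indicator (ball (0::'a) R) x)"
    by (intro integrable_mult_right integrable_real_indicator) auto
  show "AE x in lborel. norm (F x) \<le> norm (K * indicator (ball 0 R) x)"
    using assms by (intro AE_I2) (auto simp: indicator_def not_less intro: order_trans[OF _ abs_ge_self])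
qed simp

text \<open>By translation invariance every difference quotient of \<open>F\<close> has integral 0;
  dominated convergence passes this on to the derivative.\<close>

lemma lborel_integral_partial_derivative:
  fixes F G :: "'a::euclidean_space \<Rightarrow> real"
  assumes contF: "continuous_on UNIV F" and contG: "continuous_on UNIV G"
    and supp: "\<And>x. norm x \<ge> 1 \<Longrightarrow> F x = 0 \<and> G x = 0"
    and D: "\<And>x. ((\<lambda>s. F (x + s *\<^sub>R b)) has_real_derivative G x) (at 0)"
    and b: "norm b \<le> 1"
  shows "integrable lborel G" and "(\<integral>x. G x \<partial>lborel) = 0"
proof -
  have mF [measurable]: "F \<in> borel_measurable borel" and [measurable]: "G \<in> borel_measurable borel"
    using contF contG by (simp_all add: borel_measurable_continuous_onI)
  have bdd: "\<exists>K\<ge>0. \<forall>x. \<bar>H x\<bar> \<le> K"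
    if "continuous_on UNIV H" "\<And>x. norm x \<ge> 1 \<Longrightarrow> H x = 0" for H :: "'a \<Rightarrow> real"
  proof -
    have "bounded (H ` cball 0 1)"
      using that by (intro compact_imp_bounded compact_continuous_image) (auto intro: continuous_on_subset)
    then obtain K where K: "\<forall>x\<in>cball 0 1. \<bar>H x\<bar> \<le> K" by (auto simp: bounded_iff)
    show ?thesis
    proof (intro exI[of _ "max K 0"] conjI allI)
      fix x show "\<bar>H x\<bar> \<le> max K 0"
      proof (cases "norm x \<le> 1")
        case True
        with K have "\<bar>H x\<bar> \<le> K" by simp
        then show ?thesis by linarith
      next
        case False
        with that(2)[of x] show ?thesis by simp
      qed
    qed simp
  qed
  obtain K where K: "K \<ge> 0" "\<And>x. \<bar>G x\<bar> \<le> K" using bdd[OF contG] supp by blast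
  obtain K' where K': "K' \<ge> 0" "\<And>x. \<bar>F x\<bar> \<le> K'" using bdd[OF contF] supp by blast
  show iG: "integrable lborel G"
    by (rule integrable_bounded_support[of _ 1 K]) (use K supp in auto)
  have iF: "integrable lborel F"
    by (rule integrable_bounded_support[of _ 1 K']) (use K' supp in auto)
  define t where "t n = inverse (real (Suc n))" for n
  have t: "t n > 0" "t n \<le> 1" for n by (auto simp: t_def field_simps)
  have t0: "t \<longlonglongrightarrow> 0" unfolding t_def by (rule LIMSEQ_inverse_real_of_nat)
  define q where "q n x = (F (t n *\<^sub>R b + x) - F x) / t n" for n x
  have qm [measurable]: "q n \<in> borel_measurable borel" for n unfolding q_def[abs_def] by measurable
  have der: "((\<lambda>s. F (x + s *\<^sub>R b)) has_real_derivative G (x + s *\<^sub>R b)) (at s)" for x s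
    using DERIV_shift[of "\<lambda>s. F (x + s *\<^sub>R b)" "G (x + s *\<^sub>R b)" 0 s] D[of "x + s *\<^sub>R b"]
    by (simp add: algebra_simps)
  \<comment> \<open>The mean value theorem bounds the quotients by the bound of \<open>G\<close>,
    uniformly in \<open>n\<close>.\<close>
  have qK: "\<bar>q n x\<bar> \<le> K" for n x
  proof -
    obtain z where "0 < z" "F (x + t n *\<^sub>R b) - F (x + 0 *\<^sub>R b) = (t n - 0) * G (x + z *\<^sub>R b)"
      using MVT2[of 0 "t n" "\<lambda>s. F (x + s *\<^sub>R b)" "\<lambda>s. G (x + s *\<^sub>R b)"] t(1) der by blast
    then have "q n x = G (x + z *\<^sub>R b)" using t(1)[of n] by (simp add: q_def add.commute field_simps)
    then show ?thesis using K by simp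
  qed
  \<comment> \<open>The shifts have length at most 1, so all quotients vanish outside the ball of
    radius 2.\<close>
  have q0: "q n x = 0" if "norm x \<ge> 2" for n x
  proof -
    have "norm x - norm (t n *\<^sub>R b) \<le> norm (t n *\<^sub>R b + x)"
      by (metis add.commute norm_diff_ineq)
    moreover have "norm (t n *\<^sub>R b) \<le> 1"
      using mult_mono[of "t n" 1 "norm b" 1] t[of n] b by simp
    ultimately show ?thesis using that supp by (simp add: q_def)
  qed
  have "(\<integral>x. q n x \<partial>lborel) = 0" for n
  proof -
    have "integrable lborel (\<lambda>x. F (t n *\<^sub>R b + x))"
    proof (rule integrable_bounded_support[of _ 2 K'])
      fix x :: 'a assume "norm x \<ge> 2"
      with q0[OF this, of n] show "F (t n *\<^sub>R b + x) = 0"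
        using supp[of x] t(1)[of n] by (simp add: q_def)
    qed (use K' in auto)
    then show ?thesis
      unfolding q_def using iF by (simp add: lborel_integral_translate)
  qed
  moreover have "(\<lambda>n. \<integral>x. q n x \<partial>lborel) \<longlonglongrightarrow> (\<integral>x. G x \<partial>lborel)"
  proof (rule integral_dominated_convergence[where w = "\<lambda>x. K * indicator (cball 0 2) x"])
    show "integrable lborel (\<lambda>x. K * indicator (cball (0::'a) 2) x)"
      using emeasure_lborel_cball_finite[of "0::'a" 2]
      by (intro integrable_mult_right integrable_real_indicator) (auto simp: top.not_eq_extremum)
    show "AE x in lborel. (\<lambda>n. q n x) \<longlonglongrightarrow> G x"
    proof (rule AE_I2)
      fix x
      have "((\<lambda>s. (F (x + s *\<^sub>R b) - F x) / s) \<longlongrightarrow> G x) (at 0)"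
        using D[of x] by (simp add: DERIV_def)
      then have "((\<lambda>n. (F (x + t n *\<^sub>R b) - F x) / t n) \<longlongrightarrow> G x) sequentially"
        by (rule filterlim_compose) (use t t0 in \<open>auto simp: filterlim_at less_imp_neq[symmetric]\<close>)
      then show "(\<lambda>n. q n x) \<longlonglongrightarrow> G x" by (simp add: q_def add.commute)
    qed
    show "AE x in lborel. norm (q n x) \<le> K * indicator (cball 0 2) x" for n
      using qK q0 K(1) by (intro AE_I2) (auto simp: indicator_def)
  qed simp_all
  ultimately show "(\<integral>x. G x \<partial>lborel) = 0" by (simp add: LIMSEQ_const_iff)
qed

lemma unit_ball_integral_eq:
  fixes f :: "'a::euclidean_space \<Rightarrow> real"
  assumes [measurable]: "f \<in> borel_measurable borel"
  shows "(\<integral>x. f x \<partial>unit_ball_measure)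
       = (\<integral>x. indicator (ball 0 1) x * f x \<partial>lborel) / measure lborel (ball (0::'a) 1)"
proof -
  have v: "emeasure lborel (ball (0::'a) 1) = ennreal (measure lborel (ball (0::'a) 1))"
    using emeasure_unit_ball by (intro emeasure_eq_ennreal_measure) auto
  have pos: "measure lborel (ball (0::'a) 1) > 0" by (rule content_ball_pos) simp
  have "unit_ball_measure = density lborel (\<lambda>x::'a. ennreal (indicator (ball 0 1) x / measure lborel (ball (0::'a) 1)))"
    unfolding uniform_measure_def v using pos
    by (intro density_cong) (auto simp: indicator_def divide_ennreal[symmetric] ennreal_1[symmetric] simp del: ennreal_1)
  then have "(\<integral>x. f x \<partial>unit_ball_measure)
      = (\<integral>x. (indicator (ball 0 1) x / measure lborel (ball (0::'a) 1)) *\<^sub>R f x \<partial>lborel)"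
    using pos by (simp only:) (subst integral_density; (measurable)?; simp)
  also have "\<dots> = (\<integral>x. (indicator (ball 0 1) x * f x) / measure lborel (ball (0::'a) 1) \<partial>lborel)"
    by simp
  finally show ?thesis by simp
qed

text \<open>Squaring makes the cutoff continuously differentiable at \<open>s = 1\<close>. With
  \<open>s = x \<bullet> x\<close> it is positive inside the unit ball and vanishes outside.\<close>

definition bump :: "real \<Rightarrow> real" where "bump s = (max 0 (1 - s))\<^sup>2"

lemma bump_deriv: "(bump has_real_derivative - 2 * max 0 (1 - s)) (at s)"
proof -
  have sq: "((\<lambda>u. (max 0 u)\<^sup>2) has_real_derivative 2 * max 0 u) (at u)" for u :: real
  proof (cases "u = 0")
    case True
    have "((\<lambda>u::real. (max 0 u)\<^sup>2) has_real_derivative 0) (at 0)"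
      unfolding DERIV_def
    proof (rule Lim_null_comparison)
      show "((\<lambda>u::real. \<bar>u\<bar>) \<longlongrightarrow> 0) (at 0)" by (rule tendsto_eq_intros | simp)+
      show "\<forall>\<^sub>F h in at (0::real). norm (((max 0 (0 + h))\<^sup>2 - (max 0 0)\<^sup>2) / h) \<le> \<bar>h\<bar>"
        by (auto simp: eventually_at max_def power2_eq_square intro!: exI[of _ 1])
    qed
    with True show ?thesis by simp
  next
    case False
    then consider "u > 0" | "u < 0" by linarith
    then show ?thesis
    proof cases
      case 1
      have "((\<lambda>u. u\<^sup>2) has_real_derivative 2 * u) (at u)" by (auto intro!: derivative_eq_intros)
      then have "((\<lambda>u. (max 0 u)\<^sup>2) has_real_derivative 2 * u) (at u)"
        by (rule has_field_derivative_transform_within_open[of _ _ _ "{0<..}"]) (use 1 in auto)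
      then show ?thesis using 1 by simp
    next
      case 2
      have "((\<lambda>u. 0) has_real_derivative 0) (at u)" by simp
      then have "((\<lambda>u. (max 0 u)\<^sup>2) has_real_derivative 0) (at u)"
        by (rule has_field_derivative_transform_within_open[of _ _ _ "{..<0}"]) (use 2 in auto)
      then show ?thesis using 2 by simp
    qed
  qed
  have "((\<lambda>s. (max 0 (1 - s))\<^sup>2) has_real_derivative 2 * max 0 (1 - s) * (- 1)) (at s)"
    by (rule DERIV_chain2[of "\<lambda>u. (max 0 u)\<^sup>2" _ "\<lambda>s. 1 - s"])
       (auto intro!: derivative_eq_intros sq)
  then show ?thesis by (simp add: bump_def[abs_def])
qed

lemma rpf_directional_derivative:
  assumes "real_polynomial_function p"
  shows "((\<lambda>s. p (x + s *\<^sub>R b)) has_real_derivative pd b p (x::'a::euclidean_space)) (at 0)"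
proof -
  have D: "(p has_derivative frechet_derivative p (at (x + 0 *\<^sub>R b))) (at (x + 0 *\<^sub>R b))"
    using rpf_has_derivative[OF assms] .
  have "((\<lambda>s. p (x + s *\<^sub>R b)) has_derivative (\<lambda>s. frechet_derivative p (at (x + 0 *\<^sub>R b)) (s *\<^sub>R b))) (at 0)"
    by (rule has_derivative_compose[of "\<lambda>s. x + s *\<^sub>R b" "\<lambda>s. s *\<^sub>R b" 0 UNIV p, OF _ D])
       (auto intro!: derivative_eq_intros)
  moreover have "frechet_derivative p (at (x + 0 *\<^sub>R b)) (s *\<^sub>R b) = pd b p x * s" for s
    using has_derivative_linear[OF D] by (simp add: linear_scale pd_def)
  ultimately show ?thesis by (simp add: has_field_derivative_def)
qed

text \<open>The field \<open>|x|\<^sup>2 \<nabla>p - k p x\<close> is tangent to all spheres around \<open>0\<close>, so that cutting it off by a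
  radial function does not change its divergence.\<close>
theorem sphere_integral_laplacian:
  fixes p :: "'a::euclidean_space \<Rightarrow> real"
  assumes p: "p \<in> hpoly k"
  shows "(\<integral>x. laplacian p x \<partial>sphere_measure)
       = real k * (real k + real DIM('a) - 2) * (\<integral>x. p x \<partial>sphere_measure)"
proof -
  let ?N = "real DIM('a)"
  have rp: "real_polynomial_function p" using p by auto
  define V where "V b x = (x \<bullet> x) * pd b p x - real k * ((x \<bullet> b) * p x)" for b x
  define dV where "dV b x = (x \<bullet> x) * pd b (pd b p) x + 2 * (x \<bullet> b) * pd b p x
      - real k * ((x \<bullet> b) * pd b p x + p x)" for b x
  define G where "G b x = dV b x * bump (x \<bullet> x) + V b x * (- 2 * max 0 (1 - x \<bullet> x) * (2 * (x \<bullet> b)))" for b x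
  define H where "H x = (x \<bullet> x) * laplacian p x + (- (real k * (real k + ?N - 2))) * p x" for x
  have rV: "real_polynomial_function (V b)" for b
    unfolding V_def[abs_def]
    by (intro real_polynomial_function_diff rpf_mult rpf_inner_self rpf_pd rp rpf_const rpf_inner)
  have pdV: "pd b (V b) = dV b" if "b \<in> Basis" for b
  proof -
    have "V b = (\<lambda>x. (x \<bullet> x) * pd b p x + (- real k) * ((x \<bullet> b) * p x))"
      by (auto simp: V_def)
    then have "pd b (V b) = (\<lambda>x. ((x \<bullet> x) * pd b (pd b p) x + 2 * (x \<bullet> b) * pd b p x)
        + (- real k) * ((x \<bullet> b) * pd b p x + (b \<bullet> b) * p x))"
      by (simp only: pd_add pd_mult pd_cmult pd_const rpf_mult rpf_const rpf_inner rpf_inner_self rpf_pd rp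
          pd_inner pd_inner_self mult_zero_left add_0_right)
    with that show ?thesis by (auto simp: dV_def fun_eq_iff algebra_simps)
  qed
  have sumG: "(\<Sum>b\<in>Basis. G b x) = H x * bump (x \<bullet> x)" for x
  proof -
    have e: "(\<Sum>b\<in>Basis. (x \<bullet> b) * pd b p x) = real k * p x" by (rule euler_homogeneous[OF p])
    have xx: "(\<Sum>b\<in>Basis. (x \<bullet> b) * (x \<bullet> b)) = x \<bullet> x" by (rule euclidean_inner[symmetric])
    have "(\<Sum>b\<in>Basis. V b x * (x \<bullet> b)) = (x \<bullet> x) * (\<Sum>b\<in>Basis. (x \<bullet> b) * pd b p x)
        - real k * p x * (\<Sum>b\<in>Basis. (x \<bullet> b) * (x \<bullet> b))"
      unfolding sum_distrib_left sum_subtractf[symmetric]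
      by (intro sum.cong) (auto simp: V_def algebra_simps)
    then have 1: "(\<Sum>b\<in>Basis. V b x * (x \<bullet> b)) = 0" unfolding e xx by simp
    have "(\<Sum>b\<in>Basis. dV b x) = (x \<bullet> x) * laplacian p x
        + (2 - real k) * (\<Sum>b\<in>Basis. (x \<bullet> b) * pd b p x) - (\<Sum>b\<in>(Basis::'a set). real k * p x)"
      unfolding sum_distrib_left sum_subtractf[symmetric] sum.distrib[symmetric] laplacian_pd
      by (intro sum.cong) (auto simp: dV_def algebra_simps)
    then have 2: "(\<Sum>b\<in>Basis. dV b x) = H x"
      unfolding e by (simp add: H_def algebra_simps)
    have "(\<Sum>b\<in>Basis. G b x) = (\<Sum>b\<in>Basis. dV b x) * bump (x \<bullet> x)
        + (\<Sum>b\<in>Basis. V b x * (x \<bullet> b)) * (- 4 * max 0 (1 - x \<bullet> x))"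
      unfolding sum_distrib_right sum.distrib[symmetric]
      by (intro sum.cong) (auto simp: G_def algebra_simps)
    then show ?thesis by (simp add: 1 2)
  qed
  have bump_cont: "continuous_on UNIV (\<lambda>x::'a. bump (x \<bullet> x))"
    unfolding bump_def by (intro continuous_intros)
  have gt1: "x \<bullet> x \<ge> 1" if "norm x \<ge> 1" for x :: 'a
    using that by (simp add: dot_square_norm)
  have int: "integrable lborel (G b)" "(\<integral>x. G b x \<partial>lborel) = 0" if "b \<in> Basis" for b
  proof -
    have "real_polynomial_function (dV b)" using pdV[OF that] rpf_pd[OF rV, of b b] by simp
    then have "continuous_on UNIV (G b)"
      unfolding G_def[abs_def] by (intro continuous_intros bump_cont rpf_continuous_on rV)
    moreover have "continuous_on UNIV (\<lambda>x. V b x * bump (x \<bullet> x))"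
      by (intro continuous_intros bump_cont rpf_continuous_on rV)
    moreover have "((\<lambda>s. V b (x + s *\<^sub>R b) * bump ((x + s *\<^sub>R b) \<bullet> (x + s *\<^sub>R b)))
        has_real_derivative G b x) (at 0)" for x
    proof -
      have "((\<lambda>s. (x + s *\<^sub>R b) \<bullet> (x + s *\<^sub>R b)) has_real_derivative 2 * (x \<bullet> b)) (at 0)"
        using rpf_directional_derivative[OF rpf_inner_self, of x b] by simp
      from DERIV_chain2[OF bump_deriv this]
      have "((\<lambda>s. bump ((x + s *\<^sub>R b) \<bullet> (x + s *\<^sub>R b))) has_real_derivative
          - 2 * max 0 (1 - x \<bullet> x) * (2 * (x \<bullet> b))) (at 0)" by simp
      from DERIV_mult[OF rpf_directional_derivative[OF rV, of b x b] this] show ?thesis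
        by (simp add: G_def pdV[OF that] algebra_simps)
    qed
    ultimately show "integrable lborel (G b)" "(\<integral>x. G b x \<partial>lborel) = 0"
      using lborel_integral_partial_derivative[of "\<lambda>x. V b x * bump (x \<bullet> x)" "G b" b] that gt1
      by (auto simp: bump_def G_def)
  qed
  have "(\<integral>x. H x * bump (x \<bullet> x) \<partial>lborel) = (\<integral>x. (\<Sum>b\<in>Basis. G b x) \<partial>lborel)"
    by (simp add: sumG)
  also have "\<dots> = 0" using int by (simp add: Bochner_Integration.integral_sum)
  finally have 0: "(\<integral>x. H x * bump (x \<bullet> x) \<partial>lborel) = 0" .
  \<comment> \<open>The cases are due to the truncated \<open>k - 2\<close>: below degree 2 the
    Laplacian vanishes.\<close>
  have H: "H \<in> hpoly k"
  proof (cases "k < 2")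
    case True
    then have "H = (\<lambda>x. (- (real k * (real k + ?N - 2))) * p x)"
      using laplacian_hpoly_less_2[OF p] by (auto simp: H_def)
    then show ?thesis using hpoly_cmult[OF p] by (simp only:)
  next
    case False
    then have "2 + (k - 2) = k" by simp
    with hpoly_mult[OF hpoly_inner_self hpoly_laplacian[OF p]]
    have "(\<lambda>x. (x \<bullet> x) * laplacian p x) \<in> hpoly k" by (simp only:)
    then show ?thesis unfolding H_def[abs_def] by (intro hpoly_add hpoly_cmult p)
  qed
  \<comment> \<open>Since \<open>H\<close> is homogeneous of degree \<open>k\<close>, the radial
    factor of the integrand is \<open>t ^ k\<close> times the cutoff.\<close>
  define \<phi> where "\<phi> t = t ^ k * bump (t\<^sup>2)" for t :: real
  have Hm [measurable]: "H \<in> borel_measurable borel" using H by (intro rpf_measurable) auto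
  have [measurable]: "bump \<in> borel_measurable borel" unfolding bump_def[abs_def] by measurable
  have [measurable]: "\<phi> \<in> borel_measurable borel" unfolding \<phi>_def[abs_def] by measurable
  have Hc: "continuous_on (sphere 0 1) H" using H by (intro rpf_continuous_on) auto
  have "(\<integral>x. H x * bump (x \<bullet> x) \<partial>unit_ball_measure) = 0"
  proof -
    have "(\<lambda>x. indicator (ball 0 1) x * (H x * bump (x \<bullet> x))) = (\<lambda>x. H x * bump (x \<bullet> x))"
    proof
      show "indicator (ball 0 1) x * (H x * bump (x \<bullet> x)) = H x * bump (x \<bullet> x)" for x
        using gt1[of x] by (cases "norm x < 1") (simp_all add: bump_def)
    qed
    moreover have "(\<lambda>x. H x * bump (x \<bullet> x)) \<in> borel_measurable borel" by measurable
    ultimately show ?thesis using 0 by (simp only: unit_ball_integral_eq div_0)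
  qed
  moreover have "(\<integral>x. H x * bump (x \<bullet> x) \<partial>unit_ball_measure)
      = (\<integral>x. \<phi> (norm x) \<partial>(unit_ball_measure :: 'a measure)) * (\<integral>x. H x \<partial>sphere_measure)"
  proof (rule polar_integral(2)[OF Hc, where B = 1])
    fix t :: real assume "0 \<le> t" "t < 1"
    then have "t ^ k \<le> 1" "0 \<le> t ^ k" "0 \<le> 1 - t\<^sup>2" "1 - t\<^sup>2 \<le> 1" by (auto simp: power_le_one)
    moreover from this have "bump (t\<^sup>2) \<le> 1" "0 \<le> bump (t\<^sup>2)" by (auto simp: bump_def power_le_one)
    ultimately show "\<bar>\<phi> t\<bar> \<le> 1" unfolding \<phi>_def by (simp add: abs_mult mult_le_one)
  next
    fix x :: 'a assume "x \<noteq> 0"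
    then have "H (norm x *\<^sub>R sgn x) = norm x ^ k * H (sgn x)" by (intro hpoly_scale[OF H])
    then show "H x * bump (x \<bullet> x) = \<phi> (norm x) * H (sgn x)"
      using \<open>x \<noteq> 0\<close> by (simp add: \<phi>_def sgn_div_norm dot_square_norm)
  qed measurable
  \<comment> \<open>The radial factor is positive almost everywhere in the ball, so its integral can
    be divided out.\<close>
  moreover have "(\<integral>x. \<phi> (norm x) \<partial>(unit_ball_measure :: 'a measure)) \<noteq> 0"
  proof
    assume z: "(\<integral>x. \<phi> (norm x) \<partial>(unit_ball_measure :: 'a measure)) = 0"
    have nn: "0 \<le> \<phi> (norm x)" for x :: 'a by (simp add: \<phi>_def bump_def)
    have "integrable unit_ball_measure (\<lambda>x::'a. \<phi> (norm x))"
    proof (rule unit_ball.integrable_const_bound[of _ 1])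
      show "AE x in unit_ball_measure. norm (\<phi> (norm (x::'a))) \<le> 1"
      proof (rule AE_mp[OF AE_unit_ball], rule AE_I2, clarify)
        fix x :: 'a assume "norm x < 1"
        then have "norm x ^ k \<le> 1" "0 \<le> 1 - (norm x)\<^sup>2" "1 - (norm x)\<^sup>2 \<le> 1" by (auto simp: power_le_one)
        moreover from this have "bump ((norm x)\<^sup>2) \<le> 1" "0 \<le> bump ((norm x)\<^sup>2)" by (auto simp: bump_def power_le_one)
        ultimately show "norm (\<phi> (norm x)) \<le> 1" unfolding \<phi>_def by (simp add: abs_mult mult_le_one)
      qed
    qed simp
    then have "AE x in unit_ball_measure. \<phi> (norm (x::'a)) = 0"
      using integral_nonneg_eq_0_iff_AE[of unit_ball_measure "\<lambda>x::'a. \<phi> (norm x)"] nn z by simp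
    with AE_unit_ball have "AE x in (unit_ball_measure :: 'a measure). False"
    proof eventually_elim
      case (elim x)
      then have "(norm x)\<^sup>2 < 1" by (simp add: abs_square_less_1)
      with elim show False by (auto simp: \<phi>_def bump_def)
    qed
    then show False by simp
  qed
  ultimately have "(\<integral>x. H x \<partial>sphere_measure) = 0" by simp
  moreover have "(\<integral>x. H x \<partial>sphere_measure)
      = (\<integral>x. laplacian p x + (- (real k * (real k + ?N - 2))) * p x \<partial>sphere_measure)"
    by (rule Bochner_Integration.integral_cong) (auto simp: H_def dot_square_norm)
  moreover have "\<dots> = (\<integral>x. laplacian p x \<partial>sphere_measure)
      + (- (real k * (real k + ?N - 2))) * (\<integral>x. p x \<partial>sphere_measure)"
    using rp by (subst Bochner_Integration.integral_add) (auto intro!: rpf_continuous_on)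
  ultimately show ?thesis by simp
qed

section \<open>Orthogonality of harmonics of different degree\<close>

lemma pd_hpoly_0: "p \<in> hpoly 0 \<Longrightarrow> pd b p = (\<lambda>x. 0)"
  by (subst hpoly_0_const) auto

text \<open>The Laplacian of \<open>p * q\<close> is twice the sum of the products of partial
  derivatives. These are harmonics of degrees \<open>l - 1\<close> and \<open>j - 1\<close>,
  orthogonal by induction. As \<open>p * q\<close> has positive degree \<open>l + j\<close>,
  \<open>sphere_integral_laplacian\<close> recovers its integral with the nonzero factor
  \<open>(l + j) * (l + j + DIM('a) - 2)\<close>.\<close>

theorem harm_orthogonal:
  fixes p q :: "'a::euclidean_space \<Rightarrow> real"
  assumes N: "DIM('a) \<ge> 2"
  shows "p \<in> harm l \<Longrightarrow> q \<in> harm j \<Longrightarrow> l \<noteq> j \<Longrightarrow> (\<integral>x. p x * q x \<partial>sphere_measure) = 0"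
proof (induction l arbitrary: j p q)
  case (0 j p q)
  have "pd b p = (\<lambda>x. 0)" for b
    using 0 by (intro pd_hpoly_0) auto
  then have "laplacian (\<lambda>x. p x * q x) x = 0" for x
    using 0 by (subst laplacian_mult) (auto simp: harm_def)
  with sphere_integral_laplacian[OF hpoly_mult[OF harm_hpoly harm_hpoly], of p 0 q j] 0 N
  show ?case by auto
next
  case (Suc l j p q)
  have lap: "laplacian (\<lambda>x. p x * q x) x = (\<Sum>b\<in>Basis. 2 * (pd b p x * pd b q x))" for x
    using Suc.prems by (subst laplacian_mult) (auto simp: harm_def sum_distrib_left)
  have z: "(\<integral>x. pd b p x * pd b q x \<partial>sphere_measure) = 0" for b
  proof (cases j)
    case 0
    then have "pd b q = (\<lambda>x. 0)"
      using Suc.prems by (intro pd_hpoly_0) auto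
    then show ?thesis by simp
  next
    case j: (Suc i)
    then show ?thesis
      using Suc.IH[of "pd b p" "pd b q" i] harm_pd[OF Suc.prems(1)] harm_pd[OF Suc.prems(2)] Suc.prems(3)
      by simp
  qed
  have "real_polynomial_function (pd b p)" "real_polynomial_function (pd b q)" for b
    using Suc.prems by auto
  then have "(\<integral>x. laplacian (\<lambda>x. p x * q x) x \<partial>sphere_measure) = 0"
    unfolding lap using z
    by (subst Bochner_Integration.integral_sum)
       (auto intro!: integrable_sphere continuous_intros rpf_continuous_on)
  with sphere_integral_laplacian[OF hpoly_mult[OF harm_hpoly harm_hpoly], of p "Suc l" q j] Suc.prems N
  show ?case by auto
qed

section \<open>Expansions in spherical harmonics\<close>

lemma sphere_integral_cong:
  "(\<And>x. x \<in> sphere 0 1 \<Longrightarrow> f x = g x) \<Longrightarrow>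
   (\<integral>x. f x \<partial>sphere_measure) = (\<integral>x. g x \<partial>(sphere_measure :: 'a::euclidean_space measure))"
  by (rule Bochner_Integration.integral_cong) auto

locale sphere_basis =
  fixes d :: nat and Z :: "nat \<Rightarrow> nat" and Y :: "nat \<Rightarrow> nat \<Rightarrow> 'a::euclidean_space \<Rightarrow> real"
  assumes dim: "DIM('a) = d + 1" and d1: "d \<ge> 1" and onb: "harmonic_onb Z Y"
begin

abbreviation S :: "'a set" where "S \<equiv> sphere 0 1"

abbreviation coef :: "('a \<Rightarrow> real) \<Rightarrow> nat \<Rightarrow> nat \<Rightarrow> real" where
  "coef g l k \<equiv> distribution_of g (Y l k)"

definition energy :: "('a \<Rightarrow> real) \<Rightarrow> nat \<Rightarrow> real" where
  "energy g l = (\<Sum>k=1..Z l. (coef g l k)\<^sup>2)"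

definition proj :: "nat \<Rightarrow> ('a \<Rightarrow> real) \<Rightarrow> 'a \<Rightarrow> real" where
  "proj l g x = (\<Sum>k=1..Z l. coef g l k * Y l k x)"

text \<open>The reproducing kernel of the spherical harmonics of degree \<open>l\<close>; see
  \<open>zonal_reproducing\<close>.\<close>

definition zonal :: "nat \<Rightarrow> 'a \<Rightarrow> 'a \<Rightarrow> real" where
  "zonal l x y = (\<Sum>k=1..Z l. Y l k x * Y l k y)"

text \<open>\<open>harmonic_onb\<close> fixes \<open>Y l k\<close> only on the sphere; this is a
  homogeneous harmonic extension. It is 0 for indices outside the basis, so that
  \<open>solid_harm\<close> holds for all \<open>k\<close>.\<close>

definition solid :: "nat \<Rightarrow> nat \<Rightarrow> 'a \<Rightarrow> real" where
  "solid l k = (if k \<in> {1..Z l} then SOME p. p \<in> harm l \<and> (\<forall>x\<in>S. Y l k x = p x) else (\<lambda>x. 0))"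

lemma solid_harm: "solid l k \<in> harm l"
  and solid_eq: "k \<in> {1..Z l} \<Longrightarrow> x \<in> S \<Longrightarrow> Y l k x = solid l k x"
proof -
  have "solid l k \<in> harm l \<and> (\<forall>x\<in>S. Y l k x = solid l k x)" if "k \<in> {1..Z l}"
  proof -
    have "Y l k \<in> spherical_harmonics l" using onb that by (auto simp: harmonic_onb_def)
    then have "\<exists>p. p \<in> harm l \<and> (\<forall>x\<in>S. Y l k x = p x)"
      by (auto simp: spherical_harmonics_def harm_def hpoly_def)
    from someI_ex[OF this] show ?thesis unfolding solid_def if_P[OF that] .
  qed
  then show "solid l k \<in> harm l" and "k \<in> {1..Z l} \<Longrightarrow> x \<in> S \<Longrightarrow> Y l k x = solid l k x"
    by (auto simp: solid_def harm_zero)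
qed

lemma harm_continuous_on: "p \<in> harm l \<Longrightarrow> continuous_on A (p :: 'a \<Rightarrow> real)"
  by (intro rpf_continuous_on) auto

lemma continuous_on_Y: "k \<in> {1..Z l} \<Longrightarrow> continuous_on S (Y l k)"
  using harm_continuous_on[OF solid_harm] solid_eq by (subst continuous_on_cong[OF refl]) auto

lemma continuous_on_proj: "continuous_on S (proj l g)"
  unfolding proj_def[abs_def] by (intro continuous_intros continuous_on_Y) auto

lemma continuous_on_zonal: "continuous_on S (zonal l x)"
  unfolding zonal_def[abs_def] by (intro continuous_intros continuous_on_Y) auto

lemma orthonormal:
  assumes "k \<in> {1..Z l}" "m \<in> {1..Z j}"
  shows "coef (Y l k) j m = (if l = j \<and> k = m then 1 else 0)"
proof (cases "l = j")
  case True
  then show ?thesis using onb assms by (auto simp: harmonic_onb_def distribution_of_def)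
next
  case False
  have "coef (Y l k) j m = (\<integral>x. solid l k x * solid j m x \<partial>sphere_measure)"
    unfolding distribution_of_def using assms by (intro sphere_integral_cong) (simp add: solid_eq)
  also have "\<dots> = 0"
    by (rule harm_orthogonal[OF _ solid_harm solid_harm False]) (use dim d1 in simp)
  finally show ?thesis using False by simp
qed

lemma coef_diff:
  assumes "continuous_on S f" "continuous_on S g" "k \<in> {1..Z l}"
  shows "coef (\<lambda>x. f x - g x) l k = coef f l k - coef g l k"
  using assms unfolding distribution_of_def left_diff_distrib
  by (intro Bochner_Integration.integral_diff integrable_sphere continuous_intros continuous_on_Y)

lemma coef_cmult: "coef (\<lambda>x. c * g x) l k = c * coef g l k"
  unfolding distribution_of_def mult.assoc by simp

lemma coef_sum:
  assumes "\<And>i. i \<in> I \<Longrightarrow> continuous_on S (f i)" "k \<in> {1..Z l}"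
  shows "coef (\<lambda>x. \<Sum>i\<in>I. f i x) l k = (\<Sum>i\<in>I. coef (f i) l k)"
  using assms unfolding distribution_of_def sum_distrib_right
  by (intro Bochner_Integration.integral_sum integrable_sphere continuous_intros continuous_on_Y)

lemma coef_cong: "(\<And>x. x \<in> S \<Longrightarrow> f x = g x) \<Longrightarrow> coef f l k = coef g l k"
  unfolding distribution_of_def by (intro sphere_integral_cong) simp

lemma integral_proj_mult:
  assumes "continuous_on S g" "continuous_on S f"
  shows "(\<integral>x. proj l g x * f x \<partial>sphere_measure) = (\<Sum>k=1..Z l. coef g l k * coef f l k)"
proof -
  have "(\<integral>x. proj l g x * f x \<partial>sphere_measure)
      = (\<Sum>k=1..Z l. \<integral>x. coef g l k * (f x * Y l k x) \<partial>sphere_measure)"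
    unfolding proj_def sum_distrib_right using assms
    by (subst Bochner_Integration.integral_sum[symmetric])
       (auto intro!: integrable_sphere continuous_intros continuous_on_Y sphere_integral_cong sum.cong)
  then show ?thesis by (simp add: distribution_of_def)
qed

lemma coef_combination:
  assumes A: "finite A" and k: "k \<in> {1..Z j}"
  shows "coef (\<lambda>x. \<Sum>l\<in>A. \<Sum>m=1..Z l. c l m * Y l m x) j k = (if j \<in> A then c j k else 0)"
proof -
  have "coef (\<lambda>x. \<Sum>l\<in>A. \<Sum>m=1..Z l. c l m * Y l m x) j k
      = (\<Sum>l\<in>A. \<Sum>m=1..Z l. c l m * coef (Y l m) j k)"
    using k by (subst coef_sum; (subst coef_sum)?; auto simp: coef_cmult intro!: continuous_intros continuous_on_Y)
  also have "\<dots> = (\<Sum>l\<in>A. \<Sum>m=1..Z l. if l = j then (if m = k then c j k else 0) else 0)"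
    using k by (intro sum.cong refl) (auto simp: orthonormal)
  also have "\<dots> = (\<Sum>l\<in>A. if l = j then (\<Sum>m=1..Z l. if m = k then c j k else 0) else 0)"
    by (intro sum.cong refl) auto
  also have "\<dots> = (if j \<in> A then c j k else 0)"
    using A k by (simp add: sum.delta)
  finally show ?thesis .
qed

lemma coef_proj:
  "k \<in> {1..Z j} \<Longrightarrow> coef (proj l g) j k = (if j = l then coef g l k else 0)"
  using coef_combination[of "{l}" k j "\<lambda>l k. coef g l k"] by (auto simp: proj_def[abs_def])

lemma harm_proj:
  assumes p: "p \<in> harm l" and x: "x \<in> S"
  shows "proj l p x = p x"
proof -
  have "p \<in> spherical_harmonics l"
    using p by (auto simp: spherical_harmonics_def harm_def hpoly_def)
  then obtain c where c: "\<And>x. x \<in> S \<Longrightarrow> p x = (\<Sum>k=1..Z l. c k * Y l k x)"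
    using onb unfolding harmonic_onb_def by blast
  have "coef p l k = c k" if "k \<in> {1..Z l}" for k
  proof -
    have "coef p l k = coef (\<lambda>x. \<Sum>i\<in>{l}. \<Sum>m=1..Z i. c m * Y i m x) l k"
      by (rule coef_cong) (simp add: c)
    also have "\<dots> = (if l \<in> {l} then c k else 0)"
      by (rule coef_combination[of "{l}" k l "\<lambda>i m. c m", OF _ that]) simp
    finally show ?thesis by simp
  qed
  then show ?thesis by (simp add: proj_def c[OF x])
qed

lemma coef_harm_neq:
  assumes p: "p \<in> harm l" and "l \<noteq> j" "k \<in> {1..Z j}"
  shows "coef p j k = 0"
proof -
  have "coef p j k = coef (proj l p) j k" by (rule coef_cong) (simp add: harm_proj[OF p])
  then show ?thesis using assms by (simp add: coef_proj)
qed

lemma poly_upto_expansion: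
  assumes p: "poly_upto n p"
  shows "x \<in> S \<Longrightarrow> p x = (\<Sum>l\<le>n. proj l p x)"
    and "n < j \<Longrightarrow> k \<in> {1..Z j} \<Longrightarrow> coef p j k = 0"
proof -
  obtain h where h: "\<And>j. h j \<in> harm j" and ph: "\<And>x. x \<in> S \<Longrightarrow> p x = (\<Sum>j\<le>n. h j x)"
    using poly_upto_harm[OF p] by blast
  have c: "coef p j k = (if j \<le> n then coef (h j) j k else 0)" if "k \<in> {1..Z j}" for j k
  proof -
    have "coef p j k = coef (\<lambda>x. \<Sum>l\<le>n. h l x) j k" by (rule coef_cong) (simp add: ph)
    also have "\<dots> = (\<Sum>l\<le>n. coef (h l) j k)"
      using that by (intro coef_sum harm_continuous_on[OF h]) auto
    also have "\<dots> = (\<Sum>l\<le>n. if l = j then coef (h j) j k else 0)"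
      using that coef_harm_neq[OF h] by (intro sum.cong) auto
    finally show ?thesis by simp
  qed
  show "n < j \<Longrightarrow> k \<in> {1..Z j} \<Longrightarrow> coef p j k = 0" using c by simp
  assume x: "x \<in> S"
  have "proj l p x = h l x" if "l \<le> n" for l
    using harm_proj[OF h x, of l] c that by (simp add: proj_def)
  then show "p x = (\<Sum>l\<le>n. proj l p x)" using ph[OF x] by simp
qed

text \<open>Only one factor is a polynomial. The other may be any continuous function, which is what
  the density argument in \<open>coef_zero_imp\<close> uses.\<close>

lemma parseval:
  assumes p: "poly_upto n p" and g: "continuous_on S g"
  shows "(\<integral>x. p x * g x \<partial>sphere_measure) = (\<Sum>l\<le>n. \<Sum>k=1..Z l. coef p l k * coef g l k)"
proof -
  have cp: "continuous_on S p" using poly_upto_rpf[OF p] by (intro rpf_continuous_on)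
  have "(\<integral>x. p x * g x \<partial>sphere_measure) = (\<integral>x. (\<Sum>l\<le>n. proj l p x * g x) \<partial>sphere_measure)"
    by (rule sphere_integral_cong) (simp add: poly_upto_expansion(1)[OF p] sum_distrib_right)
  also have "\<dots> = (\<Sum>l\<le>n. \<integral>x. proj l p x * g x \<partial>sphere_measure)"
    using g by (intro Bochner_Integration.integral_sum integrable_sphere continuous_intros continuous_on_proj)
  finally show ?thesis using integral_proj_mult[OF cp g] by simp
qed

lemma parseval_square:
  assumes "poly_upto n p"
  shows "(\<integral>x. (p x)\<^sup>2 \<partial>sphere_measure) = (\<Sum>l\<le>n. energy p l)"
  using parseval[OF assms, of p] poly_upto_rpf[OF assms]
  by (simp add: rpf_continuous_on power2_eq_square energy_def)

lemma combination_poly: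
  "\<exists>p. poly_upto n p \<and> (\<forall>x\<in>S. p x = (\<Sum>l\<le>n. \<Sum>k=1..Z l. c l k * Y l k x))"
proof (intro exI conjI ballI)
  show "poly_upto n (\<lambda>x. \<Sum>l\<le>n. \<Sum>k=1..Z l. c l k * solid l k x)"
    by (intro poly_upto_sum poly_upto_cmult poly_upto_hpoly[OF harm_hpoly[OF solid_harm]]) auto
qed (simp add: solid_eq)

lemma bessel:
  assumes g: "continuous_on S g" and A: "finite A"
  shows "(\<Sum>l\<in>A. energy g l) \<le> (\<integral>x. (g x)\<^sup>2 \<partial>sphere_measure)"
proof -
  define P where "P x = (\<Sum>l\<in>A. proj l g x)" for x
  have P: "continuous_on S P" unfolding P_def[abs_def] by (intro continuous_intros continuous_on_proj)
  have Pf: "(\<integral>x. P x * f x \<partial>sphere_measure) = (\<Sum>l\<in>A. \<Sum>k=1..Z l. coef g l k * coef f l k)"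
    if "continuous_on S f" for f
  proof -
    have "(\<integral>x. P x * f x \<partial>sphere_measure) = (\<Sum>l\<in>A. \<integral>x. proj l g x * f x \<partial>sphere_measure)"
      unfolding P_def sum_distrib_right using that
      by (intro Bochner_Integration.integral_sum integrable_sphere continuous_intros continuous_on_proj)
    then show ?thesis using integral_proj_mult[OF g that] by simp
  qed
  have cP: "coef P l k = coef g l k" if "l \<in> A" "k \<in> {1..Z l}" for l k
    using coef_combination[OF A that(2), of "\<lambda>l k. coef g l k"] that
    by (simp add: P_def[abs_def] proj_def)
  have 1: "(\<integral>x. P x * g x \<partial>sphere_measure) = (\<Sum>l\<in>A. energy g l)"
    using Pf[OF g] by (simp add: energy_def power2_eq_square)
  have 2: "(\<integral>x. P x * P x \<partial>sphere_measure) = (\<Sum>l\<in>A. energy g l)"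
    unfolding Pf[OF P] energy_def by (intro sum.cong refl) (simp add: cP power2_eq_square)
  have "0 \<le> (\<integral>x. (g x - P x)\<^sup>2 \<partial>sphere_measure)" by (rule integral_nonneg_AE) simp
  also have "\<dots> = (\<integral>x. (g x)\<^sup>2 - 2 * (P x * g x) + P x * P x \<partial>sphere_measure)"
    by (rule sphere_integral_cong) (simp add: power2_eq_square algebra_simps)
  also have "\<dots> = (\<integral>x. (g x)\<^sup>2 \<partial>sphere_measure) - 2 * (\<integral>x. P x * g x \<partial>sphere_measure)
      + (\<integral>x. P x * P x \<partial>sphere_measure)"
    using g P by (subst Bochner_Integration.integral_add Bochner_Integration.integral_diff;
        (subst Bochner_Integration.integral_diff)?; auto intro!: integrable_sphere continuous_intros)
  finally show ?thesis unfolding 1 2 by simp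
qed

text \<open>A polynomial \<open>p\<close> close to \<open>g\<close> is orthogonal to
  \<open>g\<close> by Parseval, so the square integral of \<open>g\<close> is the integral of
  \<open>(g - p) * g\<close>, which is small.\<close>

lemma coef_zero_imp:
  assumes g: "continuous_on S g" and z: "\<And>l k. k \<in> {1..Z l} \<Longrightarrow> coef g l k = 0" and x: "x \<in> S"
  shows "g x = 0"
proof -
  have "(\<integral>x. (g x)\<^sup>2 \<partial>sphere_measure) = 0"
  proof (rule ccontr)
    assume ne: "(\<integral>x. (g x)\<^sup>2 \<partial>sphere_measure) \<noteq> 0"
    define I where "I = (\<integral>x. (g x)\<^sup>2 \<partial>sphere_measure)"
    have "0 \<le> I" unfolding I_def by (rule integral_nonneg_AE) simp
    with ne have I: "I > 0" by (simp add: I_def less_le)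
    define J where "J = (\<integral>x. \<bar>g x\<bar> \<partial>sphere_measure)"
    have J: "J \<ge> 0" unfolding J_def by (rule integral_nonneg_AE) simp
    \<comment> \<open>Chosen so that \<open>e * J < I\<close>; the \<open>+ 1\<close> covers
      \<open>J = 0\<close>.\<close>
    define e where "e = I / (2 * (J + 1))"
    have e: "e > 0" using I J by (simp add: e_def)
    obtain p where p: "real_polynomial_function p" "\<And>x. x \<in> S \<Longrightarrow> \<bar>g x - p x\<bar> < e"
      using Stone_Weierstrass_real_polynomial_function[OF compact_sphere g e] by blast
    obtain n where n: "poly_upto n p" using rpf_poly_upto[OF p(1)] by blast
    have cp: "continuous_on S p" using p(1) by (rule rpf_continuous_on)
    have pg: "(\<integral>x. p x * g x \<partial>sphere_measure) = 0"
      unfolding parseval[OF n g] using z by simp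
    have "I = (\<integral>x. (g x - p x) * g x + p x * g x \<partial>sphere_measure)"
      unfolding I_def by (rule sphere_integral_cong) (simp add: power2_eq_square algebra_simps)
    also have "\<dots> = (\<integral>x. (g x - p x) * g x \<partial>sphere_measure)"
      using g cp pg by (subst Bochner_Integration.integral_add) (auto intro!: integrable_sphere continuous_intros)
    also have "\<dots> \<le> (\<integral>x. e * \<bar>g x\<bar> \<partial>sphere_measure)"
    proof (rule integral_mono)
      fix x assume "x \<in> space (sphere_measure :: 'a measure)"
      then have "\<bar>g x - p x\<bar> \<le> e" using p(2)[of x] by simp
      then have "\<bar>g x - p x\<bar> * \<bar>g x\<bar> \<le> e * \<bar>g x\<bar>" by (intro mult_right_mono) auto
      then show "(g x - p x) * g x \<le> e * \<bar>g x\<bar>"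
        by (metis abs_ge_self abs_mult order_trans)
    qed (use g cp in \<open>auto intro!: integrable_sphere continuous_intros\<close>)
    also have "\<dots> = e * J" by (simp add: J_def)
    also have "\<dots> < I"
    proof -
      have "I * J < I * (2 * (J + 1))" using I J by (intro mult_strict_left_mono) auto
      then show ?thesis using J unfolding e_def by (simp add: field_simps)
    qed
    finally show False by simp
  qed
  then have "(g x)\<^sup>2 = 0"
    by (rule sphere_integral_zero_imp[of "\<lambda>x. (g x)\<^sup>2" x, rotated 2, OF _ x])
       (auto intro!: continuous_intros g)
  then show ?thesis by simp
qed

subsection \<open>Zonal kernels\<close>

lemma zonal_reproducing:
  assumes p: "p \<in> harm j" and x: "x \<in> S"
  shows "(\<integral>y. zonal l x y * p y \<partial>sphere_measure) = (if l = j then p x else 0)"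
proof -
  have "(\<integral>y. zonal l x y * p y \<partial>sphere_measure) = (\<integral>y. (\<Sum>k=1..Z l. Y l k x * (p y * Y l k y)) \<partial>sphere_measure)"
    by (rule sphere_integral_cong) (simp add: zonal_def sum_distrib_right sum_distrib_left mult_ac)
  also have "\<dots> = (\<Sum>k=1..Z l. Y l k x * coef p l k)"
    unfolding distribution_of_def
    by (subst Bochner_Integration.integral_sum)
       (auto intro!: integrable_sphere continuous_intros continuous_on_Y harm_continuous_on[OF p])
  also have "\<dots> = proj l p x" by (simp add: proj_def mult.commute)
  also have "\<dots> = (if l = j then p x else 0)"
    using harm_proj[OF p x] coef_harm_neq[OF p, of l] by (auto simp: proj_def)
  finally show ?thesis .
qed

text \<open>With \<open>upper\<close>, the weights of the three-term recurrence
  \<open>zonal_recurrence\<close>. For \<open>d = 1\<close> the value at \<open>l = 0\<close> is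
  \<open>0 / 0 = 0\<close>, which is the right one.\<close>

definition lower :: "nat \<Rightarrow> real" where "lower l = real l / (2 * real l + real d - 1)"

definition upper :: "nat \<Rightarrow> real" where "upper l = 1 - lower l"

text \<open>A coordinate times a harmonic splits into a harmonic of degree \<open>j + 1\<close> and
  \<open>x \<bullet> x\<close> times one of degree \<open>j - 1\<close>. The factor in
  \<open>q\<close> makes the Laplacians cancel: for \<open>j \<ge> 1\<close> those of
  \<open>(x \<bullet> b) * p x\<close> and \<open>(x \<bullet> x) * q b x\<close> are
  \<open>2 * pd b p x\<close> and \<open>2 * (2 * j + d - 1) * q b x\<close>.\<close>

lemma coordinate_mult_harm:
  fixes p :: "'a \<Rightarrow> real"
  assumes p: "p \<in> harm j"
  defines "q \<equiv> \<lambda>b x. inverse (2 * real j + real d - 1) * pd b p x"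
  shows "q b \<in> harm (j - 1)" "j = 0 \<Longrightarrow> q b = (\<lambda>x. 0)"
    "b \<in> Basis \<Longrightarrow> (\<lambda>x. (x \<bullet> b) * p x + (- 1) * ((x \<bullet> x) * q b x)) \<in> harm (Suc j)"
proof -
  show q: "q b \<in> harm (j - 1)" unfolding q_def by (intro harm_cmult harm_pd p)
  show q0: "q b = (\<lambda>x. 0)" if "j = 0"
    using pd_hpoly_0[of p b] p that by (auto simp: q_def)
  assume b: "b \<in> Basis"
  have rp: "real_polynomial_function p" and rq: "real_polynomial_function (q b)" using p q by auto
  have h1: "(\<lambda>x. (x \<bullet> b) * p x) \<in> hpoly (Suc j)"
    using hpoly_mult[OF hpoly_inner harm_hpoly[OF p], of b] by simp
  have h2: "(\<lambda>x. (x \<bullet> x) * q b x) \<in> hpoly (Suc j)"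
  proof (cases j)
    case 0 then show ?thesis by (simp add: q0 hpoly_zero)
  next
    case (Suc i)
    with hpoly_mult[OF hpoly_inner_self harm_hpoly[OF q]] show ?thesis by simp
  qed
  have lap1: "laplacian (\<lambda>x. (x \<bullet> b) * p x) x = 2 * pd b p x" for x
  proof -
    have "laplacian (\<lambda>x. x \<bullet> b) x = 0" by (simp add: laplacian_pd)
    moreover have "(\<Sum>c\<in>Basis. pd c (\<lambda>x. x \<bullet> b) x * pd c p x) = (\<Sum>c\<in>Basis. if c = b then pd b p x else 0)"
      using b by (intro sum.cong) (auto simp: inner_Basis)
    moreover have "laplacian p x = 0" using p by (simp add: harm_def)
    ultimately show ?thesis using b by (subst laplacian_mult[OF rpf_inner rp]) simp
  qed
  have lap2: "laplacian (\<lambda>x. (x \<bullet> x) * q b x) x = 2 * pd b p x" for x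
  proof (cases j)
    case 0
    then show ?thesis using pd_hpoly_0[of p b] p by (auto simp: q0 laplacian_pd)
  next
    case (Suc i)
    define D where "D = 2 * real j + real d - 1"
    have "laplacian (q b) x = 0" using q by (simp add: harm_def)
    moreover have "2 * real DIM('a) + 4 * real (j - 1) = 2 * D"
      using dim Suc by (simp add: D_def)
    moreover have "D > 0" using Suc d1 by (simp add: D_def)
    moreover have "q b x = inverse D * pd b p x" by (simp add: q_def D_def)
    ultimately show ?thesis
      unfolding laplacian_inner_self_mult[OF harm_hpoly[OF q]] by simp
  qed
  have "laplacian (\<lambda>x. (x \<bullet> b) * p x + (- 1) * ((x \<bullet> x) * q b x)) x = 0" for x
  proof -
    have "laplacian (\<lambda>x. (x \<bullet> b) * p x + (- 1) * ((x \<bullet> x) * q b x)) x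
        = laplacian (\<lambda>x. (x \<bullet> b) * p x) x + laplacian (\<lambda>x. (- 1) * ((x \<bullet> x) * q b x)) x"
      by (rule laplacian_add[OF hpoly_rpf[OF h1] hpoly_rpf[OF hpoly_cmult[OF h2]]])
    also have "\<dots> = 2 * pd b p x + (- 1) * (2 * pd b p x)"
      by (simp only: laplacian_cmult[OF hpoly_rpf[OF h2]] lap1 lap2)
    finally show ?thesis by simp
  qed
  with hpoly_add[OF h1 hpoly_cmult[OF h2]]
  show "(\<lambda>x. (x \<bullet> b) * p x + (- 1) * ((x \<bullet> x) * q b x)) \<in> harm (Suc j)"
    unfolding harm_def by blast
qed

text \<open>Expand \<open>x \<bullet> y\<close> in coordinates and split each
  \<open>(y \<bullet> b) * p y\<close> by \<open>coordinate_mult_harm\<close>; the kernel reproduces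
  the part of its own degree. Euler's identity sums the lower parts to \<open>lower j * p x\<close>,
  and \<open>upper j\<close> is what remains.\<close>

lemma integral_inner_zonal:
  assumes p: "p \<in> harm j" and x: "x \<in> S"
  shows "(\<integral>y. ((x \<bullet> y) * zonal l x y) * p y \<partial>sphere_measure)
       = (if l = Suc j then upper j * p x else if Suc l = j then lower j * p x else 0)"
proof -
  define q where "q = (\<lambda>b x. inverse (2 * real j + real d - 1) * pd b p x)"
  define u where "u b x = (x \<bullet> b) * p x + (- 1) * ((x \<bullet> x) * q b x)" for b x
  have q: "q b \<in> harm (j - 1)" "j = 0 \<Longrightarrow> q b = (\<lambda>x. 0)" for b
    unfolding q_def using coordinate_mult_harm(1,2)[OF p] by auto
  have u: "u b \<in> harm (Suc j)" if "b \<in> Basis" for b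
    using coordinate_mult_harm(3)[OF p that] unfolding u_def[abs_def] q_def .
  have xx: "(\<Sum>b\<in>Basis. (x \<bullet> b) * (x \<bullet> b)) = 1"
    using x unfolding euclidean_inner[symmetric] by (simp add: norm_eq_1)
  have sq: "(\<Sum>b\<in>Basis. (x \<bullet> b) * q b x) = lower j * p x"
  proof -
    have "(\<Sum>b\<in>Basis. (x \<bullet> b) * q b x) = inverse (2 * real j + real d - 1) * (\<Sum>b\<in>Basis. (x \<bullet> b) * pd b p x)"
      unfolding sum_distrib_left q_def by (intro sum.cong) auto
    then show ?thesis using p by (subst (asm) euler_homogeneous) (auto simp: lower_def field_simps)
  qed
  have su: "(\<Sum>b\<in>Basis. (x \<bullet> b) * u b x) = upper j * p x"
  proof -
    have "(\<Sum>b\<in>Basis. (x \<bullet> b) * u b x) = (\<Sum>b\<in>Basis. (x \<bullet> b) * (x \<bullet> b)) * p x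
        - (x \<bullet> x) * (\<Sum>b\<in>Basis. (x \<bullet> b) * q b x)"
      unfolding sum_distrib_left sum_distrib_right sum_subtractf[symmetric] u_def
      by (intro sum.cong) (auto simp: algebra_simps)
    then show ?thesis using x by (simp add: xx sq upper_def norm_eq_1 algebra_simps)
  qed
  have "(\<integral>y. ((x \<bullet> y) * zonal l x y) * p y \<partial>sphere_measure)
      = (\<integral>y. (\<Sum>b\<in>Basis. (x \<bullet> b) * (zonal l x y * u b y + zonal l x y * q b y)) \<partial>sphere_measure)"
  proof (rule sphere_integral_cong)
    fix y :: 'a assume y: "y \<in> S"
    then have "(y \<bullet> b) * p y = u b y + q b y" for b by (simp add: u_def norm_eq_1)
    then have "(x \<bullet> b) * (zonal l x y * u b y + zonal l x y * q b y) = (x \<bullet> b) * (y \<bullet> b) * (zonal l x y * p y)" for b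
      by (metis (no_types, opaque_lifting) distrib_left mult.assoc mult.left_commute)
    moreover have "((x \<bullet> y) * zonal l x y) * p y = (\<Sum>b\<in>Basis. (x \<bullet> b) * (y \<bullet> b) * (zonal l x y * p y))"
      by (subst euclidean_inner) (simp add: sum_distrib_right mult.assoc)
    ultimately show "((x \<bullet> y) * zonal l x y) * p y
        = (\<Sum>b\<in>Basis. (x \<bullet> b) * (zonal l x y * u b y + zonal l x y * q b y))"
      by (simp only:)
  qed
  also have "\<dots> = (\<Sum>b\<in>Basis. (x \<bullet> b) * ((\<integral>y. zonal l x y * u b y \<partial>sphere_measure)
      + (\<integral>y. zonal l x y * q b y \<partial>sphere_measure)))"
  proof -
    have i: "integrable sphere_measure (\<lambda>y. zonal l x y * u b y)"
      "integrable sphere_measure (\<lambda>y. zonal l x y * q b y)" if "b \<in> Basis" for b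
      using that by (auto intro!: integrable_sphere continuous_intros continuous_on_zonal
          harm_continuous_on[OF u] harm_continuous_on[OF q(1)])
    then have "(\<integral>y. (x \<bullet> b) * (zonal l x y * u b y + zonal l x y * q b y) \<partial>sphere_measure)
        = (x \<bullet> b) * ((\<integral>y. zonal l x y * u b y \<partial>sphere_measure)
      + (\<integral>y. zonal l x y * q b y \<partial>sphere_measure))" if "b \<in> Basis" for b
      using that by simp
    with i show ?thesis
      by (subst Bochner_Integration.integral_sum) auto
  qed
  also have "\<dots> = (\<Sum>b\<in>Basis. (x \<bullet> b) * ((if l = Suc j then u b x else 0) + (if Suc l = j then q b x else 0)))"
  proof (rule sum.cong[OF refl])
    fix b :: 'a assume b: "b \<in> Basis"
    have "(\<integral>y. zonal l x y * q b y \<partial>sphere_measure) = (if Suc l = j then q b x else 0)"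
      using zonal_reproducing[OF q(1) x, of l b] q(2)[of b] by (cases j) auto
    then show "(x \<bullet> b) * ((\<integral>y. zonal l x y * u b y \<partial>sphere_measure) + (\<integral>y. zonal l x y * q b y \<partial>sphere_measure))
        = (x \<bullet> b) * ((if l = Suc j then u b x else 0) + (if Suc l = j then q b x else 0))"
      using zonal_reproducing[OF u[OF b] x, of l] by simp
  qed
  also have "\<dots> = (if l = Suc j then upper j * p x else if Suc l = j then lower j * p x else 0)"
    using sq su by auto
  finally show ?thesis .
qed

text \<open>Both sides have the same integrals against every \<open>Y j k\<close>. Testing
  transposes the action on harmonics, hence the indices \<open>Suc l\<close> and
  \<open>l - 1\<close> of the coefficients.\<close>

theorem zonal_recurrence:
  assumes x: "x \<in> S" and y: "y \<in> S"
  shows "(x \<bullet> y) * zonal l x y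
       = lower (Suc l) * zonal (Suc l) x y + (if l = 0 then 0 else upper (l - 1) * zonal (l - 1) x y)"
proof -
  define g where "g y = (x \<bullet> y) * zonal l x y - (lower (Suc l) * zonal (Suc l) x y
    + (if l = 0 then 0 else upper (l - 1)) * zonal (l - 1) x y)" for y
  have "g y = 0"
  proof (rule coef_zero_imp[OF _ _ y])
    show "continuous_on S g"
      unfolding g_def[abs_def] by (intro continuous_intros continuous_on_zonal)
    fix j k assume k: "k \<in> {1..Z j}"
    let ?p = "solid j k"
    have p: "?p \<in> harm j" by (rule solid_harm)
    have "coef g j k = (\<integral>y. ((x \<bullet> y) * zonal l x y) * ?p y - (lower (Suc l) * (zonal (Suc l) x y * ?p y)
      + (if l = 0 then 0 else upper (l - 1)) * (zonal (l - 1) x y * ?p y)) \<partial>sphere_measure)"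
      unfolding distribution_of_def
      by (rule sphere_integral_cong) (simp add: g_def solid_eq[OF k] algebra_simps)
    also have "\<dots> = (\<integral>y. ((x \<bullet> y) * zonal l x y) * ?p y \<partial>sphere_measure)
        - (lower (Suc l) * (\<integral>y. zonal (Suc l) x y * ?p y \<partial>sphere_measure)
          + (if l = 0 then 0 else upper (l - 1)) * (\<integral>y. zonal (l - 1) x y * ?p y \<partial>sphere_measure))"
    proof -
      have i: "integrable sphere_measure (\<lambda>y. ((x \<bullet> y) * zonal l x y) * ?p y)"
        "integrable sphere_measure (\<lambda>y. zonal i x y * ?p y)" for l i
        by (auto intro!: integrable_sphere continuous_intros continuous_on_zonal harm_continuous_on[OF p])
      show ?thesis
        by (subst Bochner_Integration.integral_diff, (rule i), (intro Bochner_Integration.integrable_add integrable_mult_right i),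
            subst Bochner_Integration.integral_add, (intro integrable_mult_right i)+) simp
    qed
    also have "\<dots> = 0"
      unfolding integral_inner_zonal[OF p x] zonal_reproducing[OF p x] by (cases l) auto
    finally show "coef g j k = 0" .
  qed
  then show ?thesis by (auto simp: g_def)
qed

lemma zonal_0:
  assumes x: "x \<in> S" and y: "y \<in> S"
  shows "zonal 0 x y = 1"
proof -
  have "solid 0 k z = solid 0 k y" for k z
    using hpoly_0_const[OF harm_hpoly[OF solid_harm[of 0 k]]] by metis
  then have "Y 0 k y = Y 0 k z" if "z \<in> S" "k \<in> {1..Z 0}" for k z
    using solid_eq[OF that(2) y] solid_eq[OF that(2,1)] \<open>solid 0 k z = solid 0 k y\<close> by (simp only:)
  then have "zonal 0 x y = zonal 0 x z" if "z \<in> S" for z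
    unfolding zonal_def using that by (intro sum.cong refl) simp
  then have "(\<integral>z. zonal 0 x z * 1 \<partial>sphere_measure) = (\<integral>z. zonal 0 x y \<partial>(sphere_measure :: 'a measure))"
    by (intro sphere_integral_cong) simp
  moreover have "(\<lambda>z. 1) \<in> harm 0" using hpoly_const[of 1] harm_0 by blast
  ultimately show ?thesis using zonal_reproducing[of "\<lambda>z. 1" 0 x 0] x sphere.prob_space[where 'a = 'a] by simp
qed

text \<open>For \<open>x = y\<close> the recurrence, together with
  \<open>upper l + lower l = 1\<close>, says that the difference of the two sides is the same for
  \<open>l\<close> and \<open>l - 1\<close>. It is 0 for \<open>l = 0\<close>.\<close>

lemma zonal_diag_balance:
  assumes x: "x \<in> S"
  shows "lower (Suc l) * zonal (Suc l) x x = upper l * zonal l x x"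
proof (induction l)
  case 0
  show ?case using zonal_recurrence[OF x x, of 0] x by (simp add: upper_def lower_def norm_eq_1)
next
  case (Suc l)
  then show ?case using zonal_recurrence[OF x x, of "Suc l"] x
    by (simp add: upper_def norm_eq_1 algebra_simps)
qed

lemma zonal_diag_nonneg: "0 \<le> zonal l x x"
  unfolding zonal_def by (intro sum_nonneg) simp

text \<open>The balance is a one-step recursion for the diagonal, the one satisfied by the
  dimensions of the spaces of harmonics. The circle is treated apart because the induction bounds
  \<open>d - 1\<close> times the diagonal, which says nothing for \<open>d = 1\<close>.\<close>

theorem zonal_diag_le:
  assumes x: "x \<in> S"
  shows "zonal l x x \<le> 2 * real (Suc l) ^ (d - 1)"
proof (cases "d = 1")
  case True
  have "zonal (Suc l) x x = 2" for l
  proof (induction l)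
    case 0
    show ?case
      using zonal_diag_balance[OF x, of 0, unfolded lower_def upper_def] zonal_0[OF x x] True by simp
  next
    case (Suc l)
    then have "(real l + 2) * (zonal (Suc (Suc l)) x x - 2) = 0"
      using zonal_diag_balance[OF x, of "Suc l", unfolded lower_def upper_def] True
      by (simp add: field_simps)
    then show ?case by simp
  qed
  with zonal_0[OF x x] True show ?thesis by (cases l) auto
next
  case False
  then have d2: "d \<ge> 2" using d1 by simp
  \<comment> \<open>The shape comes from the exact value: \<open>(2 * l + d - 1) / (d - 1)\<close>
    times the binomial coefficient \<open>(l + d - 2) choose (d - 2)\<close>, which is at most
    \<open>(l + 1) ^ (d - 2)\<close>.\<close>
  have "(real d - 1) * zonal l x x \<le> (2 * real l + real d - 1) * real (Suc l) ^ (d - 2)"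
  proof (induction l)
    case 0
    show ?case using zonal_0[OF x x] by simp
  next
    case (Suc l)
    have pos: "2 * real l + real d - 1 > 0" "2 * real (Suc l) + real d - 1 > 0" using d2 by auto
    have low: "lower (Suc l) = real (Suc l) / (2 * real (Suc l) + real d - 1)" by (simp add: lower_def)
    have up: "upper l = (real l + real d - 1) / (2 * real l + real d - 1)"
      using pos(1) by (simp add: upper_def lower_def field_simps)
    have "zonal (Suc l) x x = (2 * real (Suc l) + real d - 1) * (upper l * zonal l x x) / real (Suc l)"
      using zonal_diag_balance[OF x, of l] pos(2) unfolding low by (simp add: field_simps del: of_nat_Suc)
    then have eq: "(real d - 1) * zonal (Suc l) x x = (2 * real (Suc l) + real d - 1) *
        ((real l + real d - 1) / real (Suc l) * (((real d - 1) * zonal l x x) / (2 * real l + real d - 1)))"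
      unfolding up by (simp add: field_simps del: of_nat_Suc)
    have "((real d - 1) * zonal l x x) / (2 * real l + real d - 1) \<le> real (Suc l) ^ (d - 2)"
      using Suc.IH pos(1) by (simp add: field_simps)
    moreover have "(real l + real d - 1) / real (Suc l) * real (Suc l) ^ (d - 2) \<le> real (Suc (Suc l)) ^ (d - 2)"
    proof -
      have "(real l + real d - 1) / real (Suc l) = 1 + real (d - 2) * (1 / real (Suc l))"
        using d2 by (simp add: field_simps of_nat_diff)
      also have "\<dots> \<le> (1 + 1 / real (Suc l)) ^ (d - 2)"
        by (rule Bernoulli_inequality) (simp add: field_simps)
      also have "1 + 1 / real (Suc l) = real (Suc (Suc l)) / real (Suc l)" by (simp add: field_simps)
      finally have "(real l + real d - 1) / real (Suc l) \<le> (real (Suc (Suc l)) / real (Suc l)) ^ (d - 2)" .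
      then show ?thesis by (simp add: power_divide field_simps del: of_nat_Suc)
    qed
    moreover have "(real l + real d - 1) / real (Suc l) \<ge> 0" using d2 by simp
    ultimately have "(real l + real d - 1) / real (Suc l) * (((real d - 1) * zonal l x x) / (2 * real l + real d - 1))
        \<le> real (Suc (Suc l)) ^ (d - 2)"
      by (meson mult_left_mono order_trans)
    then show ?case unfolding eq using pos(2) by (intro mult_left_mono) auto
  qed
  also have "2 * real l + real d - 1 \<le> (real d - 1) * (2 * real (Suc l))"
  proof -
    have "2 * real l * (real d - 1) \<ge> 2 * real l * 1" using d2 by (intro mult_left_mono) auto
    then show ?thesis using d2 by (simp add: algebra_simps)
  qed
  then have "(2 * real l + real d - 1) * real (Suc l) ^ (d - 2) \<le> (real d - 1) * (2 * real (Suc l)) * real (Suc l) ^ (d - 2)"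
    by (intro mult_right_mono) auto
  also have "\<dots> = (real d - 1) * (2 * real (Suc l) ^ (d - 1))"
    using d2 by (cases d rule: nat.exhaust) (auto simp: power_eq_if mult.assoc)
  finally show ?thesis using d2 by simp
qed

text \<open>Cauchy-Schwarz over \<open>k\<close>, where the second factor is
  \<open>zonal l x x\<close>. Later proofs call the right-hand side \<open>M l\<close>.\<close>

lemma proj_bound:
  assumes "x \<in> S"
  shows "\<bar>proj l g x\<bar> \<le> sqrt (energy g l) * sqrt (2 * real (Suc l) ^ (d - 1))"
proof -
  have "(proj l g x)\<^sup>2 \<le> (\<Sum>k=1..Z l. (coef g l k)\<^sup>2) * (\<Sum>k=1..Z l. (Y l k x)\<^sup>2)"
    unfolding proj_def by (rule Cauchy_Schwarz_ineq_sum)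
  also have "\<dots> = energy g l * zonal l x x"
    by (simp add: energy_def zonal_def power2_eq_square)
  also have "\<dots> \<le> energy g l * (2 * real (Suc l) ^ (d - 1))"
    by (intro mult_left_mono zonal_diag_le assms) (auto simp: energy_def intro: sum_nonneg)
  finally have "sqrt ((proj l g x)\<^sup>2) \<le> sqrt (energy g l * (2 * real (Suc l) ^ (d - 1)))"
    by (rule real_sqrt_le_mono)
  then show ?thesis by (simp add: real_sqrt_mult)
qed

end

section \<open>Sobolev spaces\<close>

text \<open>A continuous function is a distribution of order 0: a bound of \<open>g\<close> serves
  as the constant for the seminorm with \<open>N = 0\<close>, where only the empty list of
  derivatives occurs.\<close>

lemma sphere_distribution_of_continuous:
  fixes g :: "'a::euclidean_space \<Rightarrow> real"
  assumes g: "continuous_on (sphere 0 1) g"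
  shows "sphere_distribution (distribution_of g)"
  unfolding sphere_distribution_def
proof (intro conjI ballI allI)
  have cont: "continuous_on (sphere 0 1) \<phi>" and rad: "x \<in> sphere 0 1 \<Longrightarrow> radial_ext \<phi> x = \<phi> x"
    if "\<phi> \<in> test_functions" for \<phi> :: "'a \<Rightarrow> real" and x
  proof -
    show rad: "radial_ext \<phi> x = \<phi> x" if "x \<in> sphere 0 1" for x
      using that by (simp add: radial_ext_def sgn_div_norm)
    have "iter_partial [] (radial_ext \<phi>) differentiable_on - {0}"
      using that unfolding test_functions_def by blast
    then have "continuous_on (- {0}) (radial_ext \<phi>)"
      by (simp add: differentiable_imp_continuous_on)
    then have "continuous_on (sphere 0 1) (radial_ext \<phi>)" by (rule continuous_on_subset) auto
    then show "continuous_on (sphere 0 1) \<phi>"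
      using rad by (subst continuous_on_cong[OF refl, of _ _ "radial_ext \<phi>"]) auto
  qed
  {
    fix \<phi> \<psi> :: "'a \<Rightarrow> real" and a b assume "\<phi> \<in> test_functions" "\<psi> \<in> test_functions"
    then have "integrable sphere_measure (\<lambda>x. a * (g x * \<phi> x))" "integrable sphere_measure (\<lambda>x. b * (g x * \<psi> x))"
      using g cont by (auto intro!: integrable_sphere continuous_intros)
    then have "(\<integral>x. a * (g x * \<phi> x) + b * (g x * \<psi> x) \<partial>sphere_measure)
        = a * distribution_of g \<phi> + b * distribution_of g \<psi>"
      unfolding distribution_of_def by (subst Bochner_Integration.integral_add) auto
    then show "distribution_of g (\<lambda>x. a * \<phi> x + b * \<psi> x) = a * distribution_of g \<phi> + b * distribution_of g \<psi>"
      unfolding distribution_of_def by (simp add: algebra_simps)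
  }
  obtain B where B: "B \<ge> 0" "\<And>x. x \<in> sphere 0 1 \<Longrightarrow> \<bar>g x\<bar> \<le> B" using sphere_bounded[OF g] by blast
  have "\<bar>distribution_of g \<phi>\<bar> \<le> B * test_seminorm 0 \<phi>" if \<phi>: "\<phi> \<in> test_functions" for \<phi>
  proof -
    have "{bs. bs \<in> lists (Basis :: 'a set) \<and> length bs \<le> 0} = {[]}" by auto
    then have eq: "test_seminorm 0 \<phi> = (SUP x\<in>sphere 0 1. \<bar>radial_ext \<phi> x\<bar>)"
      by (simp add: test_seminorm_def)
    obtain K where K: "\<And>x. x \<in> sphere 0 1 \<Longrightarrow> \<bar>\<phi> x\<bar> \<le> K" using sphere_bounded[OF cont[OF \<phi>]] by blast
    have le: "\<bar>\<phi> x\<bar> \<le> test_seminorm 0 \<phi>" if x: "x \<in> sphere 0 1" for x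
    proof -
      have "\<bar>radial_ext \<phi> x\<bar> \<le> (SUP x\<in>sphere 0 1. \<bar>radial_ext \<phi> x\<bar>)"
        using K rad[OF \<phi>] by (intro cSUP_upper[OF x] bdd_aboveI2[of _ _ K]) auto
      then show ?thesis using rad[OF \<phi> x] eq by simp
    qed
    have "\<bar>distribution_of g \<phi>\<bar> \<le> (\<integral>x. \<bar>g x * \<phi> x\<bar> \<partial>sphere_measure)"
      unfolding distribution_of_def by (rule integral_abs_bound)
    also have "\<dots> \<le> (\<integral>x. B * test_seminorm 0 \<phi> \<partial>(sphere_measure :: 'a measure))"
    proof (rule integral_mono)
      fix x :: 'a assume "x \<in> space sphere_measure"
      then show "\<bar>g x * \<phi> x\<bar> \<le> B * test_seminorm 0 \<phi>"
        unfolding abs_mult using B le by (intro mult_mono) auto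
    qed (use g cont[OF \<phi>] in \<open>auto intro!: integrable_sphere continuous_intros\<close>)
    finally show ?thesis using sphere.prob_space[where 'a = 'a] by simp
  qed
  then show "\<exists>N C. \<forall>\<phi>\<in>test_functions. \<bar>distribution_of g \<phi>\<bar> \<le> C * test_seminorm N \<phi>" by blast
qed

lemma filter_eq_0:
  fixes h :: "real \<Rightarrow> real"
  assumes "\<forall>t\<ge>2. h t = 0" and "n \<ge> 1" and "l > 2 * n"
  shows "h (real l / real n) = 0"
proof -
  have "real (2 * n) \<le> real l" using assms(3) by simp
  then have "2 \<le> real l / real n" using assms(2) by (simp add: field_simps)
  with assms(1) show ?thesis by blast
qed

lemma sobolev_norm_nonneg:
  "u \<in> sobolev_space d Z Y s \<Longrightarrow> 0 \<le> sobolev_norm d Z Y s u"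
  unfolding sobolev_norm_def
  by (intro real_sqrt_ge_zero suminf_nonneg)
     (auto simp: sobolev_space_def sobolev_term_def intro!: mult_nonneg_nonneg sum_nonneg)

context sphere_basis
begin

section \<open>Weights, and multiplication by a harmonic in Sobolev norms\<close>

definition weight :: "nat \<Rightarrow> real" where "weight l = 1 + lb_eigenvalue d l"

lemma weight_lower: "(real (Suc l))\<^sup>2 \<le> 2 * weight l" "(real l)\<^sup>2 \<le> weight l" "1 \<le> weight l"
  and weight_upper: "weight l \<le> real (d + 1) * (real (Suc l))\<^sup>2"
proof -
  have "real l * real l \<le> real l * (real l + real d - 1)" using d1 by (intro mult_left_mono) auto
  then have 1: "1 + (real l)\<^sup>2 \<le> weight l" by (simp add: weight_def lb_eigenvalue_def power2_eq_square)
  have "0 \<le> (real l - 1)\<^sup>2" by simp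
  with 1 show "(real (Suc l))\<^sup>2 \<le> 2 * weight l" by (simp add: power2_eq_square algebra_simps)
  from 1 show "(real l)\<^sup>2 \<le> weight l" by simp
  have "0 \<le> (real l)\<^sup>2" by simp
  with 1 show "1 \<le> weight l" by linarith
  have "real l * (real l + real d - 1) \<le> real (Suc l) * (real d * real (Suc l))"
  proof (rule mult_mono)
    have "real l * 1 \<le> real l * real d" using d1 by (intro mult_left_mono) auto
    then show "real l + real d - 1 \<le> real d * real (Suc l)" by (simp add: algebra_simps)
  qed (use d1 in auto)
  moreover have "1 \<le> (real (Suc l))\<^sup>2" by simp
  ultimately show "weight l \<le> real (d + 1) * (real (Suc l))\<^sup>2"
    unfolding weight_def lb_eigenvalue_def
    by (simp add: power2_eq_square algebra_simps)
qed

lemma weight_pos: "0 < weight l"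
  using weight_lower(3)[of l] by linarith

lemma sobolev_term_eq: "sobolev_term d Z Y s (distribution_of g) l = weight l powr s * energy g l"
  by (simp add: sobolev_term_def weight_def energy_def)

lemma energy_nonneg: "0 \<le> energy g l"
  unfolding energy_def by (intro sum_nonneg) simp

text \<open>The square of the \<open>H^r\<close> norm cut at degree \<open>n\<close>. For
  polynomials of degree at most \<open>n\<close> nothing is cut.\<close>

definition sob :: "real \<Rightarrow> nat \<Rightarrow> ('a \<Rightarrow> real) \<Rightarrow> real" where
  "sob r n g = (\<Sum>l\<le>n. weight l powr r * energy g l)"

lemma sob_nonneg: "0 \<le> sob r n g"
  unfolding sob_def by (intro sum_nonneg mult_nonneg_nonneg energy_nonneg) auto

text \<open>A product of degree \<open>l + k\<close> has no components beyond that degree; the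
  symmetry of the triple integral in \<open>Y k i\<close> and \<open>Y j m\<close> gives the other
  range.\<close>

lemma coef_triple_zero:
  assumes f: "f \<in> harm l" and k: "i \<in> {1..Z k}" and j: "m \<in> {1..Z j}" and far: "k > l + j \<or> j > l + k"
  shows "coef (\<lambda>x. f x * Y k i x) j m = 0"
proof -
  have z: "coef (\<lambda>x. f x * Y a i x) b m = 0"
    if "b > l + a" "i \<in> {1..Z a}" "m \<in> {1..Z b}" for a b i m
  proof -
    have "coef (\<lambda>x. f x * Y a i x) b m = coef (\<lambda>x. f x * solid a i x) b m"
      using that by (intro coef_cong) (simp add: solid_eq)
    also have "\<dots> = 0"
      using that f by (intro poly_upto_expansion(2)[of "l + a"] poly_upto_hpoly[OF hpoly_mult]) (auto intro: harm_hpoly[OF solid_harm])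
    finally show ?thesis .
  qed
  have "coef (\<lambda>x. f x * Y k i x) j m = coef (\<lambda>x. f x * Y j m x) k i"
    unfolding distribution_of_def by (simp add: mult_ac)
  then show ?thesis using far z[of k j i m] z[of j k m i] k j by auto
qed

text \<open>Only components of \<open>P\<close> with degrees in \<open>B\<close> reach the degrees
  in \<open>A\<close>. For their sum, Bessel's inequality and the sup bound of \<open>f\<close> give
  an estimate without weights.\<close>

lemma energy_mult_block:
  assumes f: "f \<in> harm l" and M: "\<And>x. x \<in> S \<Longrightarrow> \<bar>f x\<bar> \<le> M" and P: "poly_upto n P"
    and A: "finite A" and far: "\<And>j k. j \<in> A \<Longrightarrow> k \<le> n \<Longrightarrow> k \<notin> B \<Longrightarrow> k > l + j \<or> j > l + k"
    and B: "B \<subseteq> {..n}"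
  shows "(\<Sum>j\<in>A. energy (\<lambda>x. f x * P x) j) \<le> M\<^sup>2 * (\<Sum>k\<in>B. energy P k)"
proof -
  define PB where "PB x = (\<Sum>k\<in>B. proj k P x)" for x
  have fB: "finite B" using B finite_subset by blast
  have cf: "continuous_on S f" using f by (rule harm_continuous_on)
  have cPB: "continuous_on S PB" unfolding PB_def[abs_def] by (intro continuous_intros continuous_on_proj)
  have "energy (\<lambda>x. f x * P x) j = energy (\<lambda>x. f x * PB x) j" if j: "j \<in> A" for j
    unfolding energy_def
  proof (intro sum.cong refl)
    fix m assume m: "m \<in> {1..Z j}"
    have z: "coef (\<lambda>x. f x * proj k P x) j m = 0" if "k \<le> n" "k \<notin> B" for k
    proof -
      have "coef (\<lambda>x. f x * proj k P x) j m = coef (\<lambda>x. \<Sum>i=1..Z k. coef P k i * (f x * Y k i x)) j m"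
        by (intro coef_cong) (simp add: proj_def sum_distrib_left mult_ac)
      also have "\<dots> = (\<Sum>i=1..Z k. coef (\<lambda>x. coef P k i * (f x * Y k i x)) j m)"
        by (rule coef_sum[OF _ m]) (intro continuous_intros cf continuous_on_Y)
      also have "\<dots> = 0"
        using coef_triple_zero[OF f _ m] far[OF j that] by (intro sum.neutral) (simp add: coef_cmult)
      finally show ?thesis .
    qed
    have "coef (\<lambda>x. f x * P x) j m = coef (\<lambda>x. \<Sum>k\<le>n. f x * proj k P x) j m"
      by (rule coef_cong) (simp add: poly_upto_expansion(1)[OF P] sum_distrib_left)
    also have "\<dots> = (\<Sum>k\<le>n. coef (\<lambda>x. f x * proj k P x) j m)"
      by (rule coef_sum[OF _ m]) (intro continuous_intros cf continuous_on_proj)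
    also have "\<dots> = (\<Sum>k\<in>B. coef (\<lambda>x. f x * proj k P x) j m)"
      using B z by (intro sum.mono_neutral_right) auto
    also have "\<dots> = coef (\<lambda>x. \<Sum>k\<in>B. f x * proj k P x) j m"
      by (rule coef_sum[OF _ m, symmetric]) (intro continuous_intros cf continuous_on_proj)
    finally have "coef (\<lambda>x. f x * P x) j m = coef (\<lambda>x. f x * PB x) j m"
      by (simp add: PB_def sum_distrib_left)
    then show "(coef (\<lambda>x. f x * P x) j m)\<^sup>2 = (coef (\<lambda>x. f x * PB x) j m)\<^sup>2" by simp
  qed
  then have "(\<Sum>j\<in>A. energy (\<lambda>x. f x * P x) j) = (\<Sum>j\<in>A. energy (\<lambda>x. f x * PB x) j)"
    by simp
  also have "\<dots> \<le> (\<integral>x. (f x * PB x)\<^sup>2 \<partial>sphere_measure)"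
    by (intro bessel continuous_intros cf cPB A)
  also have "\<dots> \<le> (\<integral>x. M\<^sup>2 * (PB x)\<^sup>2 \<partial>sphere_measure)"
  proof (rule integral_mono)
    fix x :: 'a assume "x \<in> space sphere_measure"
    then have "\<bar>f x\<bar>\<^sup>2 \<le> M\<^sup>2" using M[of x] by (intro power_mono) auto
    then show "(f x * PB x)\<^sup>2 \<le> M\<^sup>2 * (PB x)\<^sup>2"
      by (simp add: power_mult_distrib mult_right_mono)
  qed (auto intro!: integrable_sphere continuous_intros cf cPB)
  also have "\<dots> = M\<^sup>2 * (\<integral>x. (PB x)\<^sup>2 \<partial>sphere_measure)" by simp
  also have "(\<integral>x. (PB x)\<^sup>2 \<partial>sphere_measure) = (\<Sum>k\<in>B. energy P k)"
  proof -
    \<comment> \<open>\<open>parseval_square\<close> speaks of polynomials; \<open>Q\<close> is one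
      that agrees with \<open>PB\<close> on the sphere.\<close>
    obtain Q where Q: "poly_upto n Q"
      "\<And>x. x \<in> S \<Longrightarrow> Q x = (\<Sum>k\<le>n. \<Sum>i=1..Z k. (if k \<in> B then coef P k i else 0) * Y k i x)"
      using combination_poly[of n "\<lambda>k i. if k \<in> B then coef P k i else 0"] by blast
    have cQ: "coef Q k i = (if k \<in> B then coef P k i else 0)" if "i \<in> {1..Z k}" for k i
    proof -
      have "coef Q k i = (if k \<in> {..n} then (if k \<in> B then coef P k i else 0) else 0)"
        using coef_combination[OF finite_atMost that, where c = "\<lambda>k i. if k \<in> B then coef P k i else 0"]
          coef_cong[of Q "\<lambda>x. \<Sum>k\<le>n. \<Sum>i=1..Z k. (if k \<in> B then coef P k i else 0) * Y k i x" k i] Q(2)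
        by simp
      then show ?thesis using B by auto
    qed
    have "PB x = Q x" if "x \<in> S" for x
    proof -
      have "Q x = (\<Sum>k\<le>n. if k \<in> B then proj k P x else 0)"
        unfolding Q(2)[OF that] proj_def by (intro sum.cong) auto
      also have "\<dots> = PB x" unfolding PB_def using B by (intro sum.mono_neutral_cong_right) auto
      finally show ?thesis by simp
    qed
    then have "(\<integral>x. (PB x)\<^sup>2 \<partial>sphere_measure) = (\<integral>x. (Q x)\<^sup>2 \<partial>sphere_measure)"
      by (intro sphere_integral_cong) simp
    also have "\<dots> = (\<Sum>k\<le>n. energy Q k)" by (rule parseval_square[OF Q(1)])
    also have "\<dots> = (\<Sum>k\<le>n. if k \<in> B then energy P k else 0)"
      by (intro sum.cong refl) (auto simp: energy_def cQ)
    also have "\<dots> = (\<Sum>k\<in>B. energy P k)" using B by (intro sum.mono_neutral_cong_right) auto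
    finally show ?thesis .
  qed
  finally show ?thesis .
qed

text \<open>Multiplication by a harmonic of degree \<open>l\<close> shifts degrees by at most \<open>l\<close>, so it acts almost
  diagonally on blocks of \<open>l + 1\<close> consecutive degrees, on which the weight is nearly constant.\<close>
theorem sob_mult:
  assumes f: "f \<in> harm l" and M: "\<And>x. x \<in> S \<Longrightarrow> \<bar>f x\<bar> \<le> M" and P: "poly_upto n P" and r: "r \<ge> 0"
  shows "sob r (n + l) (\<lambda>x. f x * P x)
       \<le> 3 * (18 * real (d + 1)) powr r * real (Suc l) powr (2 * r) * M\<^sup>2 * sob r n P"
proof -
  define L where "L = Suc l"
  \<comment> \<open>\<open>A b\<close> is the block number \<open>b\<close> of \<open>L\<close>
    degrees of the product, \<open>B b\<close> is that block with its two neighbours among the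
    degrees of \<open>P\<close>, and \<open>R b\<close> bounds the weight on
    \<open>A b\<close>.\<close>
  define A where "A b = {j. j \<le> n + l \<and> j div L = b}" for b
  define B where "B b = {k. k \<le> n \<and> k div L \<le> b + 1 \<and> b \<le> k div L + 1}" for b
  define R where "R b = (real (d + 1) * (real (Suc b) * real L)\<^sup>2) powr r" for b
  \<comment> \<open>\<open>18 = 9 * 2\<close>: the 9 is the square of the 3 in
    \<open>(b + 1) * L \<le> 3 * L * (k + 1)\<close>, the 2 is that of
    \<open>weight_lower\<close>.\<close>
  define K where "K = (18 * real (d + 1)) powr r * real L powr (2 * r)"
  let ?e = "energy (\<lambda>x. f x * P x)"
  have L: "L > 0" by (simp add: L_def)
  have fin: "finite (A b)" "finite (B b)" for b by (simp_all add: A_def B_def)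
  have divL: "(j div L) * L \<le> j" "j < (j div L + 1) * L" for j
    using dividend_less_div_times[OF L, of j] by (simp_all add: div_times_less_eq_dividend)
  have WA: "weight j powr r \<le> R b" if "j \<in> A b" for j b
    unfolding R_def
  proof (rule powr_mono2[OF r])
    have "Suc j \<le> Suc b * L" using divL(2)[of j] that by (simp add: A_def)
    then have "real (Suc j) \<le> real (Suc b) * real L" by (metis of_nat_le_iff of_nat_mult)
    then have "(real (Suc j))\<^sup>2 \<le> (real (Suc b) * real L)\<^sup>2" by (intro power_mono) auto
    then show "weight j \<le> real (d + 1) * (real (Suc b) * real L)\<^sup>2"
      using weight_upper[of j] by (meson mult_left_mono of_nat_0_le_iff order_trans)
  qed (use weight_pos[of j] in simp)
  have WB: "R b \<le> K * weight k powr r" if "k \<in> B b" for k b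
  proof -
    have "Suc b * L \<le> (k div L + 2) * L" using that by (intro mult_le_mono1) (simp add: B_def)
    also have "\<dots> = (k div L) * L + 2 * L" by (simp add: algebra_simps)
    also have "\<dots> \<le> k + 2 * L" using divL(1)[of k] by simp
    also have "\<dots> \<le> 3 * L * Suc k"
    proof -
      have "k * 1 \<le> k * (3 * L)" using L by (intro mult_le_mono2) simp
      moreover have "3 * L * Suc k = k * (3 * L) + 3 * L" by simp
      ultimately show ?thesis by linarith
    qed
    finally have "real (Suc b * L) \<le> real (3 * L * Suc k)" by (rule of_nat_mono)
    then have "(real (Suc b) * real L)\<^sup>2 \<le> (3 * real L * real (Suc k))\<^sup>2"
      by (intro power_mono) (simp_all add: algebra_simps)
    also have "\<dots> = 9 * (real L)\<^sup>2 * (real (Suc k))\<^sup>2" by (simp add: power_mult_distrib)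
    also have "\<dots> \<le> 9 * (real L)\<^sup>2 * (2 * weight k)" by (intro mult_left_mono weight_lower) auto
    finally have "real (d + 1) * (real (Suc b) * real L)\<^sup>2 \<le> real (d + 1) * (9 * (real L)\<^sup>2 * (2 * weight k))"
      by (intro mult_left_mono) auto
    then have "R b \<le> (real (d + 1) * (9 * (real L)\<^sup>2 * (2 * weight k))) powr r"
      unfolding R_def by (intro powr_mono2[OF r]) auto
    also have "real (d + 1) * (9 * (real L)\<^sup>2 * (2 * weight k)) = (18 * real (d + 1)) * ((real L)\<^sup>2 * weight k)"
      by simp
    also have "\<dots> powr r = (18 * real (d + 1)) powr r * (((real L)\<^sup>2) powr r * weight k powr r)"
      using weight_pos[of k] by (simp add: powr_mult)
    also have "((real L)\<^sup>2) powr r = real L powr (2 * r)"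
      using L by (simp flip: powr_powr add: powr_numeral)
    finally show ?thesis by (simp add: K_def mult.assoc)
  qed
  have block: "(\<Sum>j\<in>A b. weight j powr r * ?e j) \<le> K * M\<^sup>2 * (\<Sum>k\<in>B b. weight k powr r * energy P k)" for b
  proof -
    have "(\<Sum>j\<in>A b. weight j powr r * ?e j) \<le> (\<Sum>j\<in>A b. R b * ?e j)"
      by (intro sum_mono mult_right_mono WA energy_nonneg)
    also have "\<dots> = R b * (\<Sum>j\<in>A b. ?e j)" by (simp add: sum_distrib_left)
    also have "\<dots> \<le> R b * (M\<^sup>2 * (\<Sum>k\<in>B b. energy P k))"
    proof (intro mult_left_mono energy_mult_block[OF f M P fin(1)])
      fix j k assume "j \<in> A b" "k \<le> n" "k \<notin> B b"
      \<comment> \<open>Degrees in blocks that are not neighbours differ by more than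
        \<open>l\<close>.\<close>
      then have "j div L + 2 \<le> k div L \<or> k div L + 2 \<le> j div L" by (auto simp: A_def B_def)
      moreover have "x > l + y" if "y div L + 2 \<le> x div L" for x y
      proof -
        have "(y div L + 2) * L \<le> x div L * L" using that by (rule mult_le_mono1)
        then have "(y div L + 2) * L \<le> x" using divL(1)[of x] by (rule le_trans)
        moreover have "(y div L + 2) * L = (y div L + 1) * L + L" by simp
        moreover have "L = l + 1" by (simp add: L_def)
        moreover note divL(2)[of y]
        ultimately show ?thesis by linarith
      qed
      ultimately show "k > l + j \<or> j > l + k" by blast
    qed (auto simp: R_def B_def)
    also have "\<dots> = M\<^sup>2 * (\<Sum>k\<in>B b. R b * energy P k)" by (simp add: sum_distrib_left mult_ac)
    also have "\<dots> \<le> M\<^sup>2 * (\<Sum>k\<in>B b. K * weight k powr r * energy P k)"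
      by (intro mult_left_mono sum_mono mult_right_mono WB energy_nonneg) auto
    also have "\<dots> = K * M\<^sup>2 * (\<Sum>k\<in>B b. weight k powr r * energy P k)" by (simp add: sum_distrib_left mult_ac)
    finally show ?thesis .
  qed
  have "sob r (n + l) (\<lambda>x. f x * P x) = (\<Sum>b\<le>n + l. \<Sum>j\<in>A b. weight j powr r * ?e j)"
  proof -
    have "(\<Sum>b\<in>{..n + l}. sum (\<lambda>j. weight j powr r * ?e j) {j \<in> {..n + l}. j div L = b})
        = (\<Sum>j\<in>{..n + l}. weight j powr r * ?e j)"
      by (rule sum.group) (auto intro: le_trans[OF div_le_dividend])
    then show ?thesis by (simp add: sob_def A_def)
  qed
  also have "\<dots> \<le> (\<Sum>b\<le>n + l. K * M\<^sup>2 * (\<Sum>k\<in>B b. weight k powr r * energy P k))"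
    by (intro sum_mono block)
  also have "\<dots> = K * M\<^sup>2 * (\<Sum>b\<le>n + l. \<Sum>k\<in>B b. weight k powr r * energy P k)"
    by (simp add: sum_distrib_left)
  \<comment> \<open>Every degree \<open>k\<close> lies in at most three of the sets
    \<open>B b\<close>.\<close>
  also have "(\<Sum>b\<le>n + l. \<Sum>k\<in>B b. weight k powr r * energy P k) \<le> 3 * sob r n P"
  proof -
    have "(\<Sum>b\<le>n + l. \<Sum>k\<in>B b. weight k powr r * energy P k)
        = (\<Sum>b\<le>n + l. \<Sum>k\<le>n. if k div L \<le> b + 1 \<and> b \<le> k div L + 1 then weight k powr r * energy P k else 0)"
      by (intro sum.cong refl sum.mono_neutral_cong_left) (auto simp: B_def)
    also have "\<dots> = (\<Sum>k\<le>n. \<Sum>b\<le>n + l. if k div L \<le> b + 1 \<and> b \<le> k div L + 1 then weight k powr r * energy P k else 0)"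
      by (rule sum.swap)
    also have "\<dots> \<le> (\<Sum>k\<le>n. 3 * (weight k powr r * energy P k))"
    proof (rule sum_mono)
      fix k
      let ?T = "{b. b \<le> n + l \<and> k div L \<le> b + 1 \<and> b \<le> k div L + 1}"
      have "(\<Sum>b\<le>n + l. if k div L \<le> b + 1 \<and> b \<le> k div L + 1 then weight k powr r * energy P k else 0)
          = (\<Sum>b\<in>?T. weight k powr r * energy P k)"
        by (intro sum.mono_neutral_cong_right) auto
      also have "\<dots> = real (card ?T) * (weight k powr r * energy P k)" by simp
      also have "card ?T \<le> card {k div L - 1..k div L + 1}"
        by (rule card_mono) auto
      then have "card ?T \<le> 3" by simp
      then have "real (card ?T) * (weight k powr r * energy P k) \<le> 3 * (weight k powr r * energy P k)"
        by (intro mult_right_mono mult_nonneg_nonneg energy_nonneg) auto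
      finally show "(\<Sum>b\<le>n + l. if k div L \<le> b + 1 \<and> b \<le> k div L + 1 then weight k powr r * energy P k else 0)
          \<le> 3 * (weight k powr r * energy P k)" .
    qed
    finally show ?thesis by (simp add: sob_def sum_distrib_left)
  qed
  then have "K * M\<^sup>2 * (\<Sum>b\<le>n + l. \<Sum>k\<in>B b. weight k powr r * energy P k) \<le> K * M\<^sup>2 * (3 * sob r n P)"
    by (intro mult_left_mono) (auto simp: K_def)
  finally show ?thesis by (simp add: K_def L_def mult_ac)
qed

subsection \<open>Convergence of the harmonic expansion\<close>

lemma energy_le_sobolev:
  assumes sm: "summable (\<lambda>l. weight l powr s * energy f l)"
  shows "(\<Sum>l<T. weight l powr s * energy f l) \<le> (\<Sum>l. weight l powr s * energy f l)"
  by (rule sum_le_suminf[OF sm]) (auto intro!: mult_nonneg_nonneg energy_nonneg)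

text \<open>Cauchy-Schwarz against the Sobolev norm. The squares of the complementary factor are of
  order \<open>l + 1\<close> to the power \<open>2 * r + d - 1 - 2 * s\<close>. They are summable
  exactly when \<open>s > d / 2 + r\<close>, the source of that hypothesis.\<close>

lemma proj_bounds_sum:
  assumes sm: "summable (\<lambda>l. weight l powr s * energy f l)" and s: "s \<ge> 0" and gap: "s > real d / 2 + r"
  defines "M \<equiv> \<lambda>l. sqrt (energy f l) * sqrt (2 * real (Suc l) ^ (d - 1))"
  defines "\<kappa> \<equiv> sqrt (2 * 2 powr s * (\<Sum>l. real (Suc l) powr (2 * r + real d - 1 - 2 * s)))"
  shows "(\<Sum>l<T. real (Suc l) powr r * M l) \<le> \<kappa> * sqrt (\<Sum>l. weight l powr s * energy f l)"
proof -
  define a where "a l = sqrt (2 * 2 powr s) * real (Suc l) powr (r + (real d - 1) / 2 - s)" for l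
  define b where "b l = sqrt (weight l powr s * energy f l)" for l
  define E where "E = 2 * r + real d - 1 - 2 * s"
  have E: "E < - 1" using gap by (simp add: E_def)
  have sE: "summable (\<lambda>l. real (Suc l) powr E)"
    using E by (subst summable_Suc_iff) (simp add: summable_real_powr_iff)
  have le: "real (Suc l) powr r * M l \<le> a l * b l" for l
  proof -
    have p: "real (Suc l) ^ (d - 1) = real (Suc l) powr (real d - 1)"
      using d1 by (simp add: powr_realpow[symmetric] of_nat_diff)
    have "real (Suc l) powr (2 * s) = ((real (Suc l))\<^sup>2) powr s"
      by (simp flip: powr_powr add: powr_numeral)
    also have "\<dots> \<le> (2 * weight l) powr s" by (intro powr_mono2 s weight_lower) auto
    also have "\<dots> = 2 powr s * weight l powr s" using weight_pos[of l] by (simp add: powr_mult)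
    finally have w: "real (Suc l) powr (2 * s) \<le> 2 powr s * weight l powr s" .
    have "real (Suc l) powr s = sqrt (real (Suc l) powr (2 * s))"
      by (simp add: powr_half_sqrt[symmetric] powr_powr)
    also have "\<dots> \<le> sqrt (2 powr s * weight l powr s)" using w by (rule real_sqrt_le_mono)
    finally have w': "real (Suc l) powr s \<le> sqrt (2 powr s) * sqrt (weight l powr s)"
      by (simp add: real_sqrt_mult)
    have "real (Suc l) powr r * M l
        = sqrt 2 * sqrt (energy f l) * (real (Suc l) powr (r + (real d - 1) / 2 - s) * real (Suc l) powr s)"
      unfolding M_def p real_sqrt_mult
      by (simp add: powr_half_sqrt[symmetric] powr_powr powr_add[symmetric])
    also have "\<dots> \<le> sqrt 2 * sqrt (energy f l) * (real (Suc l) powr (r + (real d - 1) / 2 - s)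
        * (sqrt (2 powr s) * sqrt (weight l powr s)))"
      by (intro mult_left_mono w') (auto simp: energy_nonneg)
    also have "\<dots> = a l * b l" by (simp add: a_def b_def real_sqrt_mult)
    finally show ?thesis .
  qed
  have "(\<Sum>l<T. real (Suc l) powr r * M l) \<le> (\<Sum>l<T. a l * b l)" by (intro sum_mono le)
  also have "\<dots> \<le> sqrt (\<Sum>l<T. (a l)\<^sup>2) * sqrt (\<Sum>l<T. (b l)\<^sup>2)"
  proof -
    have "(\<Sum>l<T. a l * b l)\<^sup>2 \<le> (\<Sum>l<T. (a l)\<^sup>2) * (\<Sum>l<T. (b l)\<^sup>2)" by (rule Cauchy_Schwarz_ineq_sum)
    then show ?thesis by (simp add: real_le_rsqrt flip: real_sqrt_mult)
  qed
  also have "\<dots> \<le> \<kappa> * sqrt (\<Sum>l. weight l powr s * energy f l)"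
  proof (intro mult_mono)
    have "(\<Sum>l<T. (a l)\<^sup>2) = (\<Sum>l<T. 2 * 2 powr s * real (Suc l) powr E)"
    proof (intro sum.cong refl)
      fix l
      have "(r + (real d - 1) / 2 - s) + (r + (real d - 1) / 2 - s) = E" by (simp add: E_def)
      then have "(real (Suc l) powr (r + (real d - 1) / 2 - s))\<^sup>2 = real (Suc l) powr E"
        unfolding power2_eq_square powr_add[symmetric] by (rule arg_cong)
      then show "(a l)\<^sup>2 = 2 * 2 powr s * real (Suc l) powr E" by (simp add: a_def power_mult_distrib)
    qed
    also have "\<dots> = 2 * 2 powr s * (\<Sum>l<T. real (Suc l) powr E)" by (simp add: sum_distrib_left)
    also have "\<dots> \<le> 2 * 2 powr s * (\<Sum>l. real (Suc l) powr E)"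
      by (intro mult_left_mono sum_le_suminf[OF sE]) auto
    finally show "sqrt (\<Sum>l<T. (a l)\<^sup>2) \<le> \<kappa>" by (simp add: \<kappa>_def E_def)
    have "(\<Sum>l<T. (b l)\<^sup>2) = (\<Sum>l<T. weight l powr s * energy f l)"
      by (intro sum.cong refl) (simp add: b_def energy_nonneg)
    then show "sqrt (\<Sum>l<T. (b l)\<^sup>2) \<le> sqrt (\<Sum>l. weight l powr s * energy f l)"
      using energy_le_sobolev[OF sm, of T] by simp
    show "0 \<le> \<kappa>" unfolding \<kappa>_def by (intro real_sqrt_ge_zero mult_nonneg_nonneg suminf_nonneg sE[unfolded E_def]) auto
  qed (auto intro!: sum_nonneg)
  finally show ?thesis .
qed

text \<open>The M-test with \<open>proj_bounds_sum\<close> for \<open>r = 0\<close> gives a uniform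
  limit \<open>g\<close>. It has the coefficients of \<open>f\<close>, hence equals \<open>f\<close>
  by \<open>coef_zero_imp\<close>.\<close>

theorem harmonic_expansion:
  assumes f: "continuous_on S f" and sm: "summable (\<lambda>l. weight l powr s * energy f l)"
    and s: "s > real d / 2"
  shows "uniform_limit S (\<lambda>T x. \<Sum>l<T. proj l f x) f sequentially"
proof -
  define M where "M l = sqrt (energy f l) * sqrt (2 * real (Suc l) ^ (d - 1))" for l
  have M0: "0 \<le> M l" for l by (simp add: M_def energy_nonneg)
  have sM: "summable M"
  proof (rule summableI_nonneg_bounded[OF M0])
    show "(\<Sum>l<T. M l) \<le> sqrt (2 * 2 powr s * (\<Sum>l. real (Suc l) powr (2 * 0 + real d - 1 - 2 * s)))
        * sqrt (\<Sum>l. weight l powr s * energy f l)" for T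
      using proj_bounds_sum[OF sm, of 0 T] s by (simp add: M_def)
  qed
  define g where "g x = (\<Sum>l. proj l f x)" for x
  have u: "uniform_limit S (\<lambda>T x. \<Sum>l<T. proj l f x) g sequentially"
    unfolding g_def[abs_def]
    by (rule Weierstrass_m_test[OF _ sM]) (use proj_bound in \<open>auto simp: M_def\<close>)
  have cg: "continuous_on S g"
    by (rule uniform_limit_theorem[OF _ u]) (auto intro!: always_eventually continuous_intros continuous_on_proj)
  have "coef (\<lambda>x. g x - f x) j k = 0" if k: "k \<in> {1..Z j}" for j k
  proof (rule ccontr)
    assume ne: "coef (\<lambda>x. g x - f x) j k \<noteq> 0"
    obtain B where B: "B \<ge> 0" "\<And>x. x \<in> S \<Longrightarrow> \<bar>Y j k x\<bar> \<le> B" using sphere_bounded[OF continuous_on_Y[OF k]] by blast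
    \<comment> \<open>Small enough for \<open>e * B\<close> to stay below the supposedly nonzero
      coefficient.\<close>
    define e where "e = \<bar>coef (\<lambda>x. g x - f x) j k\<bar> / (B + 1)"
    have e: "e > 0" using ne B by (simp add: e_def)
    have ev: "\<forall>\<^sub>F T in sequentially. (\<forall>x\<in>S. dist (\<Sum>l<T. proj l f x) (g x) < e) \<and> j < T"
      by (intro eventually_conj uniform_limitD[OF u e] eventually_gt_at_top)
    obtain T where T': "\<forall>x\<in>S. dist (\<Sum>l<T. proj l f x) (g x) < e" "j < T"
      using eventually_happens'[OF sequentially_bot ev] by blast
    then have T: "\<bar>(\<Sum>l<T. proj l f x) - g x\<bar> < e" "j < T" if "x \<in> S" for x
      using that by (auto simp: dist_real_def)
    define FT where "FT x = (\<Sum>l<T. proj l f x)" for x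
    have cF: "continuous_on S FT" unfolding FT_def[abs_def] by (intro continuous_intros continuous_on_proj)
    have "coef FT j k = coef f j k"
      using coef_combination[of "{..<T}" k j "\<lambda>l k. coef f l k"] k T'(2)
      by (simp add: FT_def[abs_def] proj_def)
    then have "coef (\<lambda>x. g x - f x) j k = coef (\<lambda>x. g x - FT x) j k"
      using cg f cF k by (simp add: coef_diff)
    also have "\<bar>\<dots>\<bar> \<le> (\<integral>x. \<bar>(g x - FT x) * Y j k x\<bar> \<partial>sphere_measure)"
      unfolding distribution_of_def by (rule integral_abs_bound)
    also have "\<dots> \<le> (\<integral>x. e * B \<partial>(sphere_measure :: 'a measure))"
    proof (rule integral_mono)
      fix x :: 'a assume "x \<in> space sphere_measure"
      then show "\<bar>(g x - FT x) * Y j k x\<bar> \<le> e * B"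
        unfolding abs_mult using B(2)[of x] T(1)[of x] e by (intro mult_mono) (auto simp: FT_def)
    qed (use cg cF k in \<open>auto intro!: integrable_sphere continuous_intros continuous_on_Y\<close>)
    also have "\<dots> = e * B" using sphere.prob_space[where 'a = 'a] by simp
    also have "\<dots> < e * (B + 1)" using e by simp
    also have "\<dots> = \<bar>coef (\<lambda>x. g x - f x) j k\<bar>" using B(1) by (simp add: e_def)
    finally show False by simp
  qed
  then have "g x = f x" if "x \<in> S" for x
    using coef_zero_imp[of "\<lambda>x. g x - f x" x] cg f that by (auto intro!: continuous_intros)
  then show ?thesis by (intro uniform_limit_cong'[THEN iffD1, OF _ _ u]) auto
qed

lemma filter_kernel_eq:
  assumes "\<forall>t\<ge>2. h t = 0" and "n \<ge> 1"
  shows "filter_kernel Z Y h n x y = (\<Sum>l\<le>2 * n. h (real l / real n) * zonal l x y)"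
  unfolding filter_kernel_def zonal_def using filter_eq_0[OF assms] by (intro suminf_finite) auto

end

section \<open>The error of filtered hyperinterpolation in Sobolev norms\<close>

locale sphere_sampling = sphere_basis d Z Y
  for d Z and Y :: "nat \<Rightarrow> nat \<Rightarrow> 'a::euclidean_space \<Rightarrow> real" +
  fixes m :: nat and xs :: "nat \<Rightarrow> 'a" and ws :: "nat \<Rightarrow> real"
  assumes xs: "\<And>j. j \<in> {1..m} \<Longrightarrow> xs j \<in> sphere 0 1"
    and ws: "\<And>j. j \<in> {1..m} \<Longrightarrow> ws j > 0"
    and ws_sum: "(\<Sum>j=1..m. ws j) = 1"
begin

section \<open>The discrepancy as a functional on polynomials and products\<close>

abbreviation \<nu> :: "('a \<Rightarrow> real) \<Rightarrow> real" where "\<nu> \<equiv> sampling_discrepancy m xs ws"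

lemma nu_cong: "(\<And>x. x \<in> S \<Longrightarrow> f x = g x) \<Longrightarrow> \<nu> f = \<nu> g"
  unfolding sampling_discrepancy_def using xs
  by (intro arg_cong2[where f = "(-)"] sum.cong sphere_integral_cong) auto

lemma nu_cmult: "\<nu> (\<lambda>x. c * f x) = c * \<nu> f"
  by (simp add: sampling_discrepancy_def sum_distrib_left algebra_simps)

lemma nu_sum:
  assumes "\<And>i. i \<in> I \<Longrightarrow> continuous_on S (f i)"
  shows "\<nu> (\<lambda>x. \<Sum>i\<in>I. f i x) = (\<Sum>i\<in>I. \<nu> (f i))"
proof -
  have "(\<integral>x. (\<Sum>i\<in>I. f i x) \<partial>sphere_measure) = (\<Sum>i\<in>I. \<integral>x. f i x \<partial>sphere_measure)"
    using assms by (intro Bochner_Integration.integral_sum integrable_sphere)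
  moreover have "(\<Sum>j=1..m. ws j * (\<Sum>i\<in>I. f i (xs j))) = (\<Sum>i\<in>I. \<Sum>j=1..m. ws j * f i (xs j))"
    unfolding sum_distrib_left by (rule sum.swap)
  ultimately show ?thesis by (simp add: sampling_discrepancy_def sum_subtractf)
qed

lemma nu_diff:
  assumes "continuous_on S f" "continuous_on S g"
  shows "\<nu> (\<lambda>x. f x - g x) = \<nu> f - \<nu> g"
proof -
  have "(\<integral>x. f x - g x \<partial>sphere_measure) = (\<integral>x. f x \<partial>sphere_measure) - (\<integral>x. g x \<partial>sphere_measure)"
    using assms by (intro Bochner_Integration.integral_diff integrable_sphere)
  then show ?thesis by (simp add: sampling_discrepancy_def sum_subtractf right_diff_distrib)
qed

text \<open>The discrepancy is a difference of two probability measures, so its total variation is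
  at most 2.\<close>

lemma nu_abs_le:
  assumes f: "continuous_on S f" and B: "\<And>x. x \<in> S \<Longrightarrow> \<bar>f x\<bar> \<le> B"
  shows "\<bar>\<nu> f\<bar> \<le> 2 * B"
proof -
  have "\<bar>\<Sum>j=1..m. ws j * f (xs j)\<bar> \<le> (\<Sum>j=1..m. ws j * B)"
  proof (rule order_trans[OF sum_abs sum_mono])
    fix j assume j: "j \<in> {1..m}"
    show "\<bar>ws j * f (xs j)\<bar> \<le> ws j * B"
      unfolding abs_mult using ws[OF j] B[OF xs[OF j]] by simp
  qed
  also have "\<dots> = B" using ws_sum by (simp flip: sum_distrib_right)
  finally have 1: "\<bar>\<Sum>j=1..m. ws j * f (xs j)\<bar> \<le> B" .
  have "\<bar>\<integral>x. f x \<partial>sphere_measure\<bar> \<le> (\<integral>x. \<bar>f x\<bar> \<partial>sphere_measure)" by (rule integral_abs_bound)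
  also have "\<dots> \<le> (\<integral>x. B \<partial>(sphere_measure :: 'a measure))"
    by (rule integral_mono) (use f B in \<open>auto intro!: integrable_sphere continuous_intros\<close>)
  also have "\<dots> = B" using sphere.prob_space[where 'a = 'a] by simp
  finally show ?thesis using 1 unfolding sampling_discrepancy_def by linarith
qed

lemma nu_poly:
  assumes g: "poly_upto n g"
  shows "\<nu> g = (\<Sum>l\<le>n. \<Sum>k=1..Z l. coef g l k * \<nu> (Y l k))"
proof -
  have "\<nu> g = \<nu> (\<lambda>x. \<Sum>l\<le>n. \<Sum>k=1..Z l. coef g l k * Y l k x)"
    by (rule nu_cong) (simp add: poly_upto_expansion(1)[OF g] proj_def)
  also have "\<dots> = (\<Sum>l\<le>n. \<Sum>k=1..Z l. coef g l k * \<nu> (Y l k))"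
    by (subst nu_sum; (subst nu_sum)?; auto simp: nu_cmult intro!: continuous_intros continuous_on_Y)
  finally show ?thesis .
qed

text \<open>The pairing of \<open>H^-r\<close> with \<open>H^r\<close>: Cauchy-Schwarz, first within
  each degree and then over the degrees, with the weights \<open>weight l powr (- r)\<close> and
  \<open>weight l powr r\<close>.\<close>

lemma nu_poly_bound:
  assumes sp: "\<nu> \<in> sobolev_space d Z Y (- r)" and N: "sobolev_norm d Z Y (- r) \<nu> \<le> N"
    and g: "poly_upto n g"
  shows "\<bar>\<nu> g\<bar> \<le> N * sqrt (sob r n g)"
proof -
  define a where "a l = sqrt (sobolev_term d Z Y (- r) \<nu> l)" for l
  define b where "b l = sqrt (weight l powr r * energy g l)" for l
  have trm: "sobolev_term d Z Y (- r) \<nu> l = weight l powr (- r) * (\<Sum>k=1..Z l. (\<nu> (Y l k))\<^sup>2)" for l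
    by (simp add: sobolev_term_def weight_def)
  have t0: "0 \<le> sobolev_term d Z Y (- r) \<nu> l" for l
    unfolding trm by (intro mult_nonneg_nonneg sum_nonneg) auto
  have le: "\<bar>\<Sum>k=1..Z l. coef g l k * \<nu> (Y l k)\<bar> \<le> a l * b l" for l
  proof -
    have w: "weight l powr (- r) * weight l powr r = 1"
      using weight_pos[of l] by (simp add: powr_add[symmetric])
    have "sobolev_term d Z Y (- r) \<nu> l * (weight l powr r * energy g l)
        = (weight l powr (- r) * weight l powr r) * (energy g l * (\<Sum>k=1..Z l. (\<nu> (Y l k))\<^sup>2))"
      unfolding trm by (simp only: mult_ac)
    then have "energy g l * (\<Sum>k=1..Z l. (\<nu> (Y l k))\<^sup>2)
        = sobolev_term d Z Y (- r) \<nu> l * (weight l powr r * energy g l)"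
      unfolding w mult_1_left by (rule sym)
    moreover have "(\<Sum>k=1..Z l. coef g l k * \<nu> (Y l k))\<^sup>2 \<le> energy g l * (\<Sum>k=1..Z l. (\<nu> (Y l k))\<^sup>2)"
      unfolding energy_def by (rule Cauchy_Schwarz_ineq_sum)
    ultimately have "sqrt ((\<Sum>k=1..Z l. coef g l k * \<nu> (Y l k))\<^sup>2)
        \<le> sqrt (sobolev_term d Z Y (- r) \<nu> l * (weight l powr r * energy g l))"
      by (intro real_sqrt_le_mono) (simp only:)
    then show ?thesis by (simp add: a_def b_def real_sqrt_mult)
  qed
  have "\<bar>\<nu> g\<bar> \<le> (\<Sum>l\<le>n. \<bar>\<Sum>k=1..Z l. coef g l k * \<nu> (Y l k)\<bar>)"
    unfolding nu_poly[OF g] by (rule sum_abs)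
  also have "\<dots> \<le> (\<Sum>l\<le>n. a l * b l)" by (intro sum_mono le)
  also have "\<dots> \<le> sqrt (\<Sum>l\<le>n. (a l)\<^sup>2) * sqrt (\<Sum>l\<le>n. (b l)\<^sup>2)"
    using Cauchy_Schwarz_ineq_sum[of a b "{..n}"] by (simp add: real_le_rsqrt flip: real_sqrt_mult)
  also have "(\<Sum>l\<le>n. (b l)\<^sup>2) = sob r n g"
    unfolding sob_def by (intro sum.cong refl) (simp add: b_def energy_nonneg)
  also have "(\<Sum>l\<le>n. (a l)\<^sup>2) = (\<Sum>l\<le>n. sobolev_term d Z Y (- r) \<nu> l)"
    using t0 by (intro sum.cong refl) (simp add: a_def)
  also have "sqrt (\<Sum>l\<le>n. sobolev_term d Z Y (- r) \<nu> l) \<le> sobolev_norm d Z Y (- r) \<nu>"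
    unfolding sobolev_norm_def using sp t0
    by (intro real_sqrt_le_mono sum_le_suminf) (auto simp: sobolev_space_def)
  then have "sqrt (\<Sum>l\<le>n. sobolev_term d Z Y (- r) \<nu> l) * sqrt (sob r n g) \<le> N * sqrt (sob r n g)"
    using N by (intro mult_right_mono) (auto simp: sob_nonneg)
  finally show ?thesis .
qed

text \<open>The first root comes from the constant of \<open>sob_mult\<close>, the second is the
  constant of \<open>proj_bounds_sum\<close>.\<close>

definition product_const :: "real \<Rightarrow> real \<Rightarrow> real" where
  "product_const r s = sqrt (3 * (18 * real (d + 1)) powr r)
     * sqrt (2 * 2 powr s * (\<Sum>l. real (Suc l) powr (2 * r + real d - 1 - 2 * s)))"

text \<open>\<open>nu_poly_bound\<close> wants a polynomial, so \<open>f\<close> is cut to its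
  components of degree below \<open>T\<close>. Each component times \<open>P\<close> is bounded by
  \<open>sob_mult\<close>, the bounds add up independently of \<open>T\<close>, and uniform
  convergence removes the cut.\<close>

lemma nu_product_bound:
  assumes sp: "\<nu> \<in> sobolev_space d Z Y (- r)" and N: "sobolev_norm d Z Y (- r) \<nu> \<le> N"
    and f: "continuous_on S f" and sm: "summable (\<lambda>l. weight l powr s * energy f l)"
    and r: "r \<ge> 0" and s: "s > real d / 2 + r" and P: "poly_upto n P"
  shows "\<bar>\<nu> (\<lambda>x. f x * P x)\<bar>
       \<le> N * product_const r s * sqrt (\<Sum>l. weight l powr s * energy f l) * sqrt (sob r n P)"
    (is "_ \<le> ?R")
proof (rule field_le_epsilon)
  fix \<epsilon> :: real assume \<epsilon>: "\<epsilon> > 0"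
  have N0: "0 \<le> N" using sobolev_norm_nonneg[OF sp] N by (rule order_trans)
  define M where "M l = sqrt (energy f l) * sqrt (2 * real (Suc l) ^ (d - 1))" for l
  have cP: "continuous_on S P" using poly_upto_rpf[OF P] by (rule rpf_continuous_on)
  obtain B where B: "B \<ge> 0" "\<And>x. x \<in> S \<Longrightarrow> \<bar>P x\<bar> \<le> B" using sphere_bounded[OF cP] by blast
  \<comment> \<open>An error \<open>e\<close> in \<open>f\<close> changes the discrepancy of the
    product by at most \<open>2 * e * B\<close>, which is below \<open>\<epsilon>\<close>.\<close>
  define e where "e = \<epsilon> / (2 * (B + 1))"
  have e: "e > 0" using \<epsilon> B by (simp add: e_def)
  have u: "uniform_limit S (\<lambda>T x. \<Sum>l<T. proj l f x) f sequentially"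
    by (rule harmonic_expansion[OF f sm]) (use r s in simp)
  obtain T where T: "\<And>x. x \<in> S \<Longrightarrow> dist (\<Sum>l<T. proj l f x) (f x) < e"
    using eventually_happens'[OF sequentially_bot uniform_limitD[OF u e]] by blast
  define FT where "FT x = (\<Sum>l<T. proj l f x)" for x
  have cF: "continuous_on S FT" unfolding FT_def[abs_def] by (intro continuous_intros continuous_on_proj)
  have one: "\<bar>\<nu> (\<lambda>x. proj l f x * P x)\<bar>
      \<le> N * sqrt (3 * (18 * real (d + 1)) powr r) * sqrt (sob r n P) * (real (Suc l) powr r * M l)" for l
  proof -
    define g where "g x = (\<Sum>k=1..Z l. coef f l k * solid l k x)" for x
    have g: "g \<in> harm l" unfolding g_def[abs_def] by (intro harm_sum harm_cmult solid_harm)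
    have eq: "proj l f x = g x" if "x \<in> S" for x
      unfolding proj_def g_def using that by (intro sum.cong) (auto simp: solid_eq)
    have Mg: "\<bar>g x\<bar> \<le> M l" if "x \<in> S" for x
      using proj_bound[OF that, of l f] eq[OF that] by (simp add: M_def)
    have M0: "0 \<le> M l" by (simp add: M_def energy_nonneg)
    have "\<nu> (\<lambda>x. proj l f x * P x) = \<nu> (\<lambda>x. g x * P x)" by (rule nu_cong) (simp add: eq)
    also have "\<bar>\<dots>\<bar> \<le> N * sqrt (sob r (n + l) (\<lambda>x. g x * P x))"
      using poly_upto_mult[OF poly_upto_hpoly[OF harm_hpoly[OF g] order_refl] P]
      by (intro nu_poly_bound[OF sp N]) (simp add: add.commute)
    also have "\<dots> \<le> N * sqrt (3 * (18 * real (d + 1)) powr r * real (Suc l) powr (2 * r) * (M l)\<^sup>2 * sob r n P)"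
      by (intro mult_left_mono real_sqrt_le_mono sob_mult[OF g Mg P r] N0)
    also have "\<dots> = N * sqrt (3 * (18 * real (d + 1)) powr r) * sqrt (sob r n P) * (real (Suc l) powr r * M l)"
    proof -
      have "sqrt (real (Suc l) powr (2 * r)) = real (Suc l) powr r"
        by (simp add: powr_half_sqrt[symmetric] powr_powr)
      then show ?thesis using M0 by (simp add: real_sqrt_mult)
    qed
    finally show ?thesis .
  qed
  have "\<bar>\<nu> (\<lambda>x. FT x * P x)\<bar> = \<bar>\<Sum>l<T. \<nu> (\<lambda>x. proj l f x * P x)\<bar>"
    unfolding FT_def sum_distrib_right by (subst nu_sum) (auto intro!: continuous_intros continuous_on_proj cP)
  also have "\<dots> \<le> (\<Sum>l<T. N * sqrt (3 * (18 * real (d + 1)) powr r) * sqrt (sob r n P) * (real (Suc l) powr r * M l))"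
    by (intro order_trans[OF sum_abs] sum_mono one)
  also have "\<dots> = N * sqrt (3 * (18 * real (d + 1)) powr r) * sqrt (sob r n P) * (\<Sum>l<T. real (Suc l) powr r * M l)"
    by (simp add: sum_distrib_left)
  also have "\<dots> \<le> N * sqrt (3 * (18 * real (d + 1)) powr r) * sqrt (sob r n P) *
     (sqrt (2 * 2 powr s * (\<Sum>l. real (Suc l) powr (2 * r + real d - 1 - 2 * s))) * sqrt (\<Sum>l. weight l powr s * energy f l))"
    unfolding M_def using r s N0
    by (intro mult_left_mono proj_bounds_sum[OF sm]) (auto simp: sob_nonneg)
  also have "\<dots> = ?R" by (simp add: product_const_def)
  finally have 1: "\<bar>\<nu> (\<lambda>x. FT x * P x)\<bar> \<le> ?R" .
  have "\<nu> (\<lambda>x. f x * P x) - \<nu> (\<lambda>x. FT x * P x) = \<nu> (\<lambda>x. f x * P x - FT x * P x)"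
    by (intro nu_diff[symmetric] continuous_intros f cF cP)
  also have "\<bar>\<dots>\<bar> \<le> 2 * (e * B)"
  proof (rule nu_abs_le)
    fix x :: 'a assume x: "x \<in> S"
    have "\<bar>f x * P x - FT x * P x\<bar> = \<bar>f x - FT x\<bar> * \<bar>P x\<bar>" by (simp add: abs_mult left_diff_distrib[symmetric])
    also have "\<dots> \<le> e * B"
      using T[OF x] B(2)[OF x] e by (intro mult_mono) (auto simp: FT_def dist_real_def abs_minus_commute)
    finally show "\<bar>f x * P x - FT x * P x\<bar> \<le> e * B" .
  qed (intro continuous_intros f cF cP)
  also have "\<dots> \<le> \<epsilon>" using \<epsilon> B(1) by (simp add: e_def field_simps)
  finally show "\<bar>\<nu> (\<lambda>x. f x * P x)\<bar> \<le> ?R + \<epsilon>" using 1 by linarith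
qed

subsection \<open>Filtered hyperinterpolation\<close>

abbreviation fhyp :: "(real \<Rightarrow> real) \<Rightarrow> nat \<Rightarrow> ('a \<Rightarrow> real) \<Rightarrow> 'a \<Rightarrow> real" where
  "fhyp h n \<equiv> filtered_hyperinterpolation Z Y h m xs ws n"

text \<open>The quadrature sum of \<open>f * Y l k\<close> is its integral plus its discrepancy, so
  the aliasing error is \<open>\<nu>\<close> of this product by definition.\<close>

lemma fhyp_eq:
  assumes h: "\<forall>t\<ge>2. h t = 0" and n: "n \<ge> 1" and f: "continuous_on S f"
  shows "fhyp h n f y = (\<Sum>l\<le>2 * n. \<Sum>k=1..Z l. h (real l / real n) * (coef f l k + \<nu> (\<lambda>x. f x * Y l k x)) * Y l k y)"
proof -
  have s: "coef f l k + \<nu> (\<lambda>x. f x * Y l k x) = (\<Sum>j=1..m. ws j * (f (xs j) * Y l k (xs j)))" for l k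
    by (simp add: sampling_discrepancy_def distribution_of_def)
  have "fhyp h n f y = (\<Sum>j=1..m. \<Sum>l\<le>2 * n. \<Sum>k=1..Z l. h (real l / real n) * (ws j * (f (xs j) * Y l k (xs j))) * Y l k y)"
    unfolding filtered_hyperinterpolation_def filter_kernel_eq[OF h n] zonal_def
    by (intro sum.cong refl) (simp add: sum_distrib_left mult_ac)
  also have "\<dots> = (\<Sum>l\<le>2 * n. \<Sum>j=1..m. \<Sum>k=1..Z l. h (real l / real n) * (ws j * (f (xs j) * Y l k (xs j))) * Y l k y)"
    by (rule sum.swap)
  also have "\<dots> = (\<Sum>l\<le>2 * n. \<Sum>k=1..Z l. \<Sum>j=1..m. h (real l / real n) * (ws j * (f (xs j) * Y l k (xs j))) * Y l k y)"
    by (intro sum.cong refl sum.swap)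
  finally show ?thesis unfolding s by (simp add: sum_distrib_left sum_distrib_right)
qed

lemma continuous_on_fhyp:
  assumes h: "\<forall>t\<ge>2. h t = 0" and n: "n \<ge> 1" and f: "continuous_on S f"
  shows "continuous_on S (fhyp h n f)"
  unfolding fhyp_eq[OF h n f, abs_def] by (intro continuous_intros continuous_on_Y)

lemma coef_fhyp:
  assumes h: "\<forall>t\<ge>2. h t = 0" and n: "n \<ge> 1" and f: "continuous_on S f" and k: "k \<in> {1..Z l}"
  shows "coef (fhyp h n f) l k = h (real l / real n) * (coef f l k + \<nu> (\<lambda>x. f x * Y l k x))"
proof (cases "l \<le> 2 * n")
  case True
  then show ?thesis
    unfolding fhyp_eq[OF h n f, abs_def] by (subst coef_combination[OF _ k]) auto
next
  case False
  then have "h (real l / real n) = 0" using filter_eq_0[OF h n] by simp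
  with False show ?thesis
    unfolding fhyp_eq[OF h n f, abs_def] by (subst coef_combination[OF _ k]) auto
qed

text \<open>The coefficients of the error are \<open>(1 - hl l) * coef f l k - hl l * e l k\<close>.
  The first part lives on degrees above \<open>n\<close>, the second is the aliasing part.
  \<open>sqrt 2\<close> comes from splitting the square of a difference, \<open>2 * H\<close> bounds
  \<open>\<bar>1 - hl l\<bar>\<close>, and \<open>9 * (d + 1) * n\<^sup>2\<close> bounds the weight
  up to degree \<open>2 * n\<close>.\<close>

theorem fhyp_error:
  assumes sp: "\<nu> \<in> sobolev_space d Z Y (- r)" and N: "sobolev_norm d Z Y (- r) \<nu> \<le> N"
    and f: "continuous_on S f" and sm: "summable (\<lambda>l. weight l powr s * energy f l)"
    and r: "r \<ge> 0" and s: "s > real d / 2 + r" and q: "0 \<le> q" "q < s" and n: "n \<ge> 1"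
    and h2: "\<forall>t\<ge>2. h t = 0" and h1: "\<And>t. 0 \<le> t \<Longrightarrow> t \<le> 1 \<Longrightarrow> h t = 1"
    and H: "\<And>t. t \<ge> 0 \<Longrightarrow> \<bar>h t\<bar> \<le> H"
  shows "distribution_of (\<lambda>y. f y - fhyp h n f y) \<in> sobolev_space d Z Y q" (is ?A)
    and "sobolev_norm d Z Y q (distribution_of (\<lambda>y. f y - fhyp h n f y))
      \<le> sqrt 2 * (2 * H * real n powr (- (s - q))
           + N * product_const r s * (9 * real (d + 1)) powr ((r + q) / 2) * H * real n powr (r + q))
        * sobolev_norm d Z Y s (distribution_of f)" (is ?B)
proof -
  define hl where "hl l = h (real l / real n)" for l
  define e where "e l k = \<nu> (\<lambda>x. f x * Y l k x)" for l k
  define \<eta> where "\<eta> l = (\<Sum>k=1..Z l. (e l k)\<^sup>2)" for l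
  define v where "v l = weight l powr q * (hl l)\<^sup>2 * \<eta> l" for l
  define G where "G y = f y - fhyp h n f y" for y
  define nf where "nf = sqrt (\<Sum>l. weight l powr s * energy f l)"
  define \<Lambda> where "\<Lambda> = real n powr (- (s - q))"
  \<comment> \<open>The square of the \<open>H^q\<close> norm of the aliasing part.\<close>
  define E where "E = (\<Sum>l\<le>2 * n. v l)"
  define X where "X = N * product_const r s * (9 * real (d + 1)) powr ((r + q) / 2) * H * real n powr (r + q)"
  have Hl: "\<bar>hl l\<bar> \<le> H" for l unfolding hl_def by (rule H) simp
  have H1: "1 \<le> H" using H[of 0] h1[of 0] by simp
  have cG: "continuous_on S G"
    unfolding G_def[abs_def] using continuous_on_fhyp[OF h2 n f] f by (intro continuous_intros) auto
  have \<eta>0: "0 \<le> \<eta> l" for l unfolding \<eta>_def by (intro sum_nonneg) simp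
  have v0: "0 \<le> v l" for l unfolding v_def by (intro mult_nonneg_nonneg \<eta>0) auto
  have E0: "0 \<le> E" unfolding E_def by (intro sum_nonneg v0)
  have sum0: "0 \<le> (\<Sum>l. weight l powr s * energy f l)"
    by (intro suminf_nonneg sm mult_nonneg_nonneg energy_nonneg) auto
  have nf0: "0 \<le> nf" and nf2: "nf\<^sup>2 = (\<Sum>l. weight l powr s * energy f l)"
    using sum0 by (simp_all add: nf_def)
  have nf: "sobolev_norm d Z Y s (distribution_of f) = nf"
    by (simp add: sobolev_norm_def sobolev_term_eq nf_def)
  have cof: "coef G l k = (1 - hl l) * coef f l k - hl l * e l k" if "k \<in> {1..Z l}" for l k
  proof -
    have "coef G l k = coef f l k - coef (fhyp h n f) l k"
      unfolding G_def[abs_def] using f continuous_on_fhyp[OF h2 n f] that by (intro coef_diff)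
    then show ?thesis using coef_fhyp[OF h2 n f that] by (simp add: hl_def e_def algebra_simps)
  qed
  have enG: "energy G l \<le> 2 * ((1 - hl l)\<^sup>2 * energy f l + (hl l)\<^sup>2 * \<eta> l)" for l
  proof -
    have "energy G l \<le> (\<Sum>k=1..Z l. 2 * ((1 - hl l)\<^sup>2 * (coef f l k)\<^sup>2 + (hl l)\<^sup>2 * (e l k)\<^sup>2))"
      unfolding energy_def
    proof (rule sum_mono)
      fix k assume k: "k \<in> {1..Z l}"
      have "(a - b)\<^sup>2 \<le> 2 * (a\<^sup>2 + b\<^sup>2)" for a b :: real
        using zero_le_power2[of "a + b"] by (simp add: power2_eq_square algebra_simps)
      from this[of "(1 - hl l) * coef f l k" "hl l * e l k"]
      show "(coef G l k)\<^sup>2 \<le> 2 * ((1 - hl l)\<^sup>2 * (coef f l k)\<^sup>2 + (hl l)\<^sup>2 * (e l k)\<^sup>2)"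
        unfolding cof[OF k] power_mult_distrib .
    qed
    then show ?thesis by (simp add: energy_def \<eta>_def sum_distrib_left sum.distrib algebra_simps)
  qed
  have tail: "weight l powr q * (1 - hl l)\<^sup>2 \<le> 4 * H\<^sup>2 * \<Lambda>\<^sup>2 * weight l powr s" for l
  proof (cases "l \<le> n")
    case True
    then have "hl l = 1" unfolding hl_def using n by (intro h1) (auto simp: field_simps)
    then show ?thesis by simp
  next
    case False
    have "\<bar>1 - hl l\<bar> \<le> 2 * H" using Hl[of l] H1 by linarith
    then have "\<bar>1 - hl l\<bar>\<^sup>2 \<le> (2 * H)\<^sup>2" by (intro power_mono) auto
    then have 1: "(1 - hl l)\<^sup>2 \<le> 4 * H\<^sup>2" by (simp add: power_mult_distrib)
    have "(real n)\<^sup>2 \<le> (real l)\<^sup>2" using False by (intro power_mono) auto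
    with weight_lower(2)[of l] have "(real n)\<^sup>2 \<le> weight l" by linarith
    then have "weight l powr (- (s - q)) \<le> ((real n)\<^sup>2) powr (- (s - q))"
      using q n by (intro powr_mono2') auto
    also have "((real n)\<^sup>2) powr (- (s - q)) = \<Lambda>\<^sup>2"
      using n by (simp add: \<Lambda>_def power2_eq_square powr_mult)
    finally have 2: "weight l powr (- (s - q)) \<le> \<Lambda>\<^sup>2" .
    have "weight l powr q = weight l powr (- (s - q)) * weight l powr s"
      by (simp add: powr_add[symmetric])
    also have "\<dots> \<le> \<Lambda>\<^sup>2 * weight l powr s" using 2 by (intro mult_right_mono) auto
    finally have "weight l powr q * (1 - hl l)\<^sup>2 \<le> (\<Lambda>\<^sup>2 * weight l powr s) * (4 * H\<^sup>2)"
      using 1 by (intro mult_mono) auto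
    then show ?thesis by (simp add: mult_ac)
  qed
  have termle: "weight l powr q * energy G l
      \<le> 2 * (4 * H\<^sup>2 * \<Lambda>\<^sup>2) * (weight l powr s * energy f l) + 2 * v l" for l
  proof -
    have "weight l powr q * energy G l \<le> weight l powr q * (2 * ((1 - hl l)\<^sup>2 * energy f l + (hl l)\<^sup>2 * \<eta> l))"
      by (intro mult_left_mono enG) auto
    also have "\<dots> = 2 * (weight l powr q * (1 - hl l)\<^sup>2) * energy f l + 2 * v l"
      by (simp add: v_def algebra_simps)
    also have "\<dots> \<le> 2 * (4 * H\<^sup>2 * \<Lambda>\<^sup>2 * weight l powr s) * energy f l + 2 * v l"
      by (intro add_right_mono mult_right_mono mult_left_mono tail energy_nonneg) auto
    finally show ?thesis by (simp add: mult_ac)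
  qed
  have vz: "v l = 0" if "l > 2 * n" for l
    using filter_eq_0[OF h2 n that] by (simp add: v_def hl_def)
  have vs: "v sums E"
    unfolding E_def using vz by (intro sums_finite) auto
  have bs: "(\<lambda>l. 2 * (4 * H\<^sup>2 * \<Lambda>\<^sup>2) * (weight l powr s * energy f l) + 2 * v l)
      sums (2 * (4 * H\<^sup>2 * \<Lambda>\<^sup>2) * nf\<^sup>2 + 2 * E)"
    unfolding nf2 by (intro sums_add sums_mult summable_sums[OF sm] vs)
  have smG: "summable (\<lambda>l. weight l powr q * energy G l)"
    by (rule summable_comparison_test'[OF sums_summable[OF bs], of 0])
       (use termle in \<open>auto simp: abs_of_nonneg energy_nonneg\<close>)
  have leG: "(\<Sum>l. weight l powr q * energy G l) \<le> 2 * (4 * H\<^sup>2 * \<Lambda>\<^sup>2) * nf\<^sup>2 + 2 * E"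
    using suminf_le[OF termle smG sums_summable[OF bs]] sums_unique[OF bs] by simp
  show ?A
    using smG sphere_distribution_of_continuous[OF cG]
    unfolding sobolev_space_def by (simp add: sobolev_term_eq[abs_def] G_def[abs_def])
  have EX: "sqrt E \<le> X * nf"
  proof -
    \<comment> \<open>These coefficients represent the aliasing part by duality:
      \<open>\<nu>\<close> of \<open>f * P\<close> becomes \<open>E\<close> itself.\<close>
    define c where "c l k = weight l powr q * (hl l)\<^sup>2 * e l k" for l k
    obtain P where P: "poly_upto (2 * n) P" "\<And>x. x \<in> S \<Longrightarrow> P x = (\<Sum>l\<le>2 * n. \<Sum>k=1..Z l. c l k * Y l k x)"
      using combination_poly by blast
    have cP: "coef P l k = c l k" if "l \<le> 2 * n" "k \<in> {1..Z l}" for l k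
      using coef_combination[OF _ that(2), of "{..2 * n}" c] coef_cong[of P _ l k, OF P(2)] that by simp
    have "\<nu> (\<lambda>x. f x * P x) = \<nu> (\<lambda>x. \<Sum>l\<le>2 * n. \<Sum>k=1..Z l. c l k * (f x * Y l k x))"
      by (rule nu_cong) (simp add: P(2) sum_distrib_left mult_ac)
    also have "\<dots> = (\<Sum>l\<le>2 * n. \<Sum>k=1..Z l. c l k * e l k)"
      unfolding e_def
      by (subst nu_sum; (subst nu_sum)?; auto simp: nu_cmult intro!: continuous_intros continuous_on_Y f)
    also have "\<dots> = E"
      unfolding E_def v_def \<eta>_def c_def sum_distrib_left
      by (intro sum.cong refl) (simp add: power2_eq_square)
    finally have E_eq: "\<nu> (\<lambda>x. f x * P x) = E" .
    \<comment> \<open>A coefficient of \<open>P\<close> is that of the aliasing part times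
      \<open>weight l powr q * hl l\<close>. Up to degree \<open>2 * n\<close>, this and the change
      from \<open>H^q\<close> to \<open>H^r\<close> cost a factor of order \<open>n\<close> to the
      power \<open>2 * (r + q)\<close> in the square.\<close>
    have "sob r (2 * n) P \<le> (9 * real (d + 1) * (real n)\<^sup>2) powr (r + q) * H\<^sup>2 * E"
      unfolding sob_def E_def sum_distrib_left
    proof (rule sum_mono)
      fix l assume l: "l \<in> {..2 * n}"
      then have "energy P l = (weight l powr q * (hl l)\<^sup>2)\<^sup>2 * \<eta> l"
        unfolding energy_def \<eta>_def sum_distrib_left by (intro sum.cong refl) (simp add: cP c_def power_mult_distrib)
      then have "weight l powr r * energy P l = (weight l powr r * weight l powr q) * (hl l)\<^sup>2 * v l"
        by (simp add: v_def power2_eq_square mult_ac)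
      also have "weight l powr r * weight l powr q = weight l powr (r + q)" by (simp add: powr_add)
      also have "weight l powr (r + q) * (hl l)\<^sup>2 * v l \<le> (9 * real (d + 1) * (real n)\<^sup>2) powr (r + q) * H\<^sup>2 * v l"
      proof (intro mult_right_mono mult_mono v0 powr_mono2)
        have "real (Suc l) \<le> 3 * real n" using l n by auto
        then have "(real (Suc l))\<^sup>2 \<le> (3 * real n)\<^sup>2" by (intro power_mono) auto
        then have "real (d + 1) * (real (Suc l))\<^sup>2 \<le> real (d + 1) * (3 * real n)\<^sup>2"
          by (intro mult_left_mono) auto
        also have "\<dots> = 9 * real (d + 1) * (real n)\<^sup>2" by (simp add: power_mult_distrib)
        finally show "weight l \<le> 9 * real (d + 1) * (real n)\<^sup>2"
          using weight_upper[of l] by (rule order_trans[rotated])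
        show "(hl l)\<^sup>2 \<le> H\<^sup>2" using Hl[of l] by (metis abs_ge_zero power2_abs power_mono)
      qed (use weight_pos[of l] r q in auto)
      finally show "weight l powr r * energy P l \<le> (9 * real (d + 1) * (real n)\<^sup>2) powr (r + q) * H\<^sup>2 * v l" .
    qed
    then have "sqrt (sob r (2 * n) P) \<le> sqrt ((9 * real (d + 1) * (real n)\<^sup>2) powr (r + q) * H\<^sup>2 * E)"
      by (rule real_sqrt_le_mono)
    also have "\<dots> = (9 * real (d + 1)) powr ((r + q) / 2) * real n powr (r + q) * H * sqrt E"
    proof -
      have "sqrt ((9 * real (d + 1) * (real n)\<^sup>2) powr (r + q))
          = (9 * real (d + 1)) powr ((r + q) / 2) * real n powr (r + q)"
        using n by (simp add: powr_mult powr_half_sqrt[symmetric] powr_powr power2_eq_square)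
           (simp add: powr_add[symmetric])
      then show ?thesis using H1 by (simp add: real_sqrt_mult)
    qed
    finally have sq: "sqrt (sob r (2 * n) P) \<le> (9 * real (d + 1)) powr ((r + q) / 2) * real n powr (r + q) * H * sqrt E" .
    have pc0: "0 \<le> N * product_const r s"
    proof -
      have "0 \<le> sobolev_norm d Z Y (- r) \<nu>" by (rule sobolev_norm_nonneg[OF sp])
      moreover have "0 \<le> product_const r s"
      proof -
        have "2 * r + real d - 1 - 2 * s < - 1" using s by simp
        then have "summable (\<lambda>l. real (Suc l) powr (2 * r + real d - 1 - 2 * s))"
          by (subst summable_Suc_iff) (simp add: summable_real_powr_iff)
        then show ?thesis unfolding product_const_def
          by (intro mult_nonneg_nonneg real_sqrt_ge_zero suminf_nonneg) auto
      qed
      ultimately show ?thesis using N by simp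
    qed
    have "E \<le> N * product_const r s * nf * sqrt (sob r (2 * n) P)"
      using nu_product_bound[OF sp N f sm r s P(1)] unfolding E_eq nf_def by simp
    also have "\<dots> \<le> N * product_const r s * nf * ((9 * real (d + 1)) powr ((r + q) / 2) * real n powr (r + q) * H * sqrt E)"
      by (intro mult_left_mono sq mult_nonneg_nonneg pc0 nf0)
    also have "\<dots> = (X * nf) * sqrt E" by (simp add: X_def mult_ac)
    \<comment> \<open>\<open>E\<close> is bounded by a multiple of its own root, which is divided
      out below.\<close>
    finally have 1: "sqrt E * sqrt E \<le> (X * nf) * sqrt E" using E0 by simp
    have "0 \<le> (N * product_const r s) * ((9 * real (d + 1)) powr ((r + q) / 2) * H * real n powr (r + q) * nf)"
      using nf0 H1 by (intro mult_nonneg_nonneg[OF pc0]) auto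
    then have X0: "0 \<le> X * nf" by (simp add: X_def mult_ac)
    show ?thesis
    proof (cases "E = 0")
      case True then show ?thesis using X0 by simp
    next
      case False
      with E0 have "sqrt E > 0" by simp
      with 1 show ?thesis by (rule mult_right_le_imp_le)
    qed
  qed
  have "(sobolev_norm d Z Y q (distribution_of G))\<^sup>2 \<le> 2 * (4 * H\<^sup>2 * \<Lambda>\<^sup>2) * nf\<^sup>2 + 2 * E"
  proof -
    have "0 \<le> (\<Sum>l. weight l powr q * energy G l)"
      by (intro suminf_nonneg smG mult_nonneg_nonneg energy_nonneg) auto
    then show ?thesis using leG by (simp add: sobolev_norm_def sobolev_term_eq)
  qed
  also have "\<dots> \<le> (sqrt 2 * (2 * H * \<Lambda> + X) * nf)\<^sup>2"
  proof -
    have X0: "0 \<le> X * nf" using EX E0 by (meson order_trans real_sqrt_ge_zero)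
    have "E = (sqrt E)\<^sup>2" using E0 by simp
    also have "\<dots> \<le> (X * nf)\<^sup>2" using EX E0 by (intro power_mono) auto
    finally have "E \<le> (X * nf)\<^sup>2" .
    moreover have "0 \<le> (2 * H * \<Lambda> * nf) * (X * nf)"
      using H1 nf0 by (intro mult_nonneg_nonneg[OF _ X0]) (simp add: \<Lambda>_def)
    moreover have "(sqrt 2 * (2 * H * \<Lambda> + X) * nf)\<^sup>2
        = 2 * (4 * H\<^sup>2 * \<Lambda>\<^sup>2) * nf\<^sup>2 + 4 * ((2 * H * \<Lambda> * nf) * (X * nf)) + 2 * (X * nf)\<^sup>2"
      by (simp add: power_mult_distrib power2_eq_square algebra_simps)
    ultimately show ?thesis by linarith
  qed
  finally have sqle: "(sobolev_norm d Z Y q (distribution_of G))\<^sup>2 \<le> (sqrt 2 * (2 * H * \<Lambda> + X) * nf)\<^sup>2" .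
  have "sobolev_norm d Z Y q (distribution_of G) \<le> sqrt 2 * (2 * H * \<Lambda> + X) * nf"
  proof (rule power2_le_imp_le[OF sqle])
    have "0 \<le> X * nf" using EX E0 by (meson order_trans real_sqrt_ge_zero)
    moreover have "0 \<le> 2 * H * \<Lambda> * nf" using H1 nf0 by (intro mult_nonneg_nonneg) (auto simp: \<Lambda>_def)
    ultimately have "0 \<le> sqrt 2 * (2 * H * \<Lambda> * nf + X * nf)" by (intro mult_nonneg_nonneg) auto
    then show "0 \<le> sqrt 2 * (2 * H * \<Lambda> + X) * nf" by (simp add: algebra_simps)
  qed
  then show ?B unfolding nf by (simp add: G_def[abs_def] X_def \<Lambda>_def)
qed

end

section \<open>A Marcinkiewicz-Zygmund inequality\<close>

lemma lborel_integral_affine: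
  fixes f :: "'a::euclidean_space \<Rightarrow> real"
  assumes [measurable]: "f \<in> borel_measurable borel" and c: "c > 0"
  shows "(\<integral>x. f x \<partial>lborel) = c ^ DIM('a) * (\<integral>x. f (t + c *\<^sub>R x) \<partial>lborel)"
proof -
  have "(\<integral>x. f x \<partial>lborel)
      = (\<integral>x. f x \<partial>density (distr lborel borel (\<lambda>x. t + c *\<^sub>R x)) (\<lambda>_. ennreal (\<bar>c\<bar> ^ DIM('a))))"
    using lborel_affine[of c t] c by simp
  also have "\<dots> = c ^ DIM('a) * (\<integral>x. f (t + c *\<^sub>R x) \<partial>lborel)"
    using c by (subst integral_density; (measurable)?; simp add: integral_distr)
  finally show ?thesis .
qed

lemma unit_ball_integral_affine:
  fixes g :: "'a::euclidean_space \<Rightarrow> real"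
  assumes [measurable]: "g \<in> borel_measurable borel" and c: "c > 0"
  shows "c ^ DIM('a) * measure lborel (ball (0::'a) 1) * (\<integral>z. g (t + c *\<^sub>R z) \<partial>unit_ball_measure)
       = (\<integral>x. indicator (ball t c) x * g x \<partial>lborel)"
proof -
  have V: "measure lborel (ball (0::'a) 1) > 0" by (rule content_ball_pos) simp
  have "(\<integral>x. indicator (ball t c) x * g x \<partial>lborel)
      = c ^ DIM('a) * (\<integral>x. indicator (ball t c) (t + c *\<^sub>R x) * g (t + c *\<^sub>R x) \<partial>lborel)"
    using c by (intro lborel_integral_affine borel_measurable_times borel_measurable_indicator) auto
  also have "(\<lambda>x. indicator (ball t c) (t + c *\<^sub>R x) * g (t + c *\<^sub>R x))
      = (\<lambda>x. indicator (ball 0 1) x * g (t + c *\<^sub>R x))"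
    using c by (auto simp: indicator_def dist_norm)
  also have "(\<integral>x. indicator (ball 0 1) x * g (t + c *\<^sub>R x) \<partial>lborel)
      = measure lborel (ball (0::'a) 1) * (\<integral>z. g (t + c *\<^sub>R z) \<partial>unit_ball_measure)"
    using V by (subst unit_ball_integral_eq) auto
  finally show ?thesis by simp
qed

lemma rpf_integrable_ball:
  fixes p :: "'a::euclidean_space \<Rightarrow> real"
  assumes "real_polynomial_function p"
  shows "integrable unit_ball_measure p"
proof -
  have "bounded (p ` cball 0 1)"
    by (intro compact_imp_bounded compact_continuous_image rpf_continuous_on assms compact_cball)
  then obtain K where K': "\<forall>y\<in>p ` cball 0 1. norm y \<le> K" unfolding bounded_iff by blast
  then have K: "\<bar>p x\<bar> \<le> K" if "x \<in> cball 0 1" for x using that by fastforce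
  have "AE x in unit_ball_measure. norm (p x) \<le> K"
    using AE_unit_ball by eventually_elim (use K in auto)
  then show ?thesis
    using rpf_measurable[OF assms] by (intro unit_ball.integrable_const_bound[of _ K]) auto
qed

lemma hpoly_ball_integral:
  fixes p :: "'a::euclidean_space \<Rightarrow> real"
  assumes p: "p \<in> hpoly k" and [measurable]: "\<phi> \<in> borel_measurable borel"
    and B: "\<And>t. 0 \<le> t \<Longrightarrow> t < 1 \<Longrightarrow> \<bar>\<phi> t\<bar> \<le> B"
  shows "integrable unit_ball_measure (\<lambda>x. \<phi> (norm x) * p x)"
    and "(\<integral>x. \<phi> (norm x) * p x \<partial>unit_ball_measure)
       = (\<integral>x. \<phi> (norm x) * norm x ^ k \<partial>(unit_ball_measure :: 'a measure)) * (\<integral>x. p x \<partial>sphere_measure)"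
proof -
  have rp: "real_polynomial_function p" using p by auto
  note [measurable] = rpf_measurable[OF rp]
  have b: "\<bar>\<phi> t * t ^ k\<bar> \<le> B" if "0 \<le> t" "t < 1" for t
  proof -
    have "\<bar>\<phi> t\<bar> * \<bar>t ^ k\<bar> \<le> B * 1"
      using B[OF that] that by (intro mult_mono) (auto simp: power_le_one)
    then show ?thesis by (simp add: abs_mult)
  qed
  have e: "\<phi> (norm x) * p x = \<phi> (norm x) * norm x ^ k * p (sgn x)" if "x \<noteq> 0" for x
    using hpoly_scale[OF p, of "norm x" "sgn x"] that by (simp add: sgn_div_norm)
  note pol = polar_integral[OF rpf_continuous_on[OF rp], of "\<lambda>t. \<phi> t * t ^ k" B "\<lambda>x. \<phi> (norm x) * p x"]
  show "integrable unit_ball_measure (\<lambda>x. \<phi> (norm x) * p x)"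
    by (rule pol(1); (measurable)?) (use b e in auto)
  show "(\<integral>x. \<phi> (norm x) * p x \<partial>unit_ball_measure)
       = (\<integral>x. \<phi> (norm x) * norm x ^ k \<partial>(unit_ball_measure :: 'a measure)) * (\<integral>x. p x \<partial>sphere_measure)"
    by (rule pol(2); (measurable)?) (use b e in auto)
qed

lemma rpf_affine:
  fixes u :: "'a::euclidean_space \<Rightarrow> real"
  assumes u: "real_polynomial_function u"
  shows "real_polynomial_function (\<lambda>z. u (c + e *\<^sub>R z))"
    and "pd b (\<lambda>z. u (c + e *\<^sub>R z)) = (\<lambda>z. e * pd b u (c + e *\<^sub>R z))"
proof -
  have "polynomial_function (\<lambda>z. c + e *\<^sub>R z)"
    by (intro polynomial_function_add polynomial_function_const polynomial_function_cmul polynomial_function_id)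
  from real_polynomial_function_compose[OF this u]
  show "real_polynomial_function (\<lambda>z. u (c + e *\<^sub>R z))" by (simp add: o_def)
  show "pd b (\<lambda>z. u (c + e *\<^sub>R z)) = (\<lambda>z. e * pd b u (c + e *\<^sub>R z))"
  proof
    fix z
    let ?D = "frechet_derivative u (at (c + e *\<^sub>R z))"
    have D: "(u has_derivative ?D) (at (c + e *\<^sub>R z))" by (rule rpf_has_derivative[OF u])
    have "((\<lambda>z. u (c + e *\<^sub>R z)) has_derivative (\<lambda>h. ?D (e *\<^sub>R h))) (at z)"
      by (rule has_derivative_compose[of "\<lambda>z. c + e *\<^sub>R z" "\<lambda>h. e *\<^sub>R h" z UNIV u, OF _ D])
         (auto intro!: derivative_eq_intros)
    from pd_eqI[OF this, of b] show "pd b (\<lambda>z. u (c + e *\<^sub>R z)) z = e * pd b u (c + e *\<^sub>R z)"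
      using has_derivative_linear[OF D] by (simp add: linear_scale pd_def)
  qed
qed

section \<open>Mean values of harmonic polynomials over balls\<close>

text \<open>Around the centre, the homogeneous components of a harmonic polynomial are harmonic one
  by one. Those of positive degree have mean 0 on the sphere by
  \<open>sphere_integral_laplacian\<close>, so only the constant term is left.\<close>

theorem harmonic_mean_value:
  fixes u :: "'a::euclidean_space \<Rightarrow> real"
  assumes u: "real_polynomial_function u" and harmonic: "\<And>x. laplacian u x = 0" and N: "DIM('a) \<ge> 2"
  shows "(\<integral>z. u (c + e *\<^sub>R z) \<partial>unit_ball_measure) = u c"
proof -
  define v where "v z = u (c + e *\<^sub>R z)" for z
  have rv: "real_polynomial_function v" unfolding v_def[abs_def] by (rule rpf_affine(1)[OF u])
  have lap_v: "laplacian v z = 0" for z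
  proof -
    have "pd b (pd b v) = (\<lambda>z. e * (e * pd b (pd b u) (c + e *\<^sub>R z)))" for b
    proof -
      have "pd b v = (\<lambda>z. e * pd b u (c + e *\<^sub>R z))"
        unfolding v_def[abs_def] by (rule rpf_affine(2)[OF u])
      then show ?thesis
        by (simp add: pd_cmult rpf_affine(1)[OF rpf_pd[OF u]] rpf_affine(2)[OF rpf_pd[OF u]])
    qed
    then have "laplacian v z = e * (e * laplacian u (c + e *\<^sub>R z))"
      by (simp add: laplacian_pd sum_distrib_left)
    then show ?thesis by (simp add: harmonic)
  qed
  obtain n where "poly_upto n v" using rpf_poly_upto[OF rv] by blast
  then obtain q where q: "\<And>i. q i \<in> hpoly i" and vq: "\<And>x. v x = (\<Sum>i\<le>n. q i x)"
    unfolding poly_upto_def by blast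
  have rq: "real_polynomial_function (q i)" for i using q[of i] by auto
  have lap_q: "laplacian (q i) x = 0" if "i \<le> n" for i x
  proof -
    \<comment> \<open>A polynomial in the dilation \<open>s\<close> that vanishes identically has
      zero coefficients. The factor \<open>s\<^sup>2\<close> below makes up for the two degrees lost
      by the Laplacian.\<close>
    have "(\<Sum>i\<le>n. laplacian (q i) x * s ^ i) = 0" for s :: real
    proof -
      have v: "v = (\<lambda>x. \<Sum>i\<le>n. q i x)" using vq by auto
      have "0 = s\<^sup>2 * laplacian v (s *\<^sub>R x)" by (simp add: lap_v)
      also have "\<dots> = s\<^sup>2 * (\<Sum>i\<le>n. laplacian (q i) (s *\<^sub>R x))"
        unfolding v by (subst laplacian_sum) (auto simp: rq)
      also have "\<dots> = (\<Sum>i\<le>n. laplacian (q i) x * s ^ i)"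
        unfolding sum_distrib_left
      proof (intro sum.cong refl)
        fix i
        show "s\<^sup>2 * laplacian (q i) (s *\<^sub>R x) = laplacian (q i) x * s ^ i"
        proof (cases "i < 2")
          case True then show ?thesis using laplacian_hpoly_less_2[OF q] by simp
        next
          case False
          then have "s ^ i = s\<^sup>2 * s ^ (i - 2)" by (metis le_add_diff_inverse not_less power_add)
          then show ?thesis using hpoly_scale[OF hpoly_laplacian[OF q], of i s x] by simp
        qed
      qed
      finally show ?thesis by simp
    qed
    then show ?thesis using polyfun_eq_0[of "\<lambda>i. laplacian (q i) x" n] that by blast
  qed
  have qint: "(\<integral>z. q i z \<partial>unit_ball_measure) = q i 0" if "i \<le> n" for i
  proof (cases "i = 0")
    case True
    then have c: "q i = (\<lambda>x. q i 0)" using hpoly_0_const q by metis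
    have "(\<integral>z. q i z \<partial>unit_ball_measure) = (\<integral>z. q i 0 \<partial>(unit_ball_measure :: 'a measure))"
      by (subst c) simp
    then show ?thesis using unit_ball.prob_space[where 'a = 'a] by simp
  next
    case False
    have "0 = real i * (real i + real DIM('a) - 2) * (\<integral>x. q i x \<partial>sphere_measure)"
      using sphere_integral_laplacian[OF q, of i] lap_q[OF that] by simp
    then have "(\<integral>x. q i x \<partial>sphere_measure) = 0" using False N by auto
    then have "(\<integral>z. q i z \<partial>unit_ball_measure) = 0"
      using hpoly_ball_integral(2)[OF q, of "\<lambda>_. 1" 1 i] by simp
    moreover have "q i 0 = 0" using hpoly_scale[OF q, of i 0 0] False by (simp add: power_0_left)
    ultimately show ?thesis by simp
  qed
  have "(\<integral>z. v z \<partial>unit_ball_measure) = (\<Sum>i\<le>n. \<integral>z. q i z \<partial>unit_ball_measure)"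
    unfolding vq by (intro Bochner_Integration.integral_sum rpf_integrable_ball rq)
  also have "\<dots> = (\<Sum>i\<le>n. q i 0)" using qint by (intro sum.cong) auto
  also have "\<dots> = v 0" by (simp add: vq)
  finally show ?thesis by (simp add: v_def)
qed

text \<open>The variance over the ball is nonnegative, and the mean is \<open>u c\<close>.\<close>

lemma harmonic_square_mean_value:
  fixes u :: "'a::euclidean_space \<Rightarrow> real"
  assumes u: "real_polynomial_function u" and harmonic: "\<And>x. laplacian u x = 0" and N: "DIM('a) \<ge> 2"
  shows "(u c)\<^sup>2 \<le> (\<integral>z. (u (c + e *\<^sub>R z))\<^sup>2 \<partial>unit_ball_measure)"
proof -
  define v where "v z = u (c + e *\<^sub>R z)" for z
  have rv: "real_polynomial_function v" unfolding v_def[abs_def] by (rule rpf_affine(1)[OF u])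
  have m: "(\<integral>z. v z \<partial>unit_ball_measure) = u c"
    unfolding v_def by (rule harmonic_mean_value[OF u harmonic N])
  have i: "integrable unit_ball_measure v" "integrable unit_ball_measure (\<lambda>z. (v z)\<^sup>2)"
    by (intro rpf_integrable_ball rv real_polynomial_function_power)+
  have "0 \<le> (\<integral>z. (v z - u c)\<^sup>2 \<partial>unit_ball_measure)" by (rule integral_nonneg_AE) simp
  also have "\<dots> = (\<integral>z. (v z)\<^sup>2 - 2 * u c * v z + (u c)\<^sup>2 \<partial>unit_ball_measure)"
    by (rule Bochner_Integration.integral_cong) (auto simp: power2_eq_square algebra_simps)
  also have "\<dots> = (\<integral>z. (v z)\<^sup>2 \<partial>unit_ball_measure) - 2 * u c * u c + (u c)\<^sup>2"
    using i m unit_ball.prob_space[where 'a = 'a] by simp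
  finally show ?thesis by (simp add: v_def power2_eq_square)
qed

section \<open>Packing balls into a thin shell\<close>

text \<open>The inner radius \<open>1 - e\<close> of the shell after division by the outer radius
  \<open>1 + e\<close>.\<close>

definition shell_radius :: "real \<Rightarrow> real" where "shell_radius e = (1 - e) / (1 + e)"

text \<open>Disjoint balls of radius \<open>e\<close> around points of the sphere lie in the shell
  \<open>1 - e < |x| < 1 + e\<close>, which is rescaled to the unit ball.\<close>
lemma packing_sum_le:
  fixes xs :: "'i \<Rightarrow> 'a::euclidean_space" and \<Theta> :: "'a \<Rightarrow> real"
  assumes J: "finite J" and xs: "\<And>j. j \<in> J \<Longrightarrow> norm (xs j) = 1"
    and sep: "\<And>i j. i \<in> J \<Longrightarrow> j \<in> J \<Longrightarrow> i \<noteq> j \<Longrightarrow> 2 * e \<le> dist (xs i) (xs j)"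
    and e: "0 < e" "e \<le> 1 / 2"
    and [measurable]: "\<Theta> \<in> borel_measurable borel" and \<Theta>0: "\<And>x. 0 \<le> \<Theta> x"
    and \<Theta>B: "\<And>x. norm x \<le> 2 \<Longrightarrow> \<Theta> x \<le> B"
    and a: "\<And>j. j \<in> J \<Longrightarrow> a j \<le> (\<integral>z. \<Theta> (xs j + e *\<^sub>R z) \<partial>unit_ball_measure)"
  shows "(\<Sum>j\<in>J. a j) * e ^ DIM('a) \<le> (1 + e) ^ DIM('a) *
    (\<integral>z. indicator {shell_radius e..} (norm z) * \<Theta> ((1 + e) *\<^sub>R z) \<partial>unit_ball_measure)"
proof -
  define V where "V = measure lborel (ball (0::'a) 1)"
  have V: "V > 0" unfolding V_def by (rule content_ball_pos) simp
  define Sh where "Sh = {x::'a. 1 - e \<le> norm x \<and> norm x < 1 + e}"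
  have [measurable]: "Sh \<in> sets borel" unfolding Sh_def by measurable
  have B0: "0 \<le> B" using \<Theta>0[of 0] \<Theta>B[of 0] by simp
  have int: "integrable lborel (\<lambda>x. indicator A x * \<Theta> x)" if "A \<in> sets borel" "A \<subseteq> ball 0 2" for A
  proof (rule integrable_bounded_support[of _ 2 B])
    show "(\<lambda>x. indicator A x * \<Theta> x) \<in> borel_measurable borel" using that(1) by measurable
    show "indicator A x * \<Theta> x = 0" if "2 \<le> norm x" for x using that \<open>A \<subseteq> ball 0 2\<close> by (auto simp: indicator_def)
    show "\<bar>indicator A x * \<Theta> x\<bar> \<le> B" for x
      using \<open>A \<subseteq> ball 0 2\<close> \<Theta>0[of x] \<Theta>B[of x] B0 by (auto simp: indicator_def)
  qed
  have norms: "1 - e \<le> norm x \<and> norm x < 1 + e" if "j \<in> J" "x \<in> ball (xs j) e" for j x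
  proof -
    have "norm (xs j - x) < e" using that(2) by (simp add: dist_norm)
    then show ?thesis using xs[OF that(1)] norm_triangle_ineq3[of "xs j" x] by linarith
  qed
  have "e ^ DIM('a) * V * (\<Sum>j\<in>J. a j) \<le> e ^ DIM('a) * V * (\<Sum>j\<in>J. \<integral>z. \<Theta> (xs j + e *\<^sub>R z) \<partial>unit_ball_measure)"
    using e V by (intro mult_left_mono sum_mono a) auto
  also have "\<dots> = (\<Sum>j\<in>J. \<integral>x. indicator (ball (xs j) e) x * \<Theta> x \<partial>lborel)"
    unfolding sum_distrib_left V_def using e by (intro sum.cong refl unit_ball_integral_affine) auto
  also have "\<dots> = (\<integral>x. (\<Sum>j\<in>J. indicator (ball (xs j) e) x * \<Theta> x) \<partial>lborel)"
    using norms e by (intro Bochner_Integration.integral_sum[symmetric] int) fastforce+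
  also have "\<dots> \<le> (\<integral>x. indicator Sh x * \<Theta> x \<partial>lborel)"
  proof (rule integral_mono)
    show "integrable lborel (\<lambda>x. \<Sum>j\<in>J. indicator (ball (xs j) e) x * \<Theta> x)"
      using norms e by (intro Bochner_Integration.integrable_sum int) fastforce+
    show "integrable lborel (\<lambda>x. indicator Sh x * \<Theta> x)"
      using e by (intro int) (auto simp: Sh_def)
    fix x
    \<comment> \<open>Points at distance at least \<open>2 * e\<close> have disjoint open balls of
      radius \<open>e\<close>, so at most one indicator is 1.\<close>
    have "(\<Sum>j\<in>J. indicator (ball (xs j) e) x :: real) \<le> indicator Sh x"
    proof (cases "\<exists>j\<in>J. x \<in> ball (xs j) e")
      case True
      then obtain j where j: "j \<in> J" "x \<in> ball (xs j) e" by blast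
      have "indicator (ball (xs i) e) x = (0::real)" if "i \<in> J" "i \<noteq> j" for i
      proof -
        have "dist (xs i) (xs j) \<le> dist (xs i) x + dist (xs j) x" by (rule dist_triangle2)
        then show ?thesis using sep[OF that(1) j(1) that(2)] j(2) by (auto simp: indicator_def)
      qed
      then have "(\<Sum>i\<in>J. indicator (ball (xs i) e) x :: real) = (\<Sum>i\<in>{j}. indicator (ball (xs i) e) x)"
        using J j(1) by (intro sum.mono_neutral_right) auto
      then show ?thesis using j norms[OF j] by (simp add: Sh_def indicator_def)
    next
      case False
      then have "(\<Sum>j\<in>J. indicator (ball (xs j) e) x :: real) = 0" by (intro sum.neutral) auto
      then show ?thesis by simp
    qed
    then have "(\<Sum>j\<in>J. indicator (ball (xs j) e) x) * \<Theta> x \<le> indicator Sh x * \<Theta> x"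
      by (rule mult_right_mono[OF _ \<Theta>0])
    then show "(\<Sum>j\<in>J. indicator (ball (xs j) e) x * \<Theta> x) \<le> indicator Sh x * \<Theta> x"
      by (simp add: sum_distrib_right)
  qed
  also have "\<dots> = (\<integral>x. indicator (ball 0 (1 + e)) x * (indicator Sh x * \<Theta> x) \<partial>lborel)"
    by (rule Bochner_Integration.integral_cong) (auto simp: Sh_def indicator_def)
  also have "\<dots> = (1 + e) ^ DIM('a) * V * (\<integral>z. indicator Sh (0 + (1 + e) *\<^sub>R z) * \<Theta> (0 + (1 + e) *\<^sub>R z) \<partial>unit_ball_measure)"
    unfolding V_def using e by (intro unit_ball_integral_affine[symmetric]) auto
  also have "(\<integral>z. indicator Sh (0 + (1 + e) *\<^sub>R z) * \<Theta> (0 + (1 + e) *\<^sub>R z) \<partial>unit_ball_measure)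
      = (\<integral>z. indicator {shell_radius e..} (norm z) * \<Theta> ((1 + e) *\<^sub>R z) \<partial>unit_ball_measure)"
  proof (rule integral_cong_AE)
    show "AE z in unit_ball_measure. indicator Sh (0 + (1 + e) *\<^sub>R z) * \<Theta> (0 + (1 + e) *\<^sub>R z)
        = indicator {shell_radius e..} (norm z) * \<Theta> ((1 + e) *\<^sub>R z)"
      using AE_unit_ball
    proof eventually_elim
      case (elim z)
      have "norm ((1 + e) *\<^sub>R z) = (1 + e) * norm z" using e by simp
      moreover have "(1 + e) * norm z < (1 + e) * 1"
        using e elim by (intro mult_strict_left_mono) auto
      ultimately show ?case using e elim by (auto simp: Sh_def indicator_def shell_radius_def field_simps)
    qed
  qed measurable
  finally have "V * ((\<Sum>j\<in>J. a j) * e ^ DIM('a)) \<le> V * ((1 + e) ^ DIM('a) *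
      (\<integral>z. indicator {shell_radius e..} (norm z) * \<Theta> ((1 + e) *\<^sub>R z) \<partial>unit_ball_measure))"
    by (simp add: mult_ac)
  then show ?thesis using V by simp
qed

text \<open>By Bernoulli's inequality the shell has measure at most \<open>DIM('a)\<close> times its
  thickness. The factor \<open>e\<close> later cancels one of the \<open>DIM('a) = d + 1\<close>
  powers of \<open>e\<close> from the packed balls, leaving \<open>e ^ d\<close>.\<close>

lemma shell_measure_le:
  assumes e: "0 < e" "e \<le> 1 / 2"
  shows "(\<integral>z. indicator {shell_radius e..} (norm z) \<partial>(unit_ball_measure :: 'a::euclidean_space measure))
       \<le> 2 * real DIM('a) * e"
proof -
  let ?a = "shell_radius e"
  have a: "0 \<le> ?a" "?a \<le> 1" "1 - ?a \<le> 2 * e"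
    using e by (auto simp: shell_radius_def field_simps)
  have [measurable]: "{z::'a. norm z < ?a} \<in> sets borel" by measurable
  have "(\<integral>z. indicator {?a..} (norm z) \<partial>(unit_ball_measure :: 'a measure))
      = (\<integral>z. indicator (UNIV - {z. norm z < ?a}) z \<partial>(unit_ball_measure :: 'a measure))"
    by (rule Bochner_Integration.integral_cong) (auto simp: indicator_def)
  also have "\<dots> = unit_ball.prob (UNIV - {z::'a. norm z < ?a})" by simp
  also have "\<dots> = 1 - unit_ball.prob {z::'a. norm z < ?a}"
    using unit_ball.prob_compl[of "{z::'a. norm z < ?a}"] by simp
  also have "unit_ball.prob {z::'a. norm z < ?a} = ?a ^ DIM('a)"
    using measure_unit_ball_norm_less[of "UNIV :: 'a set" ?a] a unit_ball.prob_space[where 'a = 'a] by simp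
  also have "1 - ?a ^ DIM('a) \<le> real DIM('a) * (1 - ?a)"
    using Bernoulli_inequality[of "?a - 1" "DIM('a)"] a by (simp add: algebra_simps)
  also have "\<dots> \<le> real DIM('a) * (2 * e)" using a(3) by (intro mult_left_mono) auto
  finally show ?thesis by simp
qed

lemma shell_integral_le:
  fixes \<Psi> :: "'a::euclidean_space \<Rightarrow> real"
  assumes e: "0 < e" "e \<le> 1 / 2" and c: "continuous_on (sphere 0 1) \<Psi>"
    and [measurable]: "\<Psi> \<in> borel_measurable borel" and nn: "\<And>x. 0 \<le> \<Psi> x"
  shows "(\<integral>z. indicator {shell_radius e..} (norm z) * \<Psi> (sgn ((1 + e) *\<^sub>R z)) \<partial>unit_ball_measure)
       \<le> 2 * real DIM('a) * e * (\<integral>x. \<Psi> x \<partial>sphere_measure)"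
proof -
  have s: "sgn ((1 + e) *\<^sub>R z) = sgn z" for z :: 'a using e by (simp add: sgn_scaleR)
  have "(\<integral>z. indicator {shell_radius e..} (norm z) * \<Psi> (sgn ((1 + e) *\<^sub>R z)) \<partial>unit_ball_measure)
      = (\<integral>z. indicator {shell_radius e..} (norm z) \<partial>(unit_ball_measure :: 'a measure)) * (\<integral>x. \<Psi> x \<partial>sphere_measure)"
    unfolding s by (rule polar_integral(2)[OF c, of _ 1]; (measurable)?)
  also have "\<dots> \<le> 2 * real DIM('a) * e * (\<integral>x. \<Psi> x \<partial>sphere_measure)"
    by (intro mult_right_mono shell_measure_le e integral_nonneg_AE) (auto simp: nn)
  finally show ?thesis .
qed

text \<open>Components of different degree are orthogonal on every sphere around 0, so the square
  integral over the shell is a sum over degrees. Stretching to radius \<open>1 + e\<close> costs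
  \<open>(1 + e) ^ (2 * N)\<close>, which is harmless as long as \<open>N * e\<close> is
  bounded.\<close>

theorem marcinkiewicz_zygmund:
  fixes xs :: "'i \<Rightarrow> 'a::euclidean_space" and u :: "nat \<Rightarrow> 'a \<Rightarrow> real" and N :: nat
  assumes dim: "DIM('a) \<ge> 2" and u: "\<And>l. u l \<in> harm l"
    and J: "finite J" and xs: "\<And>j. j \<in> J \<Longrightarrow> norm (xs j) = 1"
    and sep: "\<And>i j. i \<in> J \<Longrightarrow> j \<in> J \<Longrightarrow> i \<noteq> j \<Longrightarrow> 2 * e \<le> dist (xs i) (xs j)"
    and e: "0 < e" "e \<le> 1 / 2"
  defines "U \<equiv> \<lambda>x. \<Sum>l\<le>N. u l x"
  shows "(\<Sum>j\<in>J. (U (xs j))\<^sup>2) * e ^ DIM('a)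
       \<le> (1 + e) ^ DIM('a) * (2 * real DIM('a) * e) * (1 + e) ^ (2 * N) * (\<integral>x. (U x)\<^sup>2 \<partial>sphere_measure)"
proof -
  let ?i = "\<lambda>z::'a. indicator {shell_radius e..} (norm z) :: real"
  have ru: "real_polynomial_function (u l)" for l using u[of l] by auto
  have rU: "real_polynomial_function U"
    unfolding U_def by (intro real_polynomial_function_sum ru) auto
  have lapU: "laplacian U x = 0" for x
    unfolding U_def using u by (subst laplacian_sum) (auto simp: harm_def)
  have cU: "continuous_on A U" for A by (rule rpf_continuous_on[OF rU])
  have [measurable]: "U \<in> borel_measurable borel" by (rule rpf_measurable[OF rU])
  obtain B where B: "\<And>x. norm x \<le> 2 \<Longrightarrow> (U x)\<^sup>2 \<le> B"
  proof -
    have "bounded ((\<lambda>x. (U x)\<^sup>2) ` cball 0 2)"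
      by (intro compact_imp_bounded compact_continuous_image compact_cball continuous_intros cU)
    then obtain K where "\<forall>x\<in>cball 0 2. norm ((U x)\<^sup>2) \<le> K" by (auto simp: bounded_iff)
    then show ?thesis by (intro that[of K]) auto
  qed
  have uu: "(\<lambda>x. u l x * u j x) \<in> hpoly (l + j)" for l j
    using u by (intro hpoly_mult) auto
  have L: "(\<integral>x. u l x * u j x \<partial>sphere_measure) = (if l = j then \<integral>x. (u l x)\<^sup>2 \<partial>sphere_measure else 0)" for l j
    using harm_orthogonal[OF dim u u, of l j] by (auto simp: power2_eq_square)
  define E where "E l = (\<integral>z. ?i z * norm z ^ (l + l) \<partial>(unit_ball_measure :: 'a measure))" for l
  have bnd: "\<bar>indicator {shell_radius e..} t :: real\<bar> \<le> 1" for t by (auto simp: indicator_def)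
  have ii: "integrable unit_ball_measure (\<lambda>z. ?i z * (u l z * u j z))"
    "(\<integral>z. ?i z * (u l z * u j z) \<partial>unit_ball_measure) = (if l = j then E l * (\<integral>x. (u l x)\<^sup>2 \<partial>sphere_measure) else 0)" for l j
    using hpoly_ball_integral[OF uu, of "indicator {shell_radius e..}" 1 l j] bnd L by (auto simp: E_def)
  have El: "E l \<le> 2 * real DIM('a) * e" for l
  proof -
    have "E l \<le> (\<integral>z. ?i z \<partial>(unit_ball_measure :: 'a measure))"
      unfolding E_def
    proof (rule integral_mono_AE)
      show "integrable (unit_ball_measure :: 'a measure) (\<lambda>z. ?i z * norm z ^ (l + l))"
        by (rule unit_ball.integrable_const_bound[of _ 1]; (measurable)?)
           (rule AE_mp[OF AE_unit_ball], auto simp: indicator_def power_le_one)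
      show "integrable (unit_ball_measure :: 'a measure) ?i"
        by (rule unit_ball.integrable_const_bound[of _ 1]; (measurable)?)
      show "AE z in (unit_ball_measure :: 'a measure). ?i z * norm z ^ (l + l) \<le> ?i z"
        by (rule AE_mp[OF AE_unit_ball]) (auto simp: indicator_def power_le_one)
    qed
    with shell_measure_le[OF e, where 'a = 'a] show ?thesis by linarith
  qed
  have U2: "(\<integral>x. (U x)\<^sup>2 \<partial>sphere_measure) = (\<Sum>l\<le>N. \<integral>x. (u l x)\<^sup>2 \<partial>sphere_measure)"
  proof -
    have "(\<integral>x. (U x)\<^sup>2 \<partial>sphere_measure) = (\<integral>x. (\<Sum>l\<le>N. \<Sum>j\<le>N. u l x * u j x) \<partial>sphere_measure)"
      by (simp add: U_def power2_eq_square sum_product)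
    also have "\<dots> = (\<Sum>l\<le>N. \<Sum>j\<le>N. \<integral>x. u l x * u j x \<partial>sphere_measure)"
      by (subst Bochner_Integration.integral_sum; (subst Bochner_Integration.integral_sum)?;
          auto intro!: integrable_sphere continuous_intros rpf_continuous_on ru)
    also have "\<dots> = (\<Sum>l\<le>N. \<integral>x. (u l x)\<^sup>2 \<partial>sphere_measure)"
      by (simp add: L sum.delta' if_distrib cong: if_cong)
    finally show ?thesis .
  qed
  have shell: "(\<integral>z. ?i z * (U ((1 + e) *\<^sub>R z))\<^sup>2 \<partial>unit_ball_measure)
      \<le> 2 * real DIM('a) * e * (1 + e) ^ (2 * N) * (\<integral>x. (U x)\<^sup>2 \<partial>sphere_measure)"
  proof -
    have "?i z * (U ((1 + e) *\<^sub>R z))\<^sup>2 = (\<Sum>l\<le>N. \<Sum>j\<le>N. (1 + e) ^ (l + j) * (?i z * (u l z * u j z)))" for z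
    proof -
      have "U ((1 + e) *\<^sub>R z) = (\<Sum>l\<le>N. (1 + e) ^ l * u l z)"
        unfolding U_def using hpoly_scale[OF harm_hpoly[OF u]] by simp
      then show ?thesis
        by (simp add: power2_eq_square sum_product sum_distrib_left power_add mult_ac)
    qed
    then have "(\<integral>z. ?i z * (U ((1 + e) *\<^sub>R z))\<^sup>2 \<partial>unit_ball_measure)
        = (\<integral>z. (\<Sum>l\<le>N. \<Sum>j\<le>N. (1 + e) ^ (l + j) * (?i z * (u l z * u j z))) \<partial>unit_ball_measure)"
      by simp
    also have "\<dots> = (\<Sum>l\<le>N. \<Sum>j\<le>N. (1 + e) ^ (l + j) * (\<integral>z. ?i z * (u l z * u j z) \<partial>unit_ball_measure))"
      by (subst Bochner_Integration.integral_sum; (subst Bochner_Integration.integral_sum)?;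
          auto intro!: Bochner_Integration.integrable_sum integrable_mult_right ii(1))
    also have "\<dots> = (\<Sum>l\<le>N. (1 + e) ^ (l + l) * (E l * (\<integral>x. (u l x)\<^sup>2 \<partial>sphere_measure)))"
      by (simp add: ii(2) sum.delta' if_distrib cong: if_cong)
    also have "\<dots> \<le> (\<Sum>l\<le>N. (1 + e) ^ (2 * N) * (2 * real DIM('a) * e * (\<integral>x. (u l x)\<^sup>2 \<partial>sphere_measure)))"
    proof (rule sum_mono)
      fix l assume "l \<in> {..N}"
      then have "(1 + e) ^ (l + l) \<le> (1 + e) ^ (2 * N)" using e by (intro power_increasing) auto
      moreover have sq0: "0 \<le> (\<integral>x. (u l x)\<^sup>2 \<partial>sphere_measure)" by (rule integral_nonneg_AE) simp
      moreover have "0 \<le> E l" unfolding E_def by (rule integral_nonneg_AE) simp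
      ultimately show "(1 + e) ^ (l + l) * (E l * (\<integral>x. (u l x)\<^sup>2 \<partial>sphere_measure))
          \<le> (1 + e) ^ (2 * N) * (2 * real DIM('a) * e * (\<integral>x. (u l x)\<^sup>2 \<partial>sphere_measure))"
        using e El[of l] by (intro mult_mono mult_right_mono mult_nonneg_nonneg) auto
    qed
    also have "\<dots> = 2 * real DIM('a) * e * (1 + e) ^ (2 * N) * (\<integral>x. (U x)\<^sup>2 \<partial>sphere_measure)"
      unfolding U2 by (simp add: sum_distrib_left mult_ac)
    finally show ?thesis .
  qed
  have "(\<Sum>j\<in>J. (U (xs j))\<^sup>2) * e ^ DIM('a) \<le> (1 + e) ^ DIM('a) *
      (\<integral>z. ?i z * (U ((1 + e) *\<^sub>R z))\<^sup>2 \<partial>unit_ball_measure)"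
    by (rule packing_sum_le[OF J xs sep e _ _ B harmonic_square_mean_value[OF rU lapU dim]]) auto
  also have "\<dots> \<le> (1 + e) ^ DIM('a) * (2 * real DIM('a) * e * (1 + e) ^ (2 * N) * (\<integral>x. (U x)\<^sup>2 \<partial>sphere_measure))"
    using e by (intro mult_left_mono shell) auto
  finally show ?thesis by (simp add: mult_ac)
qed

section \<open>Localization of the filtered kernel\<close>

text \<open>All differences of order at most \<open>j\<close>, scaled by \<open>\<eta>\<close> once
  per order, are bounded by \<open>C\<close>. For \<open>\<eta> = n\<close> and samples at the
  points \<open>l / n\<close> this is the discrete form of bounded derivatives.\<close>

primrec bounded_diffs :: "real \<Rightarrow> nat \<Rightarrow> real \<Rightarrow> (nat \<Rightarrow> real) \<Rightarrow> bool" where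
  "bounded_diffs \<eta> 0 C g \<longleftrightarrow> (\<forall>i. \<bar>g i\<bar> \<le> C)"
| "bounded_diffs \<eta> (Suc j) C g \<longleftrightarrow>
     (\<forall>i. \<bar>g i\<bar> \<le> C) \<and> bounded_diffs \<eta> j C (\<lambda>i. \<eta> * (g (Suc i) - g i))"

lemma bounded_diffs_bound: "bounded_diffs \<eta> j C g \<Longrightarrow> \<bar>g i\<bar> \<le> C"
  by (cases j) auto

lemma bounded_diffs_mono: "bounded_diffs \<eta> j C g \<Longrightarrow> C \<le> C' \<Longrightarrow> bounded_diffs \<eta> j C' g"
  by (induction j arbitrary: g) (auto intro: order_trans)

lemma bounded_diffs_Suc_D: "bounded_diffs \<eta> (Suc j) C g \<Longrightarrow> bounded_diffs \<eta> j C g"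
proof (induction j arbitrary: g)
  case (Suc j)
  then have "bounded_diffs \<eta> (Suc j) C (\<lambda>i. \<eta> * (g (Suc i) - g i))"
    by (simp only: bounded_diffs.simps(2)[of \<eta> "Suc j" C g])
  from Suc.IH[OF this] Suc.prems show ?case by (simp only: bounded_diffs.simps simp_thms)
qed simp

lemma bounded_diffs_shift: "bounded_diffs \<eta> j C g \<Longrightarrow> bounded_diffs \<eta> j C (\<lambda>i. g (Suc i))"
  by (induction j arbitrary: g) auto

lemma bounded_diffs_add:
  "bounded_diffs \<eta> j C f \<Longrightarrow> bounded_diffs \<eta> j D g \<Longrightarrow> bounded_diffs \<eta> j (C + D) (\<lambda>i. f i + g i)"
proof (induction j arbitrary: f g)
  case 0
  then show ?case by (auto intro: order_trans[OF abs_triangle_ineq add_mono])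
next
  case (Suc j)
  have "(\<lambda>i. \<eta> * (f (Suc i) + g (Suc i) - (f i + g i)))
      = (\<lambda>i. \<eta> * (f (Suc i) - f i) + \<eta> * (g (Suc i) - g i))" by (simp add: algebra_simps)
  with Suc show ?case by (auto intro: order_trans[OF abs_triangle_ineq add_mono])
qed

lemma bounded_diffs_cmult:
  "bounded_diffs \<eta> j C f \<Longrightarrow> bounded_diffs \<eta> j (\<bar>a\<bar> * C) (\<lambda>i. a * f i)"
proof (induction j arbitrary: f)
  case 0
  then show ?case by (auto simp: abs_mult intro: mult_left_mono)
next
  case (Suc j)
  have "(\<lambda>i. \<eta> * (a * f (Suc i) - a * f i)) = (\<lambda>i. a * (\<eta> * (f (Suc i) - f i)))"
    by (simp add: algebra_simps)
  with Suc show ?case by (auto simp: abs_mult intro: mult_left_mono)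
qed

text \<open>The Leibniz rule; every order doubles the number of terms.\<close>

lemma bounded_diffs_mult:
  "bounded_diffs \<eta> j C f \<Longrightarrow> bounded_diffs \<eta> j D g \<Longrightarrow> bounded_diffs \<eta> j (2 ^ j * (C * D)) (\<lambda>i. f i * g i)"
proof (induction j arbitrary: f g)
  case 0
  then show ?case
    by (auto simp: abs_mult intro!: mult_mono intro: order_trans[OF abs_ge_zero])
next
  case (Suc j)
  have C: "0 \<le> C" "0 \<le> D" using Suc.prems by (auto intro: order_trans[OF abs_ge_zero])
  have eq: "(\<lambda>i. \<eta> * (f (Suc i) * g (Suc i) - f i * g i))
      = (\<lambda>i. f (Suc i) * (\<eta> * (g (Suc i) - g i)) + \<eta> * (f (Suc i) - f i) * g i)"
    by (simp add: algebra_simps)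
  have "bounded_diffs \<eta> j (2 ^ j * (C * D)) (\<lambda>i. f (Suc i) * (\<eta> * (g (Suc i) - g i)))"
    using Suc.prems by (intro Suc.IH bounded_diffs_shift) (auto intro: bounded_diffs_Suc_D)
  moreover have "bounded_diffs \<eta> j (2 ^ j * (C * D)) (\<lambda>i. \<eta> * (f (Suc i) - f i) * g i)"
    using Suc.prems by (intro Suc.IH) (auto intro: bounded_diffs_Suc_D)
  ultimately have "bounded_diffs \<eta> j (2 ^ j * (C * D) + 2 ^ j * (C * D)) (\<lambda>i. \<eta> * (f (Suc i) * g (Suc i) - f i * g i))"
    unfolding eq by (rule bounded_diffs_add)
  moreover have "\<bar>f i * g i\<bar> \<le> 2 ^ Suc j * (C * D)" for i
  proof -
    have "\<bar>f i * g i\<bar> \<le> C * D"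
      using Suc.prems C by (auto simp: abs_mult intro!: mult_mono)
    also have "\<dots> \<le> 2 ^ Suc j * (C * D)"
    proof -
      have "1 * (C * D) \<le> 2 ^ Suc j * (C * D)"
        using C one_le_power[of "2::real" "Suc j"] by (intro mult_right_mono mult_nonneg_nonneg) auto
      then show ?thesis by simp
    qed
    finally show ?thesis .
  qed
  moreover have "2 ^ j * (C * D) + 2 ^ j * (C * D) = 2 ^ Suc j * (C * D)" by simp
  ultimately show ?case by (simp only: bounded_diffs.simps) blast
qed

text \<open>The sequence \<open>c i = \<eta> / (a + 2 * real i)\<close> satisfies
  \<open>\<eta> * (c (Suc i) - c i) = - 2 * (c i * c (Suc i))\<close>, so the product rule carries
  the induction. The condition \<open>\<eta> \<le> a\<close> gives \<open>c i \<le> 1\<close>, which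
  makes \<open>K\<close> uniform.\<close>

lemma bounded_diffs_reciprocal:
  "\<exists>K\<ge>0. \<forall>\<eta> a. 0 < \<eta> \<longrightarrow> \<eta> \<le> a \<longrightarrow> bounded_diffs \<eta> j K (\<lambda>i. \<eta> / (a + 2 * real i))"
proof (induction j)
  case 0
  show ?case by (intro exI[of _ 1]) (auto simp: abs_div_pos divide_le_eq_1)
next
  case (Suc j)
  then obtain K where K: "K \<ge> 0"
    "\<And>\<eta> a. 0 < \<eta> \<Longrightarrow> \<eta> \<le> a \<Longrightarrow> bounded_diffs \<eta> j K (\<lambda>i. \<eta> / (a + 2 * real i))" by blast
  define K' where "K' = K + 2 * (2 ^ j * (K * K))"
  have "bounded_diffs \<eta> (Suc j) K' (\<lambda>i. \<eta> / (a + 2 * real i))" if "0 < \<eta>" "\<eta> \<le> a" for \<eta> a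
  proof -
    define c where "c i = \<eta> / (a + 2 * real i)" for i
    have c: "bounded_diffs \<eta> j K c" unfolding c_def[abs_def] by (rule K(2)[OF that])
    have "bounded_diffs \<eta> j (\<bar>- 2\<bar> * (2 ^ j * (K * K))) (\<lambda>i. - 2 * (c i * c (Suc i)))"
      by (intro bounded_diffs_cmult bounded_diffs_mult c bounded_diffs_shift)
    moreover have "(\<lambda>i. - 2 * (c i * c (Suc i))) = (\<lambda>i. \<eta> * (c (Suc i) - c i))"
    proof
      fix i
      have "a + 2 * real i > 0" "a + 2 * real i + 2 > 0" using that by auto
      then show "- 2 * (c i * c (Suc i)) = \<eta> * (c (Suc i) - c i)"
        by (simp add: c_def divide_simps) (simp add: algebra_simps)
    qed
    ultimately have "bounded_diffs \<eta> j (2 * (2 ^ j * (K * K))) (\<lambda>i. \<eta> * (c (Suc i) - c i))" by simp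
    then have "bounded_diffs \<eta> j K' (\<lambda>i. \<eta> * (c (Suc i) - c i))"
      by (rule bounded_diffs_mono) (simp add: K'_def K(1))
    moreover have "\<bar>c i\<bar> \<le> K'" for i
      using bounded_diffs_bound[OF c, of i] K(1) by (simp add: K'_def add_increasing2)
    ultimately show ?thesis by (simp add: c_def)
  qed
  moreover have "K' \<ge> 0" using K(1) by (simp add: K'_def)
  ultimately show ?case by blast
qed

lemma DERIV_within_atLeast_imp_at:
  fixes f :: "real \<Rightarrow> real"
  assumes "(f has_real_derivative f') (at t within {0..})" "t > 0"
  shows "(f has_real_derivative f') (at t)"
proof -
  have "(f has_real_derivative f') (at t within {0<..})"
    using assms(1) by (rule DERIV_subset) auto
  then show ?thesis using assms(2) by (simp add: at_within_open[of t "{0<..}"])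
qed

text \<open>The difference quotients \<open>E i\<close> of \<open>D i\<close> over a step
  \<open>1 / \<eta>\<close> form again a chain of derivatives, bounded by the mean value theorem.
  The induction therefore replaces \<open>D\<close> by \<open>E\<close>.\<close>

lemma bounded_diffs_smooth:
  fixes D :: "nat \<Rightarrow> real \<Rightarrow> real"
  assumes \<eta>: "\<eta> > 0" and t0: "t0 \<ge> 0"
  shows "(\<And>i t. i < j \<Longrightarrow> t \<ge> 0 \<Longrightarrow> (D i has_real_derivative D (Suc i) t) (at t within {0..})) \<Longrightarrow>
    (\<And>i t. i \<le> j \<Longrightarrow> t \<ge> 0 \<Longrightarrow> \<bar>D i t\<bar> \<le> C) \<Longrightarrow>
    bounded_diffs \<eta> j C (\<lambda>i. D 0 (t0 + real i / \<eta>))"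
proof (induction j arbitrary: D)
  case 0
  then show ?case using \<eta> t0 by simp
next
  case (Suc j D)
  define E where "E i t = \<eta> * (D i (t + 1 / \<eta>) - D i t)" for i t
  have at: "(D i has_real_derivative D (Suc i) t) (at t)" if "i < Suc j" "t > 0" for i t
    using Suc.prems(1)[OF that(1), of t] that(2) by (intro DERIV_within_atLeast_imp_at) auto
  have "bounded_diffs \<eta> j C (\<lambda>i. E 0 (t0 + real i / \<eta>))"
  proof (rule Suc.IH)
    fix i t assume i: "i < j" and t: "t \<ge> (0::real)"
    have "((\<lambda>t. D i (t + 1 / \<eta>)) has_real_derivative D (Suc i) (t + 1 / \<eta>)) (at t)"
      using at[of i "t + 1 / \<eta>"] i t \<eta> by (simp add: DERIV_shift add_nonneg_pos)
    then have "((\<lambda>t. D i (t + 1 / \<eta>)) has_real_derivative D (Suc i) (t + 1 / \<eta>)) (at t within {0..})"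
      by (rule has_field_derivative_at_within)
    then show "(E i has_real_derivative E (Suc i) t) (at t within {0..})"
      unfolding E_def[abs_def] using Suc.prems(1)[of i t] i t
      by (auto intro!: DERIV_cmult DERIV_diff)
  next
    fix i t assume i: "i \<le> j" and t: "t \<ge> (0::real)"
    have "continuous_on {0..} (D i)"
      using Suc.prems(1)[of i] i by (intro DERIV_continuous_on) auto
    then have "continuous_on {t..t + 1 / \<eta>} (D i)" by (rule continuous_on_subset) (use t in auto)
    moreover have "t < t + 1 / \<eta>" using \<eta> by simp
    moreover have "(D i has_real_derivative D (Suc i) x) (at x)" if "t < x" "x < t + 1 / \<eta>" for x
      using at[of i x] i t that by simp
    ultimately obtain z where z: "t < z" "D i (t + 1 / \<eta>) - D i t = (t + 1 / \<eta> - t) * D (Suc i) z"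
      using MVT[of t "t + 1 / \<eta>" "D i"] by (metis DERIV_unique real_differentiable_def)
    then have "E i t = D (Suc i) z" using \<eta> by (simp add: E_def)
    then show "\<bar>E i t\<bar> \<le> C" using Suc.prems(2)[of "Suc i" z] i t z(1) by simp
  qed
  moreover have "(\<lambda>i. \<eta> * (D 0 (t0 + real (Suc i) / \<eta>) - D 0 (t0 + real i / \<eta>))) = (\<lambda>i. E 0 (t0 + real i / \<eta>))"
    by (simp add: E_def add_divide_distrib algebra_simps)
  moreover have "\<bar>D 0 (t0 + real i / \<eta>)\<bar> \<le> C" for i using Suc.prems(2)[of 0] \<eta> t0 by simp
  ultimately show ?case by simp
qed

text \<open>The derivatives vanish beyond 2 together with \<open>h\<close>, and on the compact rest
  they are continuous.\<close>

lemma C_class_derivatives: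
  assumes h: "C_class \<kappa> h" and h2: "\<forall>t\<ge>2. h t = 0" and j: "real j \<le> \<kappa>"
  obtains D C where "C \<ge> 1" and "\<And>t. t \<ge> 0 \<Longrightarrow> D 0 t = h t"
    and "\<And>i t. i < j \<Longrightarrow> t \<ge> 0 \<Longrightarrow> (D i has_real_derivative D (Suc i) t) (at t within {0..})"
    and "\<And>i t. i \<le> j \<Longrightarrow> t \<ge> 0 \<Longrightarrow> \<bar>D i t\<bar> \<le> C"
proof -
  let ?K = "nat \<lfloor>\<kappa>\<rfloor>"
  obtain D :: "nat \<Rightarrow> real \<Rightarrow> real" where D0: "\<And>t. t \<ge> 0 \<Longrightarrow> D 0 t = h t"
    and D: "\<And>i t. i < ?K \<Longrightarrow> t \<ge> 0 \<Longrightarrow> (D i has_real_derivative D (Suc i) t) (at t within {0..})"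
    and Dc: "continuous_on {0..} (D ?K)"
    using h unfolding C_class_def by blast
  have jK: "j \<le> ?K" using j by linarith
  have cont: "continuous_on {0..} (D i)" if "i \<le> j" for i
  proof (cases "i = ?K")
    case True with Dc show ?thesis by simp
  next
    case False
    with that jK have "i < ?K" by simp
    then show ?thesis using D by (intro DERIV_continuous_on) auto
  qed
  have zero: "D i t = 0" if "i \<le> j" "t > 2" for i t
    using that
  proof (induction i arbitrary: t)
    case 0
    then show ?case using D0[of t] h2 by simp
  next
    case (Suc i)
    have "(D i has_real_derivative D (Suc i) t) (at t within {0..})"
      using Suc.prems jK by (intro D) auto
    then have "(D i has_real_derivative D (Suc i) t) (at t)"
      by (rule DERIV_within_atLeast_imp_at) (use Suc.prems in simp)
    moreover have "(D i has_real_derivative 0) (at t)"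
    proof (rule has_field_derivative_transform_within_open[of "\<lambda>_. 0" _ _ "{2<..}"])
      show "0 = D i x" if "x \<in> {2<..}" for x using Suc.IH[of x] Suc.prems that by simp
    qed (use Suc.prems in auto)
    ultimately show ?case by (rule DERIV_unique)
  qed
  have "\<exists>C. \<forall>t\<ge>0. \<bar>D i t\<bar> \<le> C" if i: "i \<le> j" for i
  proof -
    have "bounded (D i ` {0..2})"
      using continuous_on_subset[OF cont[OF i], of "{0..2}"]
      by (intro compact_imp_bounded compact_continuous_image) auto
    then obtain C where C: "\<forall>y\<in>D i ` {0..2}. norm y \<le> C" unfolding bounded_iff by blast
    have "\<bar>D i t\<bar> \<le> max C 0" if "t \<ge> 0" for t
    proof (cases "t \<le> 2")
      case True
      then have "norm (D i t) \<le> C" using C that by simp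
      then show ?thesis by simp
    next
      case False
      then show ?thesis using zero[OF i, of t] by simp
    qed
    then show ?thesis by blast
  qed
  then obtain c where c: "\<And>i t. i \<le> j \<Longrightarrow> t \<ge> 0 \<Longrightarrow> \<bar>D i t\<bar> \<le> c i" by metis
  define C where "C = 1 + (\<Sum>i\<le>j. \<bar>c i\<bar>)"
  have "\<bar>D i t\<bar> \<le> C" if "i \<le> j" "t \<ge> 0" for i t
  proof -
    have "\<bar>c i\<bar> \<le> (\<Sum>i\<le>j. \<bar>c i\<bar>)" using that by (intro member_le_sum) auto
    then show ?thesis using c[OF that] by (simp add: C_def)
  qed
  moreover have "C \<ge> 1" by (simp add: C_def sum_nonneg)
  ultimately show ?thesis using D0 D jK by (intro that[of C D]) auto
qed

section \<open>Multiplication by \<open>1 - x \<bullet> y\<close> on the side of the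
  coefficients\<close>

context sphere_basis
begin

text \<open>Multiplication of a zonal expansion by \<open>1 - x \<bullet> y\<close> acts on its coefficients as \<open>radial_diff\<close>,
  a second-order difference operator.\<close>
definition radial_diff :: "(nat \<Rightarrow> real) \<Rightarrow> nat \<Rightarrow> real" where
  "radial_diff c l = upper l * (c l - c (Suc l)) + lower l * (c l - c (l - 1))"

text \<open>The action on coefficients of multiplication by
  \<open>1 + n\<^sup>2 * (1 - x \<bullet> y)\<close>, which is of order 1 for points at distance up
  to \<open>1 / n\<close> and grows beyond.\<close>

definition localizer :: "nat \<Rightarrow> (nat \<Rightarrow> real) \<Rightarrow> nat \<Rightarrow> real" where
  "localizer n c l = c l + (real n)\<^sup>2 * radial_diff c l"

lemma lower_0 [simp]: "lower 0 = 0" by (simp add: lower_def)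

lemma lower_bounds: "0 \<le> lower l" "lower l \<le> 1"
proof -
  show "0 \<le> lower l" unfolding lower_def using d1 by simp
  show "lower l \<le> 1"
  proof (cases l)
    case (Suc i)
    then show ?thesis unfolding lower_def using d1 by (simp add: field_simps)
  qed simp
qed

lemma zonal_radial_diff:
  assumes c: "\<And>l. l > L \<Longrightarrow> c l = 0" and x: "x \<in> S" and y: "y \<in> S"
  shows "(1 - x \<bullet> y) * (\<Sum>l\<le>L. c l * zonal l x y) = (\<Sum>l\<le>Suc L. radial_diff c l * zonal l x y)"
proof -
  have "(x \<bullet> y) * (\<Sum>l\<le>L. c l * zonal l x y)
      = (\<Sum>l\<le>L. c l * (lower (Suc l) * zonal (Suc l) x y))
      + (\<Sum>l\<le>L. c l * (if l = 0 then 0 else upper (l - 1) * zonal (l - 1) x y))"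
    unfolding sum.distrib[symmetric] sum_distrib_left
    by (intro sum.cong refl) (metis (no_types) zonal_recurrence[OF x y] distrib_left mult.left_commute)
  \<comment> \<open>The shifted sum has no term at 0; adding one is harmless because
    \<open>lower 0 = 0\<close>.\<close>
  also have "(\<Sum>l\<le>L. c l * (lower (Suc l) * zonal (Suc l) x y)) = (\<Sum>l\<le>Suc L. lower l * c (l - 1) * zonal l x y)"
    by (simp only: sum.atMost_Suc_shift) (simp add: mult_ac)
  also have "(\<Sum>l\<le>L. c l * (if l = 0 then 0 else upper (l - 1) * zonal (l - 1) x y))
      = (\<Sum>l\<le>Suc (Suc L). c l * (if l = 0 then 0 else upper (l - 1) * zonal (l - 1) x y))"
    by (simp add: c)
  also have "\<dots> = (\<Sum>l\<le>Suc L. upper l * c (Suc l) * zonal l x y)"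
    by (simp only: sum.atMost_Suc_shift[of _ "Suc L"]) (simp add: mult_ac)
  finally have 1: "(x \<bullet> y) * (\<Sum>l\<le>L. c l * zonal l x y)
      = (\<Sum>l\<le>Suc L. lower l * c (l - 1) * zonal l x y) + (\<Sum>l\<le>Suc L. upper l * c (Suc l) * zonal l x y)" .
  have 2: "(\<Sum>l\<le>L. c l * zonal l x y) = (\<Sum>l\<le>Suc L. (upper l + lower l) * c l * zonal l x y)"
    by (simp add: c upper_def)
  have "(1 - x \<bullet> y) * (\<Sum>l\<le>L. c l * zonal l x y)
      = (\<Sum>l\<le>L. c l * zonal l x y) - (x \<bullet> y) * (\<Sum>l\<le>L. c l * zonal l x y)"
    by (simp add: algebra_simps)
  also have "\<dots> = (\<Sum>l\<le>Suc L. radial_diff c l * zonal l x y)"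
    unfolding 1 unfolding 2 sum.distrib[symmetric] sum_subtractf[symmetric]
    by (intro sum.cong refl) (simp add: radial_diff_def algebra_simps)
  finally show ?thesis .
qed

lemma radial_diff_support:
  "(\<And>l. l > L \<Longrightarrow> c l = 0) \<Longrightarrow> l > Suc L \<Longrightarrow> radial_diff c l = 0"
  by (simp add: radial_diff_def)

lemma zonal_localizer:
  assumes c: "\<And>l. l > L \<Longrightarrow> c l = 0" and x: "x \<in> S" and y: "y \<in> S"
  shows "(1 + (real n)\<^sup>2 * (1 - x \<bullet> y)) ^ k * (\<Sum>l\<le>L. c l * zonal l x y)
       = (\<Sum>l\<le>L + k. (localizer n ^^ k) c l * zonal l x y)"
    and "l > L + k \<Longrightarrow> (localizer n ^^ k) c l = 0"
proof -
  have "(1 + (real n)\<^sup>2 * (1 - x \<bullet> y)) ^ k * (\<Sum>l\<le>L. c l * zonal l x y)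
       = (\<Sum>l\<le>L + k. (localizer n ^^ k) c l * zonal l x y) \<and> (\<forall>l>L + k. (localizer n ^^ k) c l = 0)"
  proof (induction k)
    case 0 then show ?case using c by simp
  next
    case (Suc k)
    define b where "b = (localizer n ^^ k) c"
    have b: "\<And>l. l > L + k \<Longrightarrow> b l = 0" using Suc.IH by (simp add: b_def)
    have "(1 + (real n)\<^sup>2 * (1 - x \<bullet> y)) ^ Suc k * (\<Sum>l\<le>L. c l * zonal l x y)
        = (\<Sum>l\<le>L + k. b l * zonal l x y) + (real n)\<^sup>2 * ((1 - x \<bullet> y) * (\<Sum>l\<le>L + k. b l * zonal l x y))"
      using Suc.IH by (simp add: b_def algebra_simps)
    also have "\<dots> = (\<Sum>l\<le>Suc (L + k). localizer n b l * zonal l x y)"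
    proof -
      have z: "(1 - x \<bullet> y) * (\<Sum>l\<le>L + k. b l * zonal l x y)
          = (\<Sum>l\<le>Suc (L + k). radial_diff b l * zonal l x y)"
        by (rule zonal_radial_diff[OF _ x y]) (rule b)
      have "(\<Sum>l\<le>L + k. b l * zonal l x y) = (\<Sum>l\<le>Suc (L + k). b l * zonal l x y)" by (simp add: b)
      then have "(\<Sum>l\<le>L + k. b l * zonal l x y) + (real n)\<^sup>2 * ((1 - x \<bullet> y) * (\<Sum>l\<le>L + k. b l * zonal l x y))
          = (\<Sum>l\<le>Suc (L + k). b l * zonal l x y)
          + (real n)\<^sup>2 * (\<Sum>l\<le>Suc (L + k). radial_diff b l * zonal l x y)"
        unfolding z by (simp only:)
      also have "\<dots> = (\<Sum>l\<le>Suc (L + k). localizer n b l * zonal l x y)"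
        unfolding sum_distrib_left sum.distrib[symmetric]
        by (intro sum.cong refl) (simp add: localizer_def algebra_simps)
      finally show ?thesis .
    qed
    finally have "(1 + (real n)\<^sup>2 * (1 - x \<bullet> y)) ^ Suc k * (\<Sum>l\<le>L. c l * zonal l x y)
        = (\<Sum>l\<le>L + Suc k. (localizer n ^^ Suc k) c l * zonal l x y)" by (simp add: b_def)
    moreover have "(localizer n ^^ Suc k) c l = 0" if "l > L + Suc k" for l
      using that b radial_diff_support[of "L + k" b l] by (simp add: localizer_def b_def[symmetric])
    ultimately show ?case by blast
  qed
  then show "(1 + (real n)\<^sup>2 * (1 - x \<bullet> y)) ^ k * (\<Sum>l\<le>L. c l * zonal l x y)
       = (\<Sum>l\<le>L + k. (localizer n ^^ k) c l * zonal l x y)"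
    and "l > L + k \<Longrightarrow> (localizer n ^^ k) c l = 0" by blast+
qed

text \<open>Up to constants, \<open>n\<^sup>2 * radial_diff c\<close> is a scaled second difference
  plus scaled first differences times \<open>n / (2 * l + d - 1)\<close>. Two orders are spent, and
  \<open>n \<le> 2 * l0 + 2\<close> keeps the last factor bounded. The start moves to
  \<open>Suc l0\<close> because \<open>radial_diff\<close> looks one index back.\<close>

lemma localizer_bounded_diffs:
  "\<exists>K\<ge>0. \<forall>n l0 c C. n \<ge> 1 \<longrightarrow> n \<le> 2 * l0 + 2 \<longrightarrow> bounded_diffs (real n) (j + 2) C (\<lambda>i. c (l0 + i))
     \<longrightarrow> bounded_diffs (real n) j (K * C) (\<lambda>i. localizer n c (Suc l0 + i))"
proof -
  obtain K where K: "K \<ge> 0"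
    "\<And>\<eta> a. 0 < \<eta> \<Longrightarrow> \<eta> \<le> a \<Longrightarrow> bounded_diffs \<eta> j K (\<lambda>i. \<eta> / (a + 2 * real i))"
    using bounded_diffs_reciprocal[of j] by blast
  define K' where "K' = 1 + (1 / 2 + (real d - 1) / 2 * (2 ^ j * (K * 2)))"
  have "bounded_diffs (real n) j (K' * C) (\<lambda>i. localizer n c (Suc l0 + i))"
    if n: "n \<ge> 1" "n \<le> 2 * l0 + 2" and c: "bounded_diffs (real n) (j + 2) C (\<lambda>i. c (l0 + i))" for n l0 c C
  proof -
    define \<eta> where "\<eta> = real n"
    define g where "g i = c (l0 + i)" for i
    define dg where "dg i = \<eta> * (g (Suc i) - g i)" for i
    define ddg where "ddg i = \<eta> * (dg (Suc i) - dg i)" for i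
    define a where "a = 2 * real (Suc l0) + real d - 1"
    have a: "0 < \<eta>" "\<eta> \<le> a"
    proof -
      show "0 < \<eta>" using n by (simp add: \<eta>_def)
      have "real n \<le> real (2 * l0 + 2)" using n(2) by (rule of_nat_mono)
      then show "\<eta> \<le> a" using d1 by (simp add: a_def \<eta>_def)
    qed
    have g: "bounded_diffs \<eta> (Suc (Suc j)) C g" using c by (simp add: g_def[abs_def] \<eta>_def)
    then have dg: "bounded_diffs \<eta> (Suc j) C dg" by (simp add: dg_def[abs_def])
    then have ddg: "bounded_diffs \<eta> j C ddg" by (simp add: ddg_def[abs_def])
    note g' = bounded_diffs_Suc_D[OF bounded_diffs_Suc_D[OF g]] and dg' = bounded_diffs_Suc_D[OF dg]
    have "localizer n c (Suc l0 + i) = g (Suc i) + ((- 1 / 2) * ddg i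
        + (- (real d - 1) / 2) * (\<eta> / (a + 2 * real i) * (dg (Suc i) + dg i)))" for i
    proof -
      define D where "D = 2 * real (Suc l0 + i) + real d - 1"
      have D: "D > 0" "a + 2 * real i = D" using d1 by (simp_all add: D_def a_def)
      have low: "lower (Suc l0 + i) = 1 / 2 - ((real d - 1) / 2) / D"
        using D(1) by (simp add: lower_def D_def field_simps)
      have rd: "radial_diff c (Suc l0 + i) = (g (Suc i) - g (Suc (Suc i)))
          + lower (Suc l0 + i) * (g (Suc (Suc i)) - g i)"
        by (simp add: radial_diff_def upper_def g_def algebra_simps)
      have "\<eta>\<^sup>2 * radial_diff c (Suc l0 + i)
          = (- 1 / 2) * ddg i + (- (real d - 1) / 2) * (\<eta> / D * (dg (Suc i) + dg i))"
        unfolding rd low ddg_def dg_def using D(1)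
        by (simp add: field_simps power2_eq_square)
      then show ?thesis unfolding D(2) by (simp add: localizer_def \<eta>_def g_def)
    qed
    then have eq: "(\<lambda>i. localizer n c (Suc l0 + i)) = (\<lambda>i. g (Suc i) + ((- 1 / 2) * ddg i
        + (- (real d - 1) / 2) * (\<eta> / (a + 2 * real i) * (dg (Suc i) + dg i))))" by auto
    have "bounded_diffs \<eta> j (C + (\<bar>- 1 / 2\<bar> * C + \<bar>- (real d - 1) / 2\<bar> * (2 ^ j * (K * (C + C)))))
        (\<lambda>i. localizer n c (Suc l0 + i))"
      unfolding eq
      by (intro bounded_diffs_add bounded_diffs_cmult bounded_diffs_mult bounded_diffs_shift g' dg' ddg K(2) a)
    moreover have "C + (\<bar>- 1 / 2\<bar> * C + \<bar>- (real d - 1) / 2\<bar> * (2 ^ j * (K * (C + C)))) = K' * C"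
      using d1 by (simp add: K'_def algebra_simps)
    ultimately show ?thesis by (simp add: \<eta>_def)
  qed
  moreover have "K' \<ge> 0" using K(1) d1 by (simp add: K'_def)
  ultimately show ?thesis by blast
qed

lemma localizer_iterate_bounded:
  "\<exists>K\<ge>0. \<forall>n l0 c C. n \<ge> 1 \<longrightarrow> n \<le> 2 * l0 + 2 \<longrightarrow> bounded_diffs (real n) (2 * k) C (\<lambda>i. c (l0 + i))
     \<longrightarrow> (\<forall>l\<ge>l0 + k. \<bar>(localizer n ^^ k) c l\<bar> \<le> K * C)"
proof (induction k)
  case 0
  have "\<bar>c l\<bar> \<le> 1 * C" if "bounded_diffs (real n) 0 C (\<lambda>i. c (l0 + i))" "l \<ge> l0" for n l0 c C l
    using bounded_diffs_bound[OF that(1), of "l - l0"] that(2) by simp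
  then show ?case by (intro exI[of _ 1]) auto
next
  case (Suc k)
  then obtain K1 where K1: "K1 \<ge> 0" "\<And>n l0 c C l. n \<ge> 1 \<Longrightarrow> n \<le> 2 * l0 + 2 \<Longrightarrow>
      bounded_diffs (real n) (2 * k) C (\<lambda>i. c (l0 + i)) \<Longrightarrow> l \<ge> l0 + k \<Longrightarrow> \<bar>(localizer n ^^ k) c l\<bar> \<le> K1 * C"
    by blast
  obtain K2 where K2: "K2 \<ge> 0" "\<And>n l0 c C. n \<ge> 1 \<Longrightarrow> n \<le> 2 * l0 + 2 \<Longrightarrow>
      bounded_diffs (real n) (2 * k + 2) C (\<lambda>i. c (l0 + i)) \<Longrightarrow>
      bounded_diffs (real n) (2 * k) (K2 * C) (\<lambda>i. localizer n c (Suc l0 + i))"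
    using localizer_bounded_diffs[of "2 * k"] by blast
  have "\<bar>(localizer n ^^ Suc k) c l\<bar> \<le> (K1 * K2) * C"
    if n: "n \<ge> 1" "n \<le> 2 * l0 + 2" and c: "bounded_diffs (real n) (2 * Suc k) C (\<lambda>i. c (l0 + i))"
      and l: "l \<ge> l0 + Suc k" for n l0 c C l
  proof -
    have "bounded_diffs (real n) (2 * k) (K2 * C) (\<lambda>i. localizer n c (Suc l0 + i))"
      using K2(2)[OF n] c by (simp add: numeral_2_eq_2)
    from K1(2)[OF n(1) _ this, of l] n(2) l
    have "\<bar>(localizer n ^^ k) (localizer n c) l\<bar> \<le> K1 * (K2 * C)" by simp
    then show ?thesis by (simp add: funpow_swap1 mult.assoc)
  qed
  moreover have "K1 * K2 \<ge> 0" using K1(1) K2(1) by simp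
  ultimately show ?case by blast
qed

text \<open>A bound without smoothness that grows with \<open>n\<close>, for the finitely many small
  \<open>n\<close>.\<close>

lemma localizer_crude:
  assumes "\<And>l. \<bar>c l\<bar> \<le> C"
  shows "\<bar>(localizer n ^^ k) c l\<bar> \<le> (1 + 2 * (real n)\<^sup>2) ^ k * C"
  using assms
proof (induction k arbitrary: l)
  case (Suc k)
  define b where "b = (localizer n ^^ k) c"
  define B where "B = (1 + 2 * (real n)\<^sup>2) ^ k * C"
  have b: "\<bar>b l\<bar> \<le> B" for l using Suc by (simp add: b_def B_def)
  have d: "\<bar>b l - b l'\<bar> \<le> 2 * B" for l l' using b[of l] b[of l'] by linarith
  have "\<bar>radial_diff b l\<bar> \<le> upper l * (2 * B) + lower l * (2 * B)"
    unfolding radial_diff_def using lower_bounds[of l]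
    by (intro order_trans[OF abs_triangle_ineq] add_mono) (auto simp: abs_mult upper_def intro!: mult_left_mono d)
  also have "\<dots> = 2 * B" by (simp add: upper_def algebra_simps)
  finally have "(real n)\<^sup>2 * \<bar>radial_diff b l\<bar> \<le> (real n)\<^sup>2 * (2 * B)" by (intro mult_left_mono) auto
  then have "\<bar>localizer n b l\<bar> \<le> B + (real n)\<^sup>2 * (2 * B)"
    unfolding localizer_def using b[of l] by (intro order_trans[OF abs_triangle_ineq] add_mono) (auto simp: abs_mult)
  then show ?case by (simp add: b_def[symmetric] B_def algebra_simps)
qed simp

text \<open>Constants are fixed by \<open>localizer\<close>. Each application looks one index ahead,
  so the range of ones shrinks by one.\<close>

lemma localizer_one:
  assumes "\<And>l. l \<le> n \<Longrightarrow> c l = 1"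
  shows "l + k \<le> n \<Longrightarrow> (localizer N ^^ k) c l = 1"
proof (induction k arbitrary: l)
  case (Suc k)
  then show ?case by (simp add: localizer_def radial_diff_def)
qed (simp add: assms)

text \<open>Near degree 0 the factor \<open>n / (2 * l + d - 1)\<close> is not bounded uniformly in
  \<open>n\<close>, but there the coefficients are constantly 1 and stay so. From about
  \<open>n / 2\<close> on, smoothness of \<open>h\<close> gives the bound.\<close>

theorem localizer_filter_bounded:
  assumes h: "C_class \<kappa> h" and h2: "\<forall>t\<ge>2. h t = 0" and h1: "\<forall>t. 0 \<le> t \<and> t \<le> 1 \<longrightarrow> h t = 1"
    and k: "real (2 * k) \<le> \<kappa>"
  shows "\<exists>C\<ge>0. \<forall>n\<ge>1. \<forall>l. \<bar>(localizer n ^^ k) (\<lambda>l. h (real l / real n)) l\<bar> \<le> C"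
proof -
  obtain D C where C: "C \<ge> 1" and D0: "\<And>t. t \<ge> 0 \<Longrightarrow> D 0 t = h t"
    and D: "\<And>i t. i < 2 * k \<Longrightarrow> t \<ge> 0 \<Longrightarrow> (D i has_real_derivative D (Suc i) t) (at t within {0..})"
    and DC: "\<And>i t. i \<le> 2 * k \<Longrightarrow> t \<ge> 0 \<Longrightarrow> \<bar>D i t\<bar> \<le> C"
    using C_class_derivatives[OF h h2 k] by metis
  obtain K where K: "K \<ge> 0" "\<And>n l0 c C l. n \<ge> 1 \<Longrightarrow> n \<le> 2 * l0 + 2 \<Longrightarrow>
      bounded_diffs (real n) (2 * k) C (\<lambda>i. c (l0 + i)) \<Longrightarrow> l \<ge> l0 + k \<Longrightarrow> \<bar>(localizer n ^^ k) c l\<bar> \<le> K * C"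
    using localizer_iterate_bounded[of k] by blast
  define M where "M = 1 + K * C + (1 + 2 * (real (4 * k))\<^sup>2) ^ k * C"
  have "\<bar>(localizer n ^^ k) (\<lambda>l. h (real l / real n)) l\<bar> \<le> M" if n: "n \<ge> 1" for n l
  proof -
    define c where "c l = h (real l / real n)" for l
    have cC: "\<bar>c l\<bar> \<le> C" for l using DC[of 0 "real l / real n"] D0[of "real l / real n"] by (simp add: c_def)
    have c1: "c l = 1" if "l \<le> n" for l
      unfolding c_def using h1 that n by (simp add: field_simps)
    have KC: "0 \<le> K * C" using K(1) C by simp
    have PC: "0 \<le> (1 + 2 * (real (4 * k))\<^sup>2) ^ k * C" using C by simp
    have "\<bar>(localizer n ^^ k) c l\<bar> \<le> M"
    \<comment> \<open>For \<open>n \<ge> 4 * k\<close> the other two ranges fit together: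
      \<open>l < n div 2 + k\<close> implies \<open>l + k \<le> n\<close>.\<close>
    proof (cases "n < 4 * k")
      case True
      have "\<bar>(localizer n ^^ k) c l\<bar> \<le> (1 + 2 * (real n)\<^sup>2) ^ k * C" by (rule localizer_crude[OF cC])
      also have "\<dots> \<le> (1 + 2 * (real (4 * k))\<^sup>2) ^ k * C"
        using True C by (intro mult_right_mono power_mono add_left_mono mult_left_mono) auto
      finally show ?thesis using KC by (simp add: M_def)
    next
      case False
      define l0 where "l0 = n div 2"
      show ?thesis
      proof (cases "l \<ge> l0 + k")
        case True
        have "bounded_diffs (real n) (2 * k) C (\<lambda>i. D 0 (real l0 / real n + real i / real n))"
          using n by (intro bounded_diffs_smooth D DC) auto
        then have "bounded_diffs (real n) (2 * k) C (\<lambda>i. c (l0 + i))"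
          by (simp add: D0 c_def add_divide_distrib)
        then have "\<bar>(localizer n ^^ k) c l\<bar> \<le> K * C"
          using n True by (intro K(2)[of n l0]) (auto simp: l0_def)
        then show ?thesis using PC by (simp add: M_def)
      next
        case l: False
        have "l + k \<le> n" using l False unfolding l0_def by linarith
        then have "(localizer n ^^ k) c l = 1" using localizer_one[of n c l k n] c1 by blast
        then show ?thesis using KC PC by (simp add: M_def)
      qed
    qed
    then show ?thesis by (simp add: c_def[abs_def])
  qed
  moreover have "M \<ge> 0" using K(1) C by (simp add: M_def)
  ultimately show ?thesis by blast
qed

end

section \<open>Uniform boundedness of filtered hyperinterpolation\<close>

lemma pd_inner_power: "pd b (\<lambda>x. (x \<bullet> y) ^ Suc n) = (\<lambda>x. (real (Suc n) * (b \<bullet> y)) * (x \<bullet> y) ^ n)"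
proof (induction n)
  case 0
  show ?case by simp
next
  case (Suc n)
  have "pd b (\<lambda>x. (x \<bullet> y) * (x \<bullet> y) ^ Suc n)
      = (\<lambda>x. (x \<bullet> y) * pd b (\<lambda>x. (x \<bullet> y) ^ Suc n) x + pd b (\<lambda>x. x \<bullet> y) x * (x \<bullet> y) ^ Suc n)"
    by (rule pd_mult) (intro rpf_inner real_polynomial_function_power)+
  also have "\<dots> = (\<lambda>x. (real (Suc (Suc n)) * (b \<bullet> y)) * (x \<bullet> y) ^ Suc n)"
    unfolding Suc.IH pd_inner by (simp add: fun_eq_iff algebra_simps)
  finally show ?case by simp
qed

lemma laplacian_inner_power:
  fixes y :: "'a::euclidean_space"
  shows "laplacian (\<lambda>x. (x \<bullet> y) ^ Suc (Suc n)) x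
       = real (Suc (Suc n)) * real (Suc n) * (y \<bullet> y) * (x \<bullet> y) ^ n"
proof -
  have "pd b (pd b (\<lambda>x. (x \<bullet> y) ^ Suc (Suc n))) x
      = (real (Suc (Suc n)) * real (Suc n) * (x \<bullet> y) ^ n) * ((y \<bullet> b) * (y \<bullet> b))" for b
    unfolding pd_inner_power
    by (subst pd_cmult) (auto simp only: pd_inner_power inner_commute mult_ac intro!: rpf_inner real_polynomial_function_power)
  then have "laplacian (\<lambda>x. (x \<bullet> y) ^ Suc (Suc n)) x
      = (real (Suc (Suc n)) * real (Suc n) * (x \<bullet> y) ^ n) * (\<Sum>b\<in>Basis. (y \<bullet> b) * (y \<bullet> b))"
    unfolding laplacian_pd by (simp only: sum_distrib_left)
  also have "(\<Sum>b\<in>Basis. (y \<bullet> b) * (y \<bullet> b)) = y \<bullet> y" by (rule euclidean_inner[symmetric])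
  finally show ?thesis by (simp only: mult_ac)
qed

text \<open>\<open>sphere_integral_laplacian\<close> for the power \<open>2 * Suc k\<close> gives a
  two-term recursion for the moments, solved by a quotient of Pochhammer symbols.\<close>

lemma sphere_even_moment:
  fixes y :: "'a::euclidean_space"
  assumes y: "norm y = 1" and N: "DIM('a) \<ge> 2"
  shows "(\<integral>x. (x \<bullet> y) ^ (2 * k) \<partial>sphere_measure) * pochhammer (real DIM('a) / 2) k = pochhammer (1 / 2) k"
proof (induction k)
  case 0
  show ?case using sphere.prob_space[where 'a = 'a] by simp
next
  case (Suc k)
  define M where "M k = (\<integral>x. (x \<bullet> y) ^ (2 * k) \<partial>sphere_measure)" for k
  have p: "(\<lambda>x. (x \<bullet> y) ^ (2 * Suc k)) \<in> hpoly (2 * Suc k)"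
    using hpoly_power[OF hpoly_inner, of y "2 * Suc k"] by simp
  have "laplacian (\<lambda>x. (x \<bullet> y) ^ (2 * Suc k)) x = real (2 * k + 2) * real (2 * k + 1) * (x \<bullet> y) ^ (2 * k)" for x
    using laplacian_inner_power[of y "2 * k" x] y by (simp add: norm_eq_1)
  with sphere_integral_laplacian[OF p]
  have "real (2 * k + 2) * real (2 * k + 1) * M k = real (2 * Suc k) * (real (2 * Suc k) + real DIM('a) - 2) * M (Suc k)"
    by (simp add: M_def)
  then have "2 * real (2 * k + 2) * ((real DIM('a) / 2 + real k) * M (Suc k)) = 2 * real (2 * k + 2) * ((1 / 2 + real k) * M k)"
    by (simp add: field_simps)
  moreover have "2 * real (2 * k + 2) \<noteq> 0" by simp
  ultimately have eq: "(real DIM('a) / 2 + real k) * M (Suc k) = (1 / 2 + real k) * M k"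
    by (simp only: mult_cancel_left) simp
  have "M (Suc k) * pochhammer (real DIM('a) / 2) (Suc k)
      = ((real DIM('a) / 2 + real k) * M (Suc k)) * pochhammer (real DIM('a) / 2) k"
    by (simp add: pochhammer_Suc mult_ac)
  also have "\<dots> = (1 / 2 + real k) * (M k * pochhammer (real DIM('a) / 2) k)" unfolding eq by simp
  also have "\<dots> = pochhammer (1 / 2) (Suc k)" using Suc.IH by (simp add: M_def pochhammer_Suc mult.commute)
  finally show ?case by (simp add: M_def)
qed

lemma sums_neg_binomial:
  fixes a z :: real
  assumes "\<bar>z\<bar> < 1"
  shows "(\<lambda>n. pochhammer a n / fact n * z ^ n) sums (1 - z) powr (- a)"
proof -
  have "(\<lambda>n. ((- a) gchoose n) * (- z) ^ n) sums (1 + (- z)) powr (- a)"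
    by (rule Generalised_Binomial_Theorem.gen_binomial_real) (use assms in simp)
  moreover have "((- a) gchoose n) * (- z) ^ n = pochhammer a n / fact n * z ^ n" for n
    by (simp add: gbinomial_pochhammer power_mult_distrib[symmetric])
  ultimately show ?thesis by simp
qed

text \<open>The exponent \<open>DIM('a) / 2\<close> makes the moments cancel against the binomial coefficients.\<close>
lemma sphere_integral_binomial:
  fixes y :: "'a::euclidean_space"
  assumes y: "norm y = 1" and N: "DIM('a) \<ge> 2" and q: "0 \<le> q" "q < 1"
  shows "(\<integral>x. (1 - q * (x \<bullet> y)\<^sup>2) powr (- (real DIM('a) / 2)) \<partial>sphere_measure) = (1 - q) powr (- (1 / 2))"
proof -
  define c where "c k = pochhammer (real DIM('a) / 2) k / fact k" for k
  define F where "F k x = c k * (q * (x \<bullet> y)\<^sup>2) ^ k" for k and x :: 'a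
  have c0: "0 \<le> c k" for k unfolding c_def by (intro divide_nonneg_pos pochhammer_nonneg) auto
  have t: "0 \<le> q * (x \<bullet> y)\<^sup>2" "q * (x \<bullet> y)\<^sup>2 \<le> q" if "norm x = 1" for x :: 'a
  proof -
    have "\<bar>x \<bullet> y\<bar> \<le> 1" using Cauchy_Schwarz_ineq2[of x y] y that by simp
    then have "(x \<bullet> y)\<^sup>2 \<le> 1" by (simp add: abs_square_le_1)
    then show "q * (x \<bullet> y)\<^sup>2 \<le> q" using q mult_left_mono[of "(x \<bullet> y)\<^sup>2" 1 q] by simp
  qed (use q in simp)
  have F0: "0 \<le> F k x" for k x unfolding F_def using c0 q by simp
  have Fs: "(\<lambda>k. F k x) sums (1 - q * (x \<bullet> y)\<^sup>2) powr (- (real DIM('a) / 2))" if "norm x = 1" for x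
    unfolding F_def c_def by (rule sums_neg_binomial) (use t[OF that] q in simp)
  have Fi: "integrable sphere_measure (F k)" for k
    unfolding F_def[abs_def] by (intro integrable_sphere continuous_intros)
  have Fint: "(\<integral>x. F k x \<partial>sphere_measure) = pochhammer (1 / 2) k / fact k * q ^ k" for k
  proof -
    have "(\<integral>x. F k x \<partial>sphere_measure) = c k * q ^ k * (\<integral>x. (x \<bullet> y) ^ (2 * k) \<partial>sphere_measure)"
      unfolding F_def by (simp add: power_mult_distrib power_mult[symmetric] mult.assoc)
    also have "\<dots> = q ^ k / fact k * ((\<integral>x. (x \<bullet> y) ^ (2 * k) \<partial>sphere_measure) * pochhammer (real DIM('a) / 2) k)"
      by (simp add: c_def)
    finally show ?thesis unfolding sphere_even_moment[OF y N] by simp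
  qed
  have s: "(\<lambda>k. \<integral>x. F k x \<partial>sphere_measure) sums (1 - q) powr (- (1 / 2))"
    unfolding Fint by (rule sums_neg_binomial) (use q in simp)
  have "(\<lambda>k. \<integral>x. F k x \<partial>sphere_measure) sums (\<integral>x. (\<Sum>k. F k x) \<partial>sphere_measure)"
  proof (rule sums_integral[OF Fi])
    show "AE x in sphere_measure. summable (\<lambda>k. norm (F k x))"
      by (rule AE_I2) (use Fs F0 in \<open>auto dest: sums_summable\<close>)
    show "summable (\<lambda>k. \<integral>x. norm (F k x) \<partial>sphere_measure)"
      using sums_summable[OF s] F0 by simp
  qed
  also have "(\<integral>x. (\<Sum>k. F k x) \<partial>sphere_measure) = (\<integral>x. (1 - q * (x \<bullet> y)\<^sup>2) powr (- (real DIM('a) / 2)) \<partial>sphere_measure)"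
    by (rule sphere_integral_cong) (use Fs in \<open>auto simp: sums_iff\<close>)
  finally show ?thesis using s sums_unique2 by blast
qed

text \<open>The base is \<open>A * (1 - q * (x \<bullet> y)\<^sup>2)\<close> with
  \<open>A = 1 + n\<^sup>2 / 2\<close> and \<open>1 - q = 1 / A\<close>. Hence the integral is
  \<open>A\<close> to the power \<open>1 / 2 - (d + 1) / 2 = - d / 2\<close>.\<close>

lemma sphere_integral_tail:
  fixes y :: "'a::euclidean_space"
  assumes y: "norm y = 1" and N: "DIM('a) = d + 1" "d \<ge> 1" and n: "n > 0"
  shows "(\<integral>x. (1 + n\<^sup>2 * (1 - (x \<bullet> y)\<^sup>2) / 2) powr (- (real DIM('a) / 2)) \<partial>sphere_measure)
       \<le> 2 powr (real d / 2) * n powr (- real d)"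
proof -
  define A where "A = 1 + n\<^sup>2 / 2"
  define q where "q = (n\<^sup>2 / 2) / A"
  have A: "A > 1" using n by (simp add: A_def)
  have "1 - q = (A - n\<^sup>2 / 2) / A" using A by (simp add: q_def diff_divide_distrib)
  also have "A - n\<^sup>2 / 2 = 1" by (simp add: A_def)
  finally have q3: "1 - q = inverse A" by (simp add: inverse_eq_divide)
  have q: "0 \<le> q" "q < 1" "1 - q = inverse A"
  proof -
    show "0 \<le> q" using A by (simp add: q_def)
    have "0 < inverse A" using A by simp
    with q3 show "q < 1" by linarith
  qed (rule q3)
  have Aq: "A * q = n\<^sup>2 / 2" using A by (simp add: q_def)
  have "(\<integral>x. (1 + n\<^sup>2 * (1 - (x \<bullet> y)\<^sup>2) / 2) powr (- (real DIM('a) / 2)) \<partial>sphere_measure)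
      = (\<integral>x. A powr (- (real DIM('a) / 2)) * (1 - q * (x \<bullet> y)\<^sup>2) powr (- (real DIM('a) / 2)) \<partial>sphere_measure)"
  proof (rule sphere_integral_cong)
    fix x :: 'a assume "x \<in> sphere 0 1"
    then have "\<bar>x \<bullet> y\<bar> \<le> 1" using Cauchy_Schwarz_ineq2[of x y] y by simp
    then have "(x \<bullet> y)\<^sup>2 \<le> 1" by (simp add: abs_square_le_1)
    then have "q * (x \<bullet> y)\<^sup>2 \<le> q" using q mult_left_mono[of "(x \<bullet> y)\<^sup>2" 1 q] by simp
    then have pos: "1 - q * (x \<bullet> y)\<^sup>2 \<ge> 0" using q by simp
    have "1 + n\<^sup>2 * (1 - (x \<bullet> y)\<^sup>2) / 2 = A - (A * q) * (x \<bullet> y)\<^sup>2"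
      unfolding Aq by (simp add: A_def field_simps)
    also have "\<dots> = A * (1 - q * (x \<bullet> y)\<^sup>2)" by (simp add: algebra_simps)
    finally show "(1 + n\<^sup>2 * (1 - (x \<bullet> y)\<^sup>2) / 2) powr (- (real DIM('a) / 2))
        = A powr (- (real DIM('a) / 2)) * (1 - q * (x \<bullet> y)\<^sup>2) powr (- (real DIM('a) / 2))"
      using A pos by (simp add: powr_mult)
  qed
  also have "\<dots> = A powr (- (real DIM('a) / 2)) * (1 - q) powr (- (1 / 2))"
    using sphere_integral_binomial[OF y _ q(1,2)] N by simp
  also have "(1 - q) powr (- (1 / 2)) = A powr (1 / 2)"
    unfolding q(3) using A by (simp add: powr_minus inverse_powr)
  also have "A powr (- (real DIM('a) / 2)) * A powr (1 / 2) = A powr (- (real d / 2))"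
    unfolding powr_add[symmetric] using N by (simp add: field_simps)
  also have "\<dots> \<le> (n\<^sup>2 / 2) powr (- (real d / 2))"
    using n by (intro powr_mono2') (auto simp: A_def)
  also have "\<dots> = 2 powr (real d / 2) * n powr (- real d)"
  proof -
    have "(n\<^sup>2) powr (- (real d / 2)) = n powr (- real d)"
      using n by (simp add: powr_powr flip: powr_numeral)
    then show ?thesis by (simp add: powr_divide powr_minus_divide)
  qed
  finally show ?thesis .
qed

text \<open>With \<open>\<phi>\<close> half the angle, \<open>dist x y = 2 * sin \<phi>\<close> and
  \<open>\<phi> / 2 \<le> tan (\<phi> / 2) = sin \<phi> / (1 + cos \<phi>) \<le> sin \<phi>\<close>.
  The factor 2 cancels the \<open>1 / 2\<close> of \<open>separation_radius\<close>.\<close>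

lemma geodist_le_dist:
  fixes x y :: "'a::euclidean_space"
  assumes "norm x = 1" "norm y = 1"
  shows "geodist x y \<le> 2 * dist x y"
proof -
  define \<theta> where "\<theta> = arccos (x \<bullet> y)"
  have b: "\<bar>x \<bullet> y\<bar> \<le> 1" using Cauchy_Schwarz_ineq2[of x y] assms by simp
  then have \<theta>: "0 \<le> \<theta>" "\<theta> \<le> pi" "cos \<theta> = x \<bullet> y" by (auto simp: \<theta>_def arccos_lbound arccos_ubound)
  define \<phi> where "\<phi> = \<theta> / 2"
  have \<phi>: "0 \<le> \<phi>" "\<phi> \<le> pi / 2" using \<theta> by (auto simp: \<phi>_def)
  have c0: "0 \<le> cos \<phi>" using \<phi> by (intro cos_ge_zero) auto
  have \<phi>pi: "\<phi> < pi" using \<phi>(2) pi_gt_zero by linarith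
  have s0: "0 \<le> sin \<phi>" using \<phi> \<phi>pi by (intro sin_ge_zero) auto
  have "\<bar>\<phi> / 2\<bar> \<le> \<bar>tan (\<phi> / 2)\<bar>" by (rule abs_tan_ge) (use \<phi> \<phi>pi in auto)
  also have "tan (\<phi> / 2) = sin \<phi> / (cos \<phi> + 1)" using tan_half[of "\<phi> / 2"] by simp
  also have "\<bar>sin \<phi> / (cos \<phi> + 1)\<bar> = sin \<phi> / (cos \<phi> + 1)" using c0 s0 by simp
  also have "\<dots> \<le> sin \<phi> / 1" using c0 s0 by (intro divide_left_mono) auto
  finally have "\<phi> / 2 \<le> sin \<phi>" using \<phi> by simp
  moreover have "(dist x y)\<^sup>2 = (2 * sin \<phi>)\<^sup>2"
  proof -
    have "(dist x y)\<^sup>2 = 2 - 2 * (x \<bullet> y)"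
      using assms by (simp add: dist_norm power2_norm_eq_inner inner_diff inner_commute norm_eq_1)
    also have "x \<bullet> y = cos (2 * \<phi>)" using \<theta>(3) by (simp add: \<phi>_def)
    finally show ?thesis by (simp add: cos_double_sin power_mult_distrib)
  qed
  then have "dist x y = 2 * sin \<phi>" by (rule power2_eq_imp_eq) (use s0 in auto)
  ultimately show ?thesis by (simp add: geodist_def \<theta>_def \<phi>_def)
qed

lemma one_minus_inner_eq:
  fixes x y :: "'a::euclidean_space"
  assumes "norm x = 1" "norm y = 1"
  shows "1 - x \<bullet> y = (dist x y)\<^sup>2 / 2"
  using assms by (simp add: dist_norm power2_norm_eq_inner inner_diff inner_commute norm_eq_1)

section \<open>Weighted sums over separated points\<close>

context sphere_basis
begin

text \<open>\<open>1 - (x \<bullet> y)\<^sup>2\<close> stands in for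
  \<open>1 - x \<bullet> y\<close> because its integral is computed above; the antipode then counts
  as near, which only enlarges the kernel. The \<open>max\<close> keeps the base at least 1 off the
  sphere, so the kernel is continuous everywhere.\<close>

definition tail_kernel :: "real \<Rightarrow> 'a \<Rightarrow> 'a \<Rightarrow> real" where
  "tail_kernel n y x = (1 + n\<^sup>2 * max 0 (1 - (x \<bullet> y)\<^sup>2) / 2) powr (- (real DIM('a) / 2))"

text \<open>Each summand is at most a constant times the tail kernel at every direction met by the
  ball of radius \<open>e\<close> around \<open>xs j\<close>. Averaging over these disjoint balls
  turns the sum into an integral of the kernel.\<close>

lemma tail_sum_le:
  assumes y: "y \<in> S" and J: "finite J" and xs: "\<And>j. j \<in> J \<Longrightarrow> xs j \<in> S"
    and sep: "\<And>i j. i \<in> J \<Longrightarrow> j \<in> J \<Longrightarrow> i \<noteq> j \<Longrightarrow> 2 * e \<le> dist (xs i) (xs j)"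
    and e: "0 < e" "e \<le> 1 / 2" and n: "n > 0" and ne: "n * e \<le> K" and K: "K \<ge> 0"
  shows "(\<Sum>j\<in>J. (1 + n\<^sup>2 * (1 - y \<bullet> xs j)) powr (- (real DIM('a) / 2))) * e ^ d
      \<le> 2 ^ DIM('a) * (2 + 4 * K\<^sup>2) powr (real DIM('a) / 2) * (2 * real DIM('a))
        * (2 powr (real d / 2) * n powr (- real d))"
proof -
  let ?N = "real DIM('a) / 2"
  \<comment> \<open>Moving \<open>xs j\<close> by at most \<open>2 * e\<close> gives a base of at
    most \<open>2 * \<tau> + 4 * K\<^sup>2 \<le> \<kappa> * \<tau>\<close>, where
    \<open>\<tau> \<ge> 1\<close> is the base at \<open>xs j\<close> and
    \<open>n * e \<le> K\<close> is used.\<close>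
  define \<kappa> where "\<kappa> = 2 + 4 * K\<^sup>2"
  define a where "a j = (1 + n\<^sup>2 * (1 - y \<bullet> xs j)) powr (- ?N)" for j
  define \<Theta> where "\<Theta> z = \<kappa> powr ?N * tail_kernel n y (sgn z)" for z :: 'a
  have \<kappa>: "\<kappa> \<ge> 2" by (simp add: \<kappa>_def)
  have base: "1 \<le> 1 + n\<^sup>2 * max 0 (1 - (x \<bullet> y)\<^sup>2) / 2" for x by simp
  have tk: "0 \<le> tail_kernel n y x" "tail_kernel n y x \<le> 1" for x
    using powr_mono2'[of "- ?N" 1 "1 + n\<^sup>2 * max 0 (1 - (x \<bullet> y)\<^sup>2) / 2"] base[of x]
    by (auto simp: tail_kernel_def)
  have tkc: "continuous_on A (tail_kernel n y)" for A
  proof -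
    have ne: "1 + n\<^sup>2 * max 0 (1 - (x \<bullet> y)\<^sup>2) / 2 \<noteq> 0" for x using base[of x] by linarith
    then show ?thesis unfolding tail_kernel_def[abs_def] by (intro continuous_intros ballI) (use ne in auto)
  qed
  have [measurable]: "tail_kernel n y \<in> borel_measurable borel"
    using tkc by (rule borel_measurable_continuous_onI)
  have [measurable]: "\<Theta> \<in> borel_measurable borel" unfolding \<Theta>_def[abs_def] by measurable
  have \<Theta>: "0 \<le> \<Theta> z" "\<Theta> z \<le> \<kappa> powr ?N" for z
    unfolding \<Theta>_def using tk[of "sgn z"] by (auto intro: mult_left_le)
  have aint: "a j \<le> (\<integral>z. \<Theta> (xs j + e *\<^sub>R z) \<partial>unit_ball_measure)" if j: "j \<in> J" for j
  proof (rule unit_ball.integral_ge_const)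
    show "integrable unit_ball_measure (\<lambda>z. \<Theta> (xs j + e *\<^sub>R z))"
      by (rule unit_ball.integrable_const_bound[of _ "\<kappa> powr ?N"]; (measurable)?) (use \<Theta> in auto)
    show "AE z in unit_ball_measure. a j \<le> \<Theta> (xs j + e *\<^sub>R z)"
      using AE_unit_ball
    proof eventually_elim
      case (elim z)
      define x where "x = xs j + e *\<^sub>R z"
      define \<omega> where "\<omega> = sgn x"
      have nj: "norm (xs j) = 1" and ny: "norm y = 1" using xs[OF j] y by auto
      have "norm (x - xs j) = e * norm z" using e by (simp add: x_def)
      also have "\<dots> \<le> e * 1" using elim e by (intro mult_left_mono) auto
      finally have xe: "norm (x - xs j) \<le> e" by simp
      have "norm (xs j) \<le> norm x + norm (x - xs j)" by (metis norm_minus_commute norm_triangle_sub)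
      then have "norm x \<ge> 1 / 2" using xe e nj by simp
      then have x0: "x \<noteq> 0" by auto
      have n\<omega>: "norm \<omega> = 1" using x0 by (simp add: \<omega>_def norm_sgn)
      have "x - \<omega> = (norm x - 1) *\<^sub>R \<omega>" using x0 by (simp add: \<omega>_def sgn_div_norm algebra_simps)
      then have "norm (x - \<omega>) = \<bar>norm x - 1\<bar>" using n\<omega> by simp
      also have "\<dots> \<le> norm (x - xs j)" using norm_triangle_ineq3[of x "xs j"] nj by simp
      finally have "norm (x - \<omega>) \<le> e" using xe by simp
      \<comment> \<open>From \<open>xs j\<close> to the point \<open>x\<close> of the ball and on to
        its direction \<open>\<omega>\<close>: both steps have length at most
        \<open>e\<close>.\<close>
      have "dist y \<omega> \<le> dist y (xs j) + (dist (xs j) x + dist x \<omega>)"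
        using dist_triangle[of y \<omega> "xs j"] dist_triangle[of "xs j" \<omega> x] by linarith
      also have "dist (xs j) x + dist x \<omega> \<le> 2 * e"
        using xe \<open>norm (x - \<omega>) \<le> e\<close> by (simp add: dist_norm norm_minus_commute)
      finally have dle: "dist y \<omega> \<le> dist y (xs j) + 2 * e" by simp
      define D where "D = dist y (xs j)"
      have "(dist y \<omega>)\<^sup>2 \<le> (D + 2 * e)\<^sup>2" using dle by (intro power_mono) (auto simp: D_def)
      also have "\<dots> \<le> 2 * D\<^sup>2 + 8 * e\<^sup>2"
        using zero_le_power2[of "D - 2 * e"] by (simp add: power2_eq_square algebra_simps)
      finally have d2: "1 - y \<bullet> \<omega> \<le> 2 * (1 - y \<bullet> xs j) + 4 * e\<^sup>2"
        unfolding one_minus_inner_eq[OF ny n\<omega>] one_minus_inner_eq[OF ny nj] by (simp add: D_def)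
      have bi: "\<bar>\<omega> \<bullet> y\<bar> \<le> 1" using Cauchy_Schwarz_ineq2[of \<omega> y] n\<omega> ny by simp
      have sq1: "(\<omega> \<bullet> y)\<^sup>2 \<le> 1" using bi by (simp add: abs_square_le_1)
      have "1 - (\<omega> \<bullet> y)\<^sup>2 \<le> 2 * (1 - y \<bullet> \<omega>)"
        using zero_le_power2[of "1 - \<omega> \<bullet> y"] by (simp add: power2_eq_square algebra_simps inner_commute)
      then have m: "max 0 (1 - (\<omega> \<bullet> y)\<^sup>2) / 2 \<le> 2 * (1 - y \<bullet> xs j) + 4 * e\<^sup>2"
        using d2 sq1 by simp
      define \<tau> where "\<tau> = 1 + n\<^sup>2 * (1 - y \<bullet> xs j)"
      have t0: "0 \<le> 1 - y \<bullet> xs j" unfolding one_minus_inner_eq[OF ny nj] by simp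
      have \<tau>: "\<tau> \<ge> 1" using t0 by (simp add: \<tau>_def)
      have "n\<^sup>2 * (max 0 (1 - (\<omega> \<bullet> y)\<^sup>2) / 2) \<le> n\<^sup>2 * (2 * (1 - y \<bullet> xs j) + 4 * e\<^sup>2)"
        by (intro mult_left_mono m) auto
      also have "\<dots> = 2 * (\<tau> - 1) + 4 * (n * e)\<^sup>2" by (simp add: \<tau>_def power_mult_distrib algebra_simps)
      also have "(n * e)\<^sup>2 \<le> K\<^sup>2" using n e ne by (intro power_mono) auto
      finally have "1 + n\<^sup>2 * max 0 (1 - (\<omega> \<bullet> y)\<^sup>2) / 2 \<le> 2 * \<tau> + 4 * K\<^sup>2" by simp
      also have "\<dots> \<le> \<kappa> * \<tau>"
      proof -
        have "4 * K\<^sup>2 * 1 \<le> 4 * K\<^sup>2 * \<tau>" using \<tau> by (intro mult_left_mono) auto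
        then show ?thesis by (simp add: \<kappa>_def algebra_simps)
      qed
      finally have le: "1 + n\<^sup>2 * max 0 (1 - (\<omega> \<bullet> y)\<^sup>2) / 2 \<le> \<kappa> * \<tau>" .
      have "(\<kappa> * \<tau>) powr (- ?N) \<le> tail_kernel n y \<omega>"
      proof -
        have "0 < 1 + n\<^sup>2 * max 0 (1 - (\<omega> \<bullet> y)\<^sup>2) / 2" using base[of \<omega>] by linarith
        then show ?thesis unfolding tail_kernel_def by (intro powr_mono2'[OF _ _ le]) simp_all
      qed
      then have "\<kappa> powr ?N * (\<kappa> * \<tau>) powr (- ?N) \<le> \<kappa> powr ?N * tail_kernel n y \<omega>"
        by (intro mult_left_mono) auto
      moreover have "\<kappa> powr ?N * (\<kappa> * \<tau>) powr (- ?N) = \<tau> powr (- ?N)"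
        using \<kappa> \<tau> by (simp add: powr_mult powr_minus)
      ultimately show ?case by (simp add: a_def \<tau>_def \<Theta>_def \<omega>_def x_def)
    qed
  qed
  have "(\<Sum>j\<in>J. a j) * e ^ DIM('a) \<le> (1 + e) ^ DIM('a) *
      (\<integral>z. indicator {shell_radius e..} (norm z) * \<Theta> ((1 + e) *\<^sub>R z) \<partial>unit_ball_measure)"
    by (rule packing_sum_le[OF J _ sep e _ \<Theta>(1) \<Theta>(2) aint]) (use xs in auto)
  also have "(\<integral>z. indicator {shell_radius e..} (norm z) * \<Theta> ((1 + e) *\<^sub>R z) \<partial>unit_ball_measure)
      = \<kappa> powr ?N * (\<integral>z. indicator {shell_radius e..} (norm z) * tail_kernel n y (sgn ((1 + e) *\<^sub>R z)) \<partial>unit_ball_measure)"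
  proof -
    have "(\<lambda>z. indicator {shell_radius e..} (norm z) * \<Theta> ((1 + e) *\<^sub>R z))
        = (\<lambda>z. \<kappa> powr ?N * (indicator {shell_radius e..} (norm z) * tail_kernel n y (sgn ((1 + e) *\<^sub>R z))))"
      by (auto simp: \<Theta>_def)
    then show ?thesis by simp
  qed
  also have "(1 + e) ^ DIM('a) * (\<kappa> powr ?N * (\<integral>z. indicator {shell_radius e..} (norm z) * tail_kernel n y (sgn ((1 + e) *\<^sub>R z)) \<partial>unit_ball_measure))
      \<le> 2 ^ DIM('a) * (\<kappa> powr ?N * (2 * real DIM('a) * e * (2 powr (real d / 2) * n powr (- real d))))"
  proof (intro mult_mono power_mono mult_left_mono)
    have "(\<integral>z. indicator {shell_radius e..} (norm z) * tail_kernel n y (sgn ((1 + e) *\<^sub>R z)) \<partial>unit_ball_measure)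
        \<le> 2 * real DIM('a) * e * (\<integral>x. tail_kernel n y x \<partial>sphere_measure)"
      by (rule shell_integral_le[OF e tkc _ tk(1)]) measurable
    also have "(\<integral>x. tail_kernel n y x \<partial>sphere_measure)
        = (\<integral>x. (1 + n\<^sup>2 * (1 - (x \<bullet> y)\<^sup>2) / 2) powr (- ?N) \<partial>sphere_measure)"
    proof (rule sphere_integral_cong)
      fix x :: 'a assume "x \<in> S"
      then have "\<bar>x \<bullet> y\<bar> \<le> 1" using Cauchy_Schwarz_ineq2[of x y] y by simp
      then have "(x \<bullet> y)\<^sup>2 \<le> 1" by (simp add: abs_square_le_1)
      then show "tail_kernel n y x = (1 + n\<^sup>2 * (1 - (x \<bullet> y)\<^sup>2) / 2) powr (- ?N)"
        by (simp add: tail_kernel_def)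
    qed
    also have "\<dots> \<le> 2 powr (real d / 2) * n powr (- real d)"
      by (rule sphere_integral_tail[OF _ dim d1 n]) (use y in simp)
    finally show "(\<integral>z. indicator {shell_radius e..} (norm z) * tail_kernel n y (sgn ((1 + e) *\<^sub>R z)) \<partial>unit_ball_measure)
        \<le> 2 * real DIM('a) * e * (2 powr (real d / 2) * n powr (- real d))"
      using e by (simp add: mult_left_mono)
  qed (use e tk in \<open>auto intro!: mult_nonneg_nonneg integral_nonneg_AE\<close>)
  finally have "((\<Sum>j\<in>J. a j) * e ^ d) * e \<le> (2 ^ DIM('a) * \<kappa> powr ?N * (2 * real DIM('a))
      * (2 powr (real d / 2) * n powr (- real d))) * e"
    unfolding dim by (simp add: mult_ac)
  then show ?thesis using e by (simp add: a_def \<kappa>_def)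
qed

text \<open>With \<open>U = \<tau> ^ k * \<Phi>\<close> the localized kernel, the summand is
  \<open>sqrt w * \<bar>U\<bar>\<close> times \<open>sqrt w / \<tau> ^ k\<close>. In the
  Cauchy-Schwarz bound the first square sum is of order \<open>n ^ d\<close> by
  Marcinkiewicz-Zygmund, the second of order \<open>n\<close> to the power \<open>- d\<close> by
  \<open>tail_sum_le\<close>; the powers cancel.\<close>

theorem filter_kernel_sum_bounded:
  assumes h: "C_class \<kappa> h" and h2: "\<forall>t\<ge>2. h t = 0" and h1: "\<forall>t. 0 \<le> t \<and> t \<le> 1 \<longrightarrow> h t = 1"
    and \<kappa>: "\<kappa> > real d + 1" and K: "K \<ge> 0" and A: "A \<ge> 0"
  obtains C where "C > 0" and "\<And>(J :: nat set) xs w n e y. finite J \<Longrightarrow> \<forall>j\<in>J. xs j \<in> S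
    \<Longrightarrow> \<forall>i\<in>J. \<forall>j\<in>J. i \<noteq> j \<longrightarrow> 2 * e \<le> dist (xs i) (xs j)
    \<Longrightarrow> 0 < e \<Longrightarrow> e \<le> 1 / 2 \<Longrightarrow> n \<ge> 1 \<Longrightarrow> real n * e \<le> K
    \<Longrightarrow> \<forall>j\<in>J. 0 \<le> w j \<and> w j \<le> A * e ^ d \<Longrightarrow> y \<in> S
    \<Longrightarrow> (\<Sum>j\<in>J. w j * \<bar>filter_kernel Z Y h n y (xs j)\<bar>) \<le> C"
proof -
  \<comment> \<open>\<open>2 * k \<le> d + 1 < \<kappa>\<close> provides enough derivatives of
    \<open>h\<close>. Since \<open>2 * k \<ge> d \<ge> (d + 1) / 2\<close>, the power
    \<open>- 2 * k\<close> of \<open>\<tau>\<close> is at most the summand of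
    \<open>tail_sum_le\<close>.\<close>
  define k where "k = (d + 1) div 2"
  have k: "2 * k \<le> d + 1" "d \<le> 2 * k" unfolding k_def by auto
  have "real (2 * k) \<le> \<kappa>" using k(1) \<kappa> by linarith
  then obtain G where G: "G \<ge> 0" "\<And>n l. n \<ge> 1 \<Longrightarrow> \<bar>(localizer n ^^ k) (\<lambda>l. h (real l / real n)) l\<bar> \<le> G"
    using localizer_filter_bounded[OF h h2 h1] by blast
  \<comment> \<open>\<open>exp (4 * K + k)\<close> bounds \<open>(1 + e) ^ (2 * L)\<close> for
    \<open>L = 2 * n + k\<close>. The last factor, times \<open>n ^ d\<close>, bounds the square
    integral of \<open>U\<close>, where \<open>Suc L \<le> (k + 3) * n\<close>.\<close>
  define E1 where "E1 = 2 ^ DIM('a) * (2 * real DIM('a)) * exp (4 * K + real k) * (2 * G\<^sup>2 * real (k + 3) ^ d)"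
  define E2 where "E2 = 2 ^ DIM('a) * (2 + 4 * K\<^sup>2) powr (real DIM('a) / 2) * (2 * real DIM('a)) * 2 powr (real d / 2)"
  have E: "0 \<le> E1" "0 \<le> E2" using G(1) by (simp_all add: E1_def E2_def)
  have main: "(\<Sum>j\<in>J. w j * \<bar>filter_kernel Z Y h n y (xs j)\<bar>) \<le> A * sqrt (E1 * E2)"
    if J: "finite J" and xs: "\<forall>j\<in>J. xs j \<in> S"
      and sep: "\<forall>i\<in>J. \<forall>j\<in>J. i \<noteq> j \<longrightarrow> 2 * e \<le> dist (xs i) (xs j)"
      and e: "0 < e" "e \<le> 1 / 2" and n: "n \<ge> 1" and ne: "real n * e \<le> K"
      and w: "\<forall>j\<in>J. 0 \<le> w j \<and> w j \<le> A * e ^ d" and y: "y \<in> S"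
    for J :: "nat set" and xs w n e y
  proof -
    define g where "g = (localizer n ^^ k) (\<lambda>l. h (real l / real n))"
    define L where "L = 2 * n + k"
    \<comment> \<open>Built from \<open>solid\<close>, so that \<open>U\<close> is a harmonic
      polynomial off the sphere as well, as \<open>marcinkiewicz_zygmund\<close> requires.\<close>
    define u where "u l x = (\<Sum>i=1..Z l. (g l * Y l i y) * solid l i x)" for l x
    define U where "U x = (\<Sum>l\<le>L. u l x)" for x
    define \<tau> where "\<tau> j = 1 + (real n)\<^sup>2 * (1 - y \<bullet> xs j)" for j
    define \<Phi> where "\<Phi> j = filter_kernel Z Y h n y (xs j)" for j
    have ug: "u l x = g l * zonal l y x" if "x \<in> S" for l x
      unfolding u_def zonal_def sum_distrib_left using that
      by (intro sum.cong) (auto simp: solid_eq mult.assoc)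
    have uh: "u l \<in> harm l" for l
      unfolding u_def[abs_def] by (intro harm_sum harm_cmult solid_harm)
    note hz = filter_eq_0[OF h2 n] and fk = filter_kernel_eq[OF h2 n]
    have UP: "U (xs j) = \<tau> j ^ k * \<Phi> j" if "j \<in> J" for j
    proof -
      have "xs j \<in> S" using xs that by blast
      with zonal_localizer(1)[of "2 * n" "\<lambda>l. h (real l / real n)" y "xs j" n k] hz y
      show ?thesis by (simp add: U_def ug g_def L_def \<tau>_def \<Phi>_def fk)
    qed
    have \<tau>1: "\<tau> j \<ge> 1" if "j \<in> J" for j
    proof -
      have "1 - y \<bullet> xs j = (dist y (xs j))\<^sup>2 / 2"
        using xs y that by (intro one_minus_inner_eq) auto
      then have "0 \<le> 1 - y \<bullet> xs j" by (simp only:) simp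
      then show ?thesis by (simp add: \<tau>_def)
    qed
    \<comment> \<open>By Parseval, degree \<open>l\<close> contributes
      \<open>(g l)\<^sup>2 * zonal l y y\<close>, which is of order
      \<open>(l + 1) ^ (d - 1)\<close>.\<close>
    have U2: "(\<integral>x. (U x)\<^sup>2 \<partial>sphere_measure) \<le> 2 * G\<^sup>2 * real (k + 3) ^ d * real n ^ d"
    proof -
      have pU: "poly_upto L U"
        unfolding U_def[abs_def] by (intro poly_upto_sum poly_upto_hpoly[OF harm_hpoly[OF uh]]) auto
      have cU: "coef U l i = g l * Y l i y" if "l \<le> L" "i \<in> {1..Z l}" for l i
      proof -
        have "coef U l i = coef (\<lambda>x. \<Sum>l\<le>L. \<Sum>i=1..Z l. (g l * Y l i y) * Y l i x) l i"
          by (rule coef_cong) (simp add: U_def u_def solid_eq)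
        also have "\<dots> = (if l \<in> {..L} then g l * Y l i y else 0)"
          by (rule coef_combination[OF finite_atMost that(2)])
        finally show ?thesis using that by simp
      qed
      have "(\<integral>x. (U x)\<^sup>2 \<partial>sphere_measure) = (\<Sum>l\<le>L. energy U l)" by (rule parseval_square[OF pU])
      also have "\<dots> \<le> (\<Sum>l\<le>L. 2 * G\<^sup>2 * real (Suc L) ^ (d - 1))"
      proof (rule sum_mono)
        fix l assume l: "l \<in> {..L}"
        have "energy U l = (g l)\<^sup>2 * zonal l y y"
          unfolding energy_def zonal_def sum_distrib_left using l
          by (intro sum.cong refl) (simp add: cU power2_eq_square)
        also have "\<dots> \<le> G\<^sup>2 * (2 * real (Suc l) ^ (d - 1))"
        proof (intro mult_mono zonal_diag_le y)
          have "\<bar>g l\<bar>\<^sup>2 \<le> G\<^sup>2" unfolding g_def by (intro power_mono G(2) n) auto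
          then show "(g l)\<^sup>2 \<le> G\<^sup>2" by simp
        qed (auto simp: zonal_diag_nonneg)
        also have "\<dots> \<le> G\<^sup>2 * (2 * real (Suc L) ^ (d - 1))"
          using l by (intro mult_left_mono power_mono) auto
        finally show "energy U l \<le> 2 * G\<^sup>2 * real (Suc L) ^ (d - 1)" by simp
      qed
      also have "\<dots> = 2 * G\<^sup>2 * real (Suc L) ^ d"
        using d1 by (cases d) (auto simp: algebra_simps)
      also have "\<dots> \<le> 2 * G\<^sup>2 * (real (k + 3) * real n) ^ d"
      proof (intro mult_left_mono power_mono)
        have "k * 1 \<le> k * n" using n by (intro mult_le_mono2)
        moreover have "(k + 3) * n = k * n + 3 * n" by (simp add: algebra_simps)
        ultimately have "Suc L \<le> (k + 3) * n" using n unfolding L_def by linarith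
        then show "real (Suc L) \<le> real (k + 3) * real n" by (metis of_nat_le_iff of_nat_mult)
      qed auto
      finally show ?thesis by (simp add: power_mult_distrib mult_ac)
    qed
    have mz: "(\<Sum>j\<in>J. (U (xs j))\<^sup>2) * e ^ d \<le> E1 * real n ^ d"
    proof -
      have "(\<Sum>j\<in>J. (U (xs j))\<^sup>2) * e ^ DIM('a)
          \<le> (1 + e) ^ DIM('a) * (2 * real DIM('a) * e) * (1 + e) ^ (2 * L) * (\<integral>x. (U x)\<^sup>2 \<partial>sphere_measure)"
        unfolding U_def
        by (rule marcinkiewicz_zygmund[OF _ uh J _ _ e]) (use xs sep dim d1 in auto)
      also have "\<dots> \<le> 2 ^ DIM('a) * (2 * real DIM('a) * e) * exp (4 * K + real k) * (2 * G\<^sup>2 * real (k + 3) ^ d * real n ^ d)"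
      proof (intro mult_mono U2 power_mono)
        have "(1 + e) ^ (2 * L) \<le> exp e ^ (2 * L)"
          using e by (intro power_mono exp_ge_add_one_self) auto
        also have "\<dots> = exp (4 * (real n * e) + 2 * real k * e)"
          by (simp add: L_def exp_of_nat_mult[symmetric] algebra_simps)
        also have "\<dots> \<le> exp (4 * K + real k)"
          using ne e mult_left_mono[of e "1/2" "2 * real k"] by simp
        finally show "(1 + e) ^ (2 * L) \<le> exp (4 * K + real k)" .
      qed (use e G(1) in \<open>auto intro!: mult_nonneg_nonneg integral_nonneg_AE\<close>)
      finally have "((\<Sum>j\<in>J. (U (xs j))\<^sup>2) * e ^ d) * e \<le> (E1 * real n ^ d) * e"
        unfolding dim by (simp add: E1_def dim mult_ac)
      then show ?thesis using e by simp
    qed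
    have tl: "(\<Sum>j\<in>J. inverse (\<tau> j ^ (2 * k))) * e ^ d \<le> E2 * real n powr (- real d)"
    proof -
      have "(\<Sum>j\<in>J. inverse (\<tau> j ^ (2 * k))) * e ^ d \<le> (\<Sum>j\<in>J. \<tau> j powr (- (real DIM('a) / 2))) * e ^ d"
      proof (intro mult_right_mono sum_mono)
        fix j assume j: "j \<in> J"
        have "\<tau> j powr real (2 * k) = \<tau> j ^ (2 * k)"
          by (rule powr_realpow) (use \<tau>1[OF j] in simp)
        then have "inverse (\<tau> j ^ (2 * k)) = \<tau> j powr (- real (2 * k))"
          unfolding powr_minus by simp
        also have "\<dots> \<le> \<tau> j powr (- (real DIM('a) / 2))"
          using \<tau>1[OF j] k(2) d1 dim by (intro powr_mono) auto
        finally show "inverse (\<tau> j ^ (2 * k)) \<le> \<tau> j powr (- (real DIM('a) / 2))" .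
      qed (use e in auto)
      also have "\<dots> \<le> E2 * real n powr (- real d)"
        using tail_sum_le[OF y J _ _ e _ ne K, of xs] xs sep n by (simp add: \<tau>_def E2_def mult_ac)
      finally show ?thesis .
    qed
    have "(\<Sum>j\<in>J. w j * \<bar>\<Phi> j\<bar>) = (\<Sum>j\<in>J. (sqrt (w j) * \<bar>U (xs j)\<bar>) * (sqrt (w j) * inverse (\<tau> j ^ k)))"
    proof (intro sum.cong refl)
      fix j assume j: "j \<in> J"
      have "\<bar>U (xs j)\<bar> * inverse (\<tau> j ^ k) = \<bar>\<Phi> j\<bar>"
        using UP[OF j] \<tau>1[OF j] by (simp add: abs_mult)
      moreover have "sqrt (w j) * sqrt (w j) = w j" using w j by simp
      ultimately show "w j * \<bar>\<Phi> j\<bar> = (sqrt (w j) * \<bar>U (xs j)\<bar>) * (sqrt (w j) * inverse (\<tau> j ^ k))"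
        by (metis (no_types, opaque_lifting) mult.assoc mult.left_commute)
    qed
    then have "(\<Sum>j\<in>J. w j * \<bar>\<Phi> j\<bar>)\<^sup>2 \<le> (\<Sum>j\<in>J. (sqrt (w j) * \<bar>U (xs j)\<bar>)\<^sup>2) * (\<Sum>j\<in>J. (sqrt (w j) * inverse (\<tau> j ^ k))\<^sup>2)"
      using Cauchy_Schwarz_ineq_sum by metis
    also have "\<dots> \<le> (A * (E1 * real n ^ d)) * (A * (E2 * real n powr (- real d)))"
    proof (intro mult_mono)
      have "(\<Sum>j\<in>J. (sqrt (w j) * \<bar>U (xs j)\<bar>)\<^sup>2) \<le> (\<Sum>j\<in>J. A * e ^ d * (U (xs j))\<^sup>2)"
        using w by (intro sum_mono) (auto simp: power_mult_distrib intro!: mult_right_mono)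
      also have "\<dots> = A * ((\<Sum>j\<in>J. (U (xs j))\<^sup>2) * e ^ d)" by (simp add: sum_distrib_left mult_ac)
      also have "\<dots> \<le> A * (E1 * real n ^ d)" using A by (intro mult_left_mono mz)
      finally show "(\<Sum>j\<in>J. (sqrt (w j) * \<bar>U (xs j)\<bar>)\<^sup>2) \<le> A * (E1 * real n ^ d)" .
      have "(\<Sum>j\<in>J. (sqrt (w j) * inverse (\<tau> j ^ k))\<^sup>2) \<le> (\<Sum>j\<in>J. A * e ^ d * inverse (\<tau> j ^ (2 * k)))"
      proof (rule sum_mono)
        fix j assume j: "j \<in> J"
        have "(sqrt (w j) * inverse (\<tau> j ^ k))\<^sup>2 = w j * inverse (\<tau> j ^ (2 * k))"
          using w j by (simp add: power_mult_distrib power_inverse power_mult[symmetric] mult.commute[of k 2])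
        also have "\<dots> \<le> A * e ^ d * inverse (\<tau> j ^ (2 * k))"
          using w j \<tau>1[OF j] by (intro mult_right_mono) auto
        finally show "(sqrt (w j) * inverse (\<tau> j ^ k))\<^sup>2 \<le> A * e ^ d * inverse (\<tau> j ^ (2 * k))" .
      qed
      also have "\<dots> = A * ((\<Sum>j\<in>J. inverse (\<tau> j ^ (2 * k))) * e ^ d)" by (simp add: sum_distrib_left mult_ac)
      also have "\<dots> \<le> A * (E2 * real n powr (- real d))" using A by (intro mult_left_mono tl)
      finally show "(\<Sum>j\<in>J. (sqrt (w j) * inverse (\<tau> j ^ k))\<^sup>2) \<le> A * (E2 * real n powr (- real d))" .
    qed (use A E in \<open>auto intro!: sum_nonneg mult_nonneg_nonneg\<close>)
    also have "\<dots> = (A * sqrt (E1 * E2))\<^sup>2"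
    proof -
      have "real n ^ d * real n powr (- real d) = 1"
        using n by (simp add: powr_realpow[symmetric] powr_add[symmetric])
      moreover have "(A * (E1 * real n ^ d)) * (A * (E2 * real n powr (- real d)))
          = A\<^sup>2 * (E1 * E2) * (real n ^ d * real n powr (- real d))"
        by (simp add: power2_eq_square mult_ac)
      ultimately show ?thesis using E by (simp add: power_mult_distrib)
    qed
    finally have "(\<Sum>j\<in>J. w j * \<bar>\<Phi> j\<bar>) \<le> A * sqrt (E1 * E2)"
      by (rule power2_le_imp_le) (use A E in simp)
    then show ?thesis by (simp add: \<Phi>_def)
  qed
  show ?thesis
  proof (rule that[of "A * sqrt (E1 * E2) + 1"])
    show "0 < A * sqrt (E1 * E2) + 1" using A E by (intro add_nonneg_pos mult_nonneg_nonneg) auto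
    fix J :: "nat set" and xs w n e y
    assume "finite J" "\<forall>j\<in>J. xs j \<in> S" "\<forall>i\<in>J. \<forall>j\<in>J. i \<noteq> j \<longrightarrow> 2 * e \<le> dist (xs i) (xs j)"
      "0 < e" "e \<le> 1 / 2" "1 \<le> n" "real n * e \<le> K" "\<forall>j\<in>J. 0 \<le> w j \<and> w j \<le> A * e ^ d" "y \<in> S"
    from main[OF this]
    show "(\<Sum>j\<in>J. w j * \<bar>filter_kernel Z Y h n y (xs j)\<bar>) \<le> A * sqrt (E1 * E2) + 1" by simp
  qed
qed

end

section \<open>Sup norm, mesh norm and separation radius\<close>

lemma Linf_norm_le:
  fixes g :: "'a::euclidean_space \<Rightarrow> real"
  assumes g: "continuous_on (sphere 0 1) g" and c: "\<And>y. y \<in> sphere 0 1 \<Longrightarrow> \<bar>g y\<bar> \<le> c"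
  shows "Linf_norm g \<le> ereal c"
  unfolding Linf_norm_def
proof (rule esssup_I)
  have "(\<lambda>x. \<bar>g x\<bar>) \<in> borel_measurable sphere_measure"
    by (intro borel_measurable_sphere_measure continuous_intros g)
  then show "(\<lambda>x. ereal \<bar>g x\<bar>) \<in> borel_measurable sphere_measure" by simp
  show "AE x in sphere_measure. ereal \<bar>g x\<bar> \<le> ereal c"
    by (rule AE_I2) (use c in simp)
qed

text \<open>By \<open>sphere_AE_imp_all\<close> an almost sure bound of a continuous function holds
  at every point. Naming the real \<open>b\<close> keeps extended reals out of the later
  estimates.\<close>

lemma Linf_norm_continuous:
  fixes f :: "'a::euclidean_space \<Rightarrow> real"
  assumes f: "continuous_on (sphere 0 1) f"
  obtains b where "Linf_norm f = ereal b" and "\<And>z. z \<in> sphere 0 1 \<Longrightarrow> \<bar>f z\<bar> \<le> b"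
proof -
  obtain B where B: "\<And>x. x \<in> sphere 0 1 \<Longrightarrow> \<bar>f x\<bar> \<le> B" using sphere_bounded[OF f] by blast
  have le: "Linf_norm f \<le> ereal B" by (rule Linf_norm_le[OF f B])
  have c: "continuous_on (sphere 0 1) (\<lambda>x. \<bar>f x\<bar>)" by (intro continuous_intros f)
  have ae: "AE x in sphere_measure. ereal \<bar>f x\<bar> \<le> Linf_norm f"
    unfolding Linf_norm_def by (rule esssup_AE)
  have "Linf_norm f \<noteq> - \<infinity>"
  proof
    assume "Linf_norm f = - \<infinity>"
    with ae have "AE x in (sphere_measure :: 'a measure). False" by simp
    then show False by simp
  qed
  with le obtain b where b: "Linf_norm f = ereal b" by (cases "Linf_norm f") auto
  have "AE x in sphere_measure. \<bar>f x\<bar> \<le> b" using ae unfolding b by simp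
  from sphere_AE_imp_all[OF c this] show ?thesis by (intro that[OF b])
qed

lemma geodist_bounds:
  fixes x y :: "'a::euclidean_space"
  assumes "norm x = 1" "norm y = 1"
  shows "0 \<le> geodist x y" "geodist x y \<le> pi"
proof -
  have "\<bar>x \<bullet> y\<bar> \<le> 1" using Cauchy_Schwarz_ineq2[of x y] assms by simp
  then show "0 \<le> geodist x y" "geodist x y \<le> pi"
    by (auto simp: geodist_def arccos_lbound arccos_ubound)
qed

lemma mesh_norm_bounds:
  fixes xs :: "nat \<Rightarrow> 'a::euclidean_space"
  assumes xs: "\<And>j. j \<in> {1..m} \<Longrightarrow> xs j \<in> sphere 0 1" and m: "m \<ge> 1"
  shows "0 \<le> mesh_norm m xs" "mesh_norm m xs \<le> pi"
proof -
  let ?M = "\<lambda>y. Min ((\<lambda>j. geodist y (xs j)) ` {1..m})"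
  have b: "0 \<le> ?M y" "?M y \<le> pi" if "y \<in> sphere 0 1" for y
  proof -
    have ne: "(\<lambda>j. geodist y (xs j)) ` {1..m} \<noteq> {}" using m by auto
    show "0 \<le> ?M y" using ne geodist_bounds[of y] that xs by (subst Min_ge_iff) auto
    have "?M y \<le> geodist y (xs 1)" using m by (intro Min_le) auto
    also have "\<dots> \<le> pi" using m that xs[of 1] by (intro geodist_bounds) auto
    finally show "?M y \<le> pi" .
  qed
  have x1: "xs 1 \<in> sphere 0 1" using xs m by simp
  show "mesh_norm m xs \<le> pi" unfolding mesh_norm_def by (rule cSUP_least) (use x1 b in auto)
  have "?M (xs 1) \<le> mesh_norm m xs"
    unfolding mesh_norm_def by (rule cSUP_upper[OF x1]) (use b in \<open>auto intro!: bdd_aboveI2[of _ _ pi]\<close>)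
  with b(1)[OF x1] show "0 \<le> mesh_norm m xs" by linarith
qed

lemma separation_radius_bounds:
  fixes xs :: "nat \<Rightarrow> 'a::euclidean_space"
  assumes xs: "\<And>j. j \<in> {1..m} \<Longrightarrow> xs j \<in> sphere 0 1" and m: "m \<ge> 2"
  shows "0 \<le> separation_radius m xs"
    and "i \<in> {1..m} \<Longrightarrow> j \<in> {1..m} \<Longrightarrow> i \<noteq> j \<Longrightarrow> separation_radius m xs \<le> dist (xs i) (xs j)"
proof -
  let ?G = "{geodist (xs i) (xs j) | i j. i \<in> {1..m} \<and> j \<in> {1..m} \<and> i \<noteq> j}"
  have "?G \<subseteq> (\<lambda>(i, j). geodist (xs i) (xs j)) ` ({1..m} \<times> {1..m})" by auto
  then have fin: "finite ?G" by (rule finite_subset) auto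
  have "geodist (xs 1) (xs 2) \<in> ?G" using m by fastforce
  then have ne: "?G \<noteq> {}" by blast
  show "0 \<le> separation_radius m xs"
    unfolding separation_radius_def using fin ne geodist_bounds(1) xs by (auto simp: Min_ge_iff)
  assume ij: "i \<in> {1..m}" "j \<in> {1..m}" "i \<noteq> j"
  then have "Min ?G \<le> geodist (xs i) (xs j)" by (intro Min_le[OF fin]) auto
  moreover have "geodist (xs i) (xs j) \<le> 2 * dist (xs i) (xs j)"
    using geodist_le_dist[of "xs i" "xs j"] xs ij by auto
  ultimately show "separation_radius m xs \<le> dist (xs i) (xs j)"
    unfolding separation_radius_def by simp
qed

theorem corollary4p7:
  fixes d :: nat
    and r s q \<kappa> C\<^sub>1 :: real
    and Z :: "nat \<Rightarrow> nat"
    and Y :: "nat \<Rightarrow> nat \<Rightarrow> 'a::euclidean_space \<Rightarrow> real"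
    and M :: "nat set"
    and x :: "nat \<Rightarrow> nat \<Rightarrow> 'a"
    and w :: "nat \<Rightarrow> nat \<Rightarrow> real"
    and \<delta> \<gamma> :: "nat \<Rightarrow> real"
    and h :: "real \<Rightarrow> real"
    and F :: "nat \<Rightarrow> nat \<Rightarrow> ('a \<Rightarrow> real) \<Rightarrow> 'a \<Rightarrow> real"
  defines "\<delta> \<equiv> \<lambda>m. mesh_norm m (x m)"
    and "\<gamma> \<equiv> \<lambda>m. separation_radius m (x m)"
    and "F \<equiv> \<lambda>m n. filtered_hyperinterpolation Z Y h m (x m) (w m) n"
  assumes "DIM('a) = d + 1" and "d \<ge> 1"
    and "harmonic_onb Z Y"
    and "r > real d / 2" and "s > real d / 2 + r" and "0 \<le> q" and "q < s"
    and "\<kappa> > real d + 1"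
    and "infinite M" and "\<forall>m\<in>M. m \<ge> 1"
    and "\<forall>m\<in>M. \<forall>j\<in>{1..m}. x m j \<in> sphere 0 1"
    and "\<forall>m\<in>M. \<forall>j\<in>{1..m}. w m j > 0"
    and "\<forall>m\<in>M. (\<Sum>j=1..m. w m j) = 1"
    and "\<forall>m\<in>M. sampling_discrepancy m (x m) (w m) \<in> sobolev_space d Z Y (- r) \<and>
           sobolev_norm d Z Y (- r) (sampling_discrepancy m (x m) (w m)) \<le> C\<^sub>1 * \<delta> m powr r"
    and "C_class \<kappa> h"
    and "\<forall>t. 0 \<le> t \<and> t \<le> 1 \<longrightarrow> h t = 1" and "\<forall>t\<ge>2. h t = 0"
  shows
    "(\<exists>C>0. \<forall>m\<in>M. \<forall>n\<ge>1. \<forall>f\<in>sobolev_functions d Z Y s.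
        distribution_of (\<lambda>y. f y - F m n f y) \<in> sobolev_space d Z Y q \<and>
        sobolev_norm d Z Y q (distribution_of (\<lambda>y. f y - F m n f y))
          \<le> C * (real n powr (- (s - q)) + \<delta> m powr r * real n powr (r + q))
              * sobolev_norm d Z Y s (distribution_of f))
     \<and>
     (\<forall>n :: nat \<Rightarrow> nat. \<forall>c\<^sub>1>0. \<forall>c\<^sub>2>0.
        (\<forall>m\<in>M. n m \<ge> 1 \<and> c\<^sub>1 * \<delta> m powr (- r / (s + r)) \<le> real (n m) \<and>
                real (n m) \<le> c\<^sub>2 * \<delta> m powr (- r / (s + r))) \<longrightarrow>
        (\<exists>C'>0. \<forall>m\<in>M. \<forall>f\<in>sobolev_functions d Z Y s.
           distribution_of (\<lambda>y. f y - F m (n m) f y) \<in> sobolev_space d Z Y q \<and>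
           sobolev_norm d Z Y q (distribution_of (\<lambda>y. f y - F m (n m) f y))
             \<le> C' * \<delta> m powr (r * (s - q) / (s + r)) * sobolev_norm d Z Y s (distribution_of f)))
     \<and>
     (\<forall>C\<^sub>0 C\<^sub>2.
        (\<forall>m\<in>M. m \<ge> 2 \<and> \<delta> m \<le> C\<^sub>0 * \<gamma> m \<and> (\<forall>j\<in>{1..m}. w m j \<le> C\<^sub>2 * \<delta> m ^ d)) \<longrightarrow>
        (\<forall>C\<^sub>3>0. \<exists>C''>0. \<forall>m\<in>M. \<forall>n\<ge>1. \<forall>f.
           continuous_on (sphere 0 1) f \<and> real n \<le> C\<^sub>3 * inverse (\<delta> m) \<longrightarrow>
           Linf_norm (F m n f) \<le> ereal C'' * Linf_norm f))"
proof -
  note dim = \<open>DIM('a) = d + 1\<close> and d1 = \<open>d \<ge> 1\<close> and onb = \<open>harmonic_onb Z Y\<close>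
    and rd = \<open>r > real d / 2\<close> and sd = \<open>s > real d / 2 + r\<close> and q0 = \<open>0 \<le> q\<close> and qs = \<open>q < s\<close>
    and \<kappa>d = \<open>\<kappa> > real d + 1\<close> and M1 = \<open>\<forall>m\<in>M. m \<ge> 1\<close>
    and xS = \<open>\<forall>m\<in>M. \<forall>j\<in>{1..m}. x m j \<in> sphere 0 1\<close>
    and wpos = \<open>\<forall>m\<in>M. \<forall>j\<in>{1..m}. w m j > 0\<close> and wsum = \<open>\<forall>m\<in>M. (\<Sum>j=1..m. w m j) = 1\<close>
    and disc = \<open>\<forall>m\<in>M. sampling_discrepancy m (x m) (w m) \<in> sobolev_space d Z Y (- r) \<and>
           sobolev_norm d Z Y (- r) (sampling_discrepancy m (x m) (w m)) \<le> C\<^sub>1 * \<delta> m powr r\<close>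
    and hC = \<open>C_class \<kappa> h\<close> and h1 = \<open>\<forall>t. 0 \<le> t \<and> t \<le> 1 \<longrightarrow> h t = 1\<close> and h2 = \<open>\<forall>t\<ge>2. h t = 0\<close>
  interpret sphere_basis d Z Y by unfold_locales (fact dim d1 onb)+
  have samp: "sphere_sampling d Z Y m (x m) (w m)" if "m \<in> M" for m
    using xS wpos wsum that by unfold_locales auto
  have "0 \<le> real d / 2" by simp
  then have r0: "r \<ge> 0" and sr: "s + r > 0" using rd sd by linarith+
  have \<delta>b: "0 \<le> \<delta> m" "\<delta> m \<le> pi" if "m \<in> M" for m
    unfolding \<delta>_def using mesh_norm_bounds[of m "x m"] xS M1 that by auto
  obtain H where H: "H \<ge> 1" "\<And>t. t \<ge> 0 \<Longrightarrow> \<bar>h t\<bar> \<le> H"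
  proof -
    have \<kappa>0: "real 0 \<le> \<kappa>" using \<kappa>d by simp
    show ?thesis
    proof (rule C_class_derivatives[OF hC h2 \<kappa>0])
      fix D :: "nat \<Rightarrow> real \<Rightarrow> real" and C
      assume C: "1 \<le> C" and D: "\<And>t. 0 \<le> t \<Longrightarrow> D 0 t = h t" "\<And>i t. i \<le> 0 \<Longrightarrow> 0 \<le> t \<Longrightarrow> \<bar>D i t\<bar> \<le> C"
      have "\<bar>h t\<bar> \<le> C" if "t \<ge> 0" for t using D(1)[OF that] D(2)[OF order_refl that] by simp
      with C show ?thesis by (intro that[of C])
    qed
  qed
  \<comment> \<open>The absolute value is there because no sign of \<open>C\<^sub>1\<close> is
    assumed.\<close>
  define X where "X = \<bar>C\<^sub>1 * sphere_sampling.product_const d r s * (9 * real (d + 1)) powr ((r + q) / 2) * H\<bar>"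
  define CC where "CC = sqrt 2 * (2 * H + X) + 1"
  have X0: "0 \<le> X" by (simp add: X_def)
  have CC: "CC > 0" using H(1) X0 by (simp add: CC_def add_nonneg_pos)
  have main: "distribution_of (\<lambda>y. f y - F m n f y) \<in> sobolev_space d Z Y q"
    "sobolev_norm d Z Y q (distribution_of (\<lambda>y. f y - F m n f y))
          \<le> CC * (real n powr (- (s - q)) + \<delta> m powr r * real n powr (r + q))
              * sobolev_norm d Z Y s (distribution_of f)"
    if m: "m \<in> M" and n: "n \<ge> 1" and f: "f \<in> sobolev_functions d Z Y s" for m n f
  proof -
    interpret sphere_sampling d Z Y m "x m" "w m" by (rule samp[OF m])
    have cf: "continuous_on S f" and sm: "summable (\<lambda>l. weight l powr s * energy f l)"
      using f by (auto simp: sobolev_functions_def sobolev_space_def sobolev_term_eq[abs_def])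
    have dm: "sampling_discrepancy m (x m) (w m) \<in> sobolev_space d Z Y (- r)"
      "sobolev_norm d Z Y (- r) (sampling_discrepancy m (x m) (w m)) \<le> C\<^sub>1 * \<delta> m powr r"
      using disc m by blast+
    note err = fhyp_error[OF dm cf sm r0 sd q0 qs n h2 _ H(2)]
    show "distribution_of (\<lambda>y. f y - F m n f y) \<in> sobolev_space d Z Y q"
      unfolding F_def by (rule err(1)) (use h1 in auto)
    let ?a = "real n powr (- (s - q))" and ?b = "\<delta> m powr r * real n powr (r + q)"
    let ?nf = "sobolev_norm d Z Y s (distribution_of f)"
    have nf0: "0 \<le> ?nf" using f by (intro sobolev_norm_nonneg) (simp add: sobolev_functions_def)
    have "sobolev_norm d Z Y q (distribution_of (\<lambda>y. f y - F m n f y))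
      \<le> sqrt 2 * (2 * H * ?a + C\<^sub>1 * \<delta> m powr r * product_const r s * (9 * real (d + 1)) powr ((r + q) / 2) * H * real n powr (r + q)) * ?nf"
      unfolding F_def by (rule err(2)) (use h1 in auto)
    also have "\<dots> = sqrt 2 * (2 * H * ?a + (C\<^sub>1 * product_const r s * (9 * real (d + 1)) powr ((r + q) / 2) * H) * ?b) * ?nf"
      by (simp add: mult_ac)
    also have "\<dots> \<le> sqrt 2 * (2 * H * ?a + X * ?b) * ?nf"
      unfolding X_def using nf0 by (intro mult_right_mono mult_left_mono add_left_mono abs_ge_self) auto
    also have "\<dots> \<le> CC * (?a + ?b) * ?nf"
    proof (intro mult_right_mono nf0)
      have ab: "0 \<le> ?a" "0 \<le> ?b" by auto
      have "2 * H * ?a + X * ?b \<le> (2 * H + X) * (?a + ?b)"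
        using ab H(1) X0 by (simp add: distrib_left distrib_right)
      then have "sqrt 2 * (2 * H * ?a + X * ?b) \<le> sqrt 2 * ((2 * H + X) * (?a + ?b))"
        by (intro mult_left_mono) auto
      also have "\<dots> \<le> CC * (?a + ?b)"
        using ab by (simp add: CC_def algebra_simps)
      finally show "sqrt 2 * (2 * H * ?a + X * ?b) \<le> CC * (?a + ?b)" .
    qed
    finally show "sobolev_norm d Z Y q (distribution_of (\<lambda>y. f y - F m n f y)) \<le> CC * (?a + ?b) * ?nf" .
  qed
  show ?thesis
  proof (intro conjI allI impI)
    show "\<exists>C>0. \<forall>m\<in>M. \<forall>n\<ge>1. \<forall>f\<in>sobolev_functions d Z Y s.
        distribution_of (\<lambda>y. f y - F m n f y) \<in> sobolev_space d Z Y q \<and>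
        sobolev_norm d Z Y q (distribution_of (\<lambda>y. f y - F m n f y))
          \<le> C * (real n powr (- (s - q)) + \<delta> m powr r * real n powr (r + q))
              * sobolev_norm d Z Y s (distribution_of f)"
      using main CC by (intro exI[of _ CC]) blast
  next
    fix n :: "nat \<Rightarrow> nat" and c\<^sub>1 c\<^sub>2 :: real
    assume c: "0 < c\<^sub>1" "0 < c\<^sub>2" and nm: "\<forall>m\<in>M. n m \<ge> 1 \<and> c\<^sub>1 * \<delta> m powr (- r / (s + r)) \<le> real (n m) \<and>
                real (n m) \<le> c\<^sub>2 * \<delta> m powr (- r / (s + r))"
    define C' where "C' = CC * (c\<^sub>1 powr (- (s - q)) + c\<^sub>2 powr (r + q))"
    have C': "C' > 0" using CC c by (simp add: C'_def add_pos_pos)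
    \<comment> \<open>The choice of \<open>n\<close> balances the two terms, since
      \<open>r - r * (r + q) / (s + r) = r * (s - q) / (s + r)\<close>.\<close>
    have rate: "real (n m) powr (- (s - q)) + \<delta> m powr r * real (n m) powr (r + q)
        \<le> (c\<^sub>1 powr (- (s - q)) + c\<^sub>2 powr (r + q)) * \<delta> m powr (r * (s - q) / (s + r))" if m: "m \<in> M" for m
    proof -
      define D where "D = \<delta> m"
      have n1: "real (n m) \<ge> 1" and lo: "c\<^sub>1 * D powr (- r / (s + r)) \<le> real (n m)"
        and hi: "real (n m) \<le> c\<^sub>2 * D powr (- r / (s + r))"
        using nm m by (auto simp: D_def)
      \<comment> \<open>For \<open>D = 0\<close> the upper bound would read
        \<open>n m \<le> 0\<close>, as \<open>0 powr a = 0\<close>.\<close>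
      have "D \<noteq> 0" using n1 hi by auto
      then have D: "D > 0" using \<delta>b(1)[OF m] by (simp add: D_def)
      have "real (n m) powr (- (s - q)) \<le> (c\<^sub>1 * D powr (- r / (s + r))) powr (- (s - q))"
        using lo c D qs by (intro powr_mono2') auto
      also have "\<dots> = c\<^sub>1 powr (- (s - q)) * D powr (- r / (s + r) * (- (s - q)))"
        using c D by (simp add: powr_mult powr_powr)
      also have "- r / (s + r) * (- (s - q)) = r * (s - q) / (s + r)"
        using sr by (simp add: field_simps)
      finally have 1: "real (n m) powr (- (s - q)) \<le> c\<^sub>1 powr (- (s - q)) * D powr (r * (s - q) / (s + r))" .
      have "real (n m) powr (r + q) \<le> (c\<^sub>2 * D powr (- r / (s + r))) powr (r + q)"
        using hi n1 r0 q0 by (intro powr_mono2) auto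
      also have "\<dots> = c\<^sub>2 powr (r + q) * D powr (- r / (s + r) * (r + q))"
        using c D by (simp add: powr_mult powr_powr)
      finally have "D powr r * real (n m) powr (r + q) \<le> D powr r * (c\<^sub>2 powr (r + q) * D powr (- r / (s + r) * (r + q)))"
        by (intro mult_left_mono) auto
      also have "\<dots> = c\<^sub>2 powr (r + q) * D powr (r + - r / (s + r) * (r + q))"
        by (simp only: powr_add mult_ac)
      also have "r + - r / (s + r) * (r + q) = r * (s - q) / (s + r)"
        using sr by (simp add: field_simps)
      finally show ?thesis using 1 by (simp add: D_def distrib_right)
    qed
    show "\<exists>C'>0. \<forall>m\<in>M. \<forall>f\<in>sobolev_functions d Z Y s.
           distribution_of (\<lambda>y. f y - F m (n m) f y) \<in> sobolev_space d Z Y q \<and>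
           sobolev_norm d Z Y q (distribution_of (\<lambda>y. f y - F m (n m) f y))
             \<le> C' * \<delta> m powr (r * (s - q) / (s + r)) * sobolev_norm d Z Y s (distribution_of f)"
    proof (intro exI[of _ C'] conjI ballI C')
      fix m f assume m: "m \<in> M" and f: "f \<in> sobolev_functions d Z Y s"
      have n1: "n m \<ge> 1" using nm m by blast
      show "distribution_of (\<lambda>y. f y - F m (n m) f y) \<in> sobolev_space d Z Y q"
        by (rule main(1)[OF m n1 f])
      have nf0: "0 \<le> sobolev_norm d Z Y s (distribution_of f)"
        using f by (intro sobolev_norm_nonneg) (simp add: sobolev_functions_def)
      have "CC * (real (n m) powr (- (s - q)) + \<delta> m powr r * real (n m) powr (r + q))
          \<le> CC * ((c\<^sub>1 powr (- (s - q)) + c\<^sub>2 powr (r + q)) * \<delta> m powr (r * (s - q) / (s + r)))"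
        using CC by (intro mult_left_mono rate m) auto
      also have "\<dots> = C' * \<delta> m powr (r * (s - q) / (s + r))" by (simp add: C'_def)
      finally show "sobolev_norm d Z Y q (distribution_of (\<lambda>y. f y - F m (n m) f y))
             \<le> C' * \<delta> m powr (r * (s - q) / (s + r)) * sobolev_norm d Z Y s (distribution_of f)"
        using main(2)[OF m n1 f] nf0 by (meson mult_right_mono order_trans)
    qed
  next
    fix C\<^sub>0 C\<^sub>2 C\<^sub>3 :: real
    assume hyp: "\<forall>m\<in>M. m \<ge> 2 \<and> \<delta> m \<le> C\<^sub>0 * \<gamma> m \<and> (\<forall>j\<in>{1..m}. w m j \<le> C\<^sub>2 * \<delta> m ^ d)"
      and C3: "0 < C\<^sub>3"
    \<comment> \<open>The 8 makes \<open>e = \<delta> m / c\<close> at most \<open>1 / 2\<close>, as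
      \<open>\<delta> m \<le> pi < 4\<close>. The factor \<open>max C\<^sub>0 1\<close> gives
      \<open>2 * e \<le> \<gamma> m\<close> by quasi-uniformity and keeps \<open>c\<close> positive
      whatever the sign of \<open>C\<^sub>0\<close>.\<close>
    define c where "c = 8 * max C\<^sub>0 1"
    have c: "c \<ge> 8" "4 * C\<^sub>0 \<le> c" by (auto simp: c_def)
    \<comment> \<open>Turns the weight bound \<open>C\<^sub>2 * \<delta> m ^ d\<close> into one in
      terms of \<open>e\<close>, as \<open>\<delta> m = c * e\<close>.\<close>
    define A where "A = \<bar>C\<^sub>2\<bar> * c ^ d"
    have A0: "A \<ge> 0" and K0: "C\<^sub>3 / c \<ge> 0" using c C3 by (simp_all add: A_def)
    show "\<exists>C''>0. \<forall>m\<in>M. \<forall>n\<ge>1. \<forall>f.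
           continuous_on (sphere 0 1) f \<and> real n \<le> C\<^sub>3 * inverse (\<delta> m) \<longrightarrow>
           Linf_norm (F m n f) \<le> ereal C'' * Linf_norm f"
    proof (rule filter_kernel_sum_bounded[OF hC h2 h1 \<kappa>d K0 A0])
      fix C :: real
      assume C: "C > 0" and bound: "\<And>(J :: nat set) xs w n e y. finite J \<Longrightarrow> \<forall>j\<in>J. xs j \<in> S
      \<Longrightarrow> \<forall>i\<in>J. \<forall>j\<in>J. i \<noteq> j \<longrightarrow> 2 * e \<le> dist (xs i) (xs j)
      \<Longrightarrow> 0 < e \<Longrightarrow> e \<le> 1 / 2 \<Longrightarrow> n \<ge> 1 \<Longrightarrow> real n * e \<le> C\<^sub>3 / c
      \<Longrightarrow> \<forall>j\<in>J. 0 \<le> w j \<and> w j \<le> A * e ^ d \<Longrightarrow> y \<in> S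
      \<Longrightarrow> (\<Sum>j\<in>J. w j * \<bar>filter_kernel Z Y h n y (xs j)\<bar>) \<le> C"
      show ?thesis
      proof (intro exI[of _ C] conjI ballI allI impI C)
        fix m n :: nat and f :: "'a \<Rightarrow> real"
        assume m: "m \<in> M" and n: "1 \<le> n" and f: "continuous_on (sphere 0 1) f \<and> real n \<le> C\<^sub>3 * inverse (\<delta> m)"
        interpret sphere_sampling d Z Y m "x m" "w m" by (rule samp[OF m])
        obtain b where b: "Linf_norm f = ereal b" "\<And>z. z \<in> S \<Longrightarrow> \<bar>f z\<bar> \<le> b"
          using Linf_norm_continuous f by blast
        \<comment> \<open>With \<open>inverse 0 = 0\<close>, a vanishing mesh norm would force
          \<open>n = 0\<close>.\<close>
        have "\<delta> m \<noteq> 0" using f n by auto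
        then have \<delta>0: "\<delta> m > 0" using \<delta>b(1)[OF m] by simp
        define e where "e = \<delta> m / c"
        have e: "0 < e" using \<delta>0 c by (simp add: e_def)
        have e2: "e \<le> 1 / 2"
        proof -
          have "\<delta> m \<le> 4" using \<delta>b(2)[OF m] pi_less_4 by linarith
          then show ?thesis using c(1) by (simp add: e_def field_simps)
        qed
        have ne: "real n * e \<le> C\<^sub>3 / c"
        proof -
          have "real n * \<delta> m \<le> C\<^sub>3" using f \<delta>0 by (simp add: field_simps)
          then show ?thesis using c(1) by (simp add: e_def divide_right_mono)
        qed
        have m2: "m \<ge> 2" and qu: "\<delta> m \<le> C\<^sub>0 * \<gamma> m" and wle: "\<And>j. j \<in> {1..m} \<Longrightarrow> w m j \<le> C\<^sub>2 * \<delta> m ^ d"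
          using hyp m by blast+
        have \<gamma>0: "0 \<le> \<gamma> m" unfolding \<gamma>_def by (rule separation_radius_bounds(1)[OF xs m2])
        have sep: "\<forall>i\<in>{1..m}. \<forall>j\<in>{1..m}. i \<noteq> j \<longrightarrow> 2 * e \<le> dist (x m i) (x m j)"
        proof (intro ballI impI)
          fix i j assume "i \<in> {1..m}" "j \<in> {1..m}" "i \<noteq> j"
          then have "\<gamma> m \<le> dist (x m i) (x m j)" 
            unfolding \<gamma>_def using separation_radius_bounds(2)[of m "x m" i j] xs m2 by blast
          moreover have "2 * \<delta> m \<le> c * \<gamma> m"
          proof -
            have "4 * C\<^sub>0 * \<gamma> m \<le> c * \<gamma> m" using c(2) \<gamma>0 by (rule mult_right_mono)
            then show ?thesis using qu \<delta>0 by linarith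
          qed
          then have "2 * e \<le> \<gamma> m" using c(1) by (simp add: e_def field_simps)
          ultimately show "2 * e \<le> dist (x m i) (x m j)" by linarith
        qed
        have wA: "\<forall>j\<in>{1..m}. 0 \<le> w m j \<and> w m j \<le> A * e ^ d"
        proof (intro ballI conjI)
          fix j assume j: "j \<in> {1..m}"
          show "0 \<le> w m j" using ws[OF j] by simp
          have "w m j \<le> C\<^sub>2 * \<delta> m ^ d" by (rule wle[OF j])
          also have "\<dots> \<le> \<bar>C\<^sub>2\<bar> * \<delta> m ^ d" using \<delta>0 by (intro mult_right_mono) auto
          also have "\<delta> m ^ d = c ^ d * e ^ d"
            using c(1) by (simp add: e_def power_mult_distrib[symmetric])
          finally show "w m j \<le> A * e ^ d" by (simp add: A_def mult.assoc)
        qed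
        have "Linf_norm (F m n f) \<le> ereal (C * b)"
        proof (rule Linf_norm_le)
          show "continuous_on (sphere 0 1) (F m n f)"
            unfolding F_def using f by (intro continuous_on_fhyp[OF h2 n]) auto
          fix y :: 'a assume y: "y \<in> sphere 0 1"
          have "\<bar>F m n f y\<bar> \<le> (\<Sum>j=1..m. b * (w m j * \<bar>filter_kernel Z Y h n y (x m j)\<bar>))"
            unfolding F_def filtered_hyperinterpolation_def
          proof (intro order_trans[OF sum_abs] sum_mono)
            fix j assume j: "j \<in> {1..m}"
            have "\<bar>w m j * f (x m j) * filter_kernel Z Y h n y (x m j)\<bar>
                = \<bar>f (x m j)\<bar> * (w m j * \<bar>filter_kernel Z Y h n y (x m j)\<bar>)"
              using ws[OF j] by (simp add: abs_mult)
            also have "\<dots> \<le> b * (w m j * \<bar>filter_kernel Z Y h n y (x m j)\<bar>)"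
              using b(2)[OF xs[OF j]] ws[OF j] by (intro mult_right_mono) auto
            finally show "\<bar>w m j * f (x m j) * filter_kernel Z Y h n y (x m j)\<bar>
                \<le> b * (w m j * \<bar>filter_kernel Z Y h n y (x m j)\<bar>)" .
          qed
          also have "\<dots> = b * (\<Sum>j=1..m. w m j * \<bar>filter_kernel Z Y h n y (x m j)\<bar>)"
            by (simp add: sum_distrib_left)
          also have "\<dots> \<le> b * C"
          proof (rule mult_left_mono)
            show "(\<Sum>j=1..m. w m j * \<bar>filter_kernel Z Y h n y (x m j)\<bar>) \<le> C"
              by (rule bound[OF _ _ sep e e2 n ne wA y]) (use xs in auto)
            show "0 \<le> b" using b(2)[OF y] by simp
          qed
          finally show "\<bar>F m n f y\<bar> \<le> C * b" by (simp add: mult.commute)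
        qed
        then show "Linf_norm (F m n f) \<le> ereal C * Linf_norm f" unfolding b by simp
      qed
    qed
  qed
qed

end
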